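(* Let $\bar A=(A_0,A_1)$ be a compatible couple of (quasi-)Banach spaces with $A_0\cap A_1\neq\{0\}$. Let $0<q_1,r_1\le\infty$ and $a_1,b_1\in SV$ be such that $\|s^{-1/r_1}b_1(s)\|_{r_1,(1,\infty)}<\infty$ and $\left\|s^{-1/r_1}b_1(s)\|u^{-1/q_1}a_1(u)\|_{q_1,(0,s)}\right\|_{r_1,(0,1)}<\infty$, and put $$\chi_1(t)=\left\|s^{-1/r_1}b_1(s)\|u^{-1/q_1}a_1(u)\|_{q_1,(0,s)}\right\|_{r_1,(0,t)}+\|s^{-1/r_1}b_1(s)\|_{r_1,(t,\infty)}\|u^{-1/q_1}a_1(u)\|_{q_1,(0,t)}.$$ Let $0<r,r_0\le\infty$, $a,b_0\in SV$, and $\|u^{-1/r_0}b_0(u)\|_{r_0,(1,\infty)}<\infty$. Put $\chi_0(t)=\|u^{-1/r_0}b_0(u)\|_{r_0,(t,\infty)}$ and $\rho(t)=t\frac{\chi_0(t)}{\chi_1(t)}$. For given $0\le\theta\le1$ denote $a^{\#}=\chi_0^{1-\theta}\chi_1^{\theta}\,(a\circ\rho)$. (i) If $0<\theta<1$, then $\left(\bar A_{0,r_0,b_0},\bar A^{\mathcal L}_{1,r_1,b_1,q_1,a_1}\right)_{\theta,r,a}=\bar A_{\theta,r,a^{\#}}$. (ii) If $\|s^{-1/r}a(s)\|_{r,(1,\infty)}<\infty$, then, with $\theta=0$ (i.e. $a^{\#}=\chi_0\,(a\circ\rho)$), $\left(\bar A_{0,r_0,b_0},\bar A^{\mathcal L}_{1,r_1,b_1,q_1,a_1}\right)_{0,r,a}=\bar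 A_{0,r,a^{\#}}\cap\bar A^{\mathcal L}_{0,r,a\circ\rho,r_0,b_0}$. (iii) If $\|s^{-1/r}a(s)\|_{r,(0,1)}<\infty$, then, with $\theta=1$ (i.e. $a^{\#}=\chi_1\,(a\circ\rho)$), $\left(\bar A_{0,r_0,b_0},\bar A^{\mathcal L}_{1,r_1,b_1,q_1,a_1}\right)_{1,r,a}=\bar A_{1,r,a^{\#}}\cap\bar A^{\mathcal L,\mathcal R}_{1,r,a\circ\rho,r_1,b_1,q_1,a_1}$.
   Context: Conventions: $1/\infty=0$; $\|\cdot\|_{q,(a,b)}$ is the usual (quasi-)norm of $L_q$ on the interval $(a,b)$, $0<q\le\infty$. Two positive functions satisfy $f\approx g$ (are equivalent) if $C^{-1}g\le f\le Cg$ for some constant $C>0$ independent of all significant quantities. $b\in SV$ (slowly varying) means that $b$ is a positive Lebesgue measurable function on $(0,\infty)$ such that for each $\varepsilon>0$ the function $t^{\varepsilon}b(t)$ is equivalent to an increasing function and $t^{-\varepsilon}b(t)$ is equivalent to a decreasing function. For a compatible couple $(X_0,X_1)$ of (quasi-)normed spaces, $K(t,f;X_0,X_1)=\inf\{\|f_0\|_{X_0}+t\|f_1\|_{X_1}: f=f_0+f_1,\ f_i\in X_i\}$ for $f\in X_0+X_1$, $t>0$; $K(t,f):=K(t,f;A_0,A_1)$. For $0\le\theta\le1$, $0<q\le\infty$, $b\in SV$, $(X_0,X_1)_{\theta,q,b}$ is the space of all $f\in X_0+X_1$ with finite (quasi-)norm $\|u^{-\theta-1/q}b(u)K(u,f;X_0,X_1)\|_{q,(0,\infty)}$,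 and $\bar A_{\theta,q,b}:=(A_0,A_1)_{\theta,q,b}$. For $0<p,r,q\le\infty$ and $a,b,c\in SV$, the following are the spaces of all $f\in A_0+A_1$ with finite (quasi-)norm: - $\bar A^{\mathcal L}_{\theta,r,b,q,a}$: $\left\|t^{-1/r}b(t)\|u^{-\theta-1/q}a(u)K(u,f)\|_{q,(0,t)}\right\|_{r,(0,\infty)}$; - $\bar A^{\mathcal L,\mathcal R}_{\theta,p,c,r,b,q,a}$: $\left\|t^{-1/p}c(t)\left\|u^{-1/r}b(u)\|v^{-\theta-1/q}a(v)K(v,f)\|_{q,(t,u)}\right\|_{r,(t,\infty)}\right\|_{p,(0,\infty)}$. Equality of (quasi-)normed spaces means that each is continuously embedded in the other; intersections carry the maximum (equivalently, the sum) of the (quasi-)norms. Standing assumption: none of the spaces under consideration is $\{0\}$. *)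

theory Defs
  imports "HOL-Analysis.Analysis" "HOL-Library.Set_Algebras"
begin

section \<open>Lebesgue quasi-norms and slowly varying functions\<close>

definition ennreal_powr :: "ennreal \<Rightarrow> real \<Rightarrow> ennreal" where
  "ennreal_powr x p = (if x = top then top else ennreal (enn2real x powr p))"

(* The exponent q ranges over (0, \<infinity>] and is coded as an extended non-negative real;
   recip q is the number 1/q, with 1/\<infinity> = 0. *)
definition recip :: "ennreal \<Rightarrow> real" where
  "recip q = enn2real (1 / q)"

(* For q = \<infinity> this is the essential supremum, written without a measurability test on f,
   so that the value is not \<infinity> by default for a non-measurable f. This matters for weights
   of the form a \<circ> \<rho>: a is Lebesgue measurable, but a \<circ> \<rho> is in general only equivalent
   to a measurable function. *)
definition Lnorm :: "ennreal \<Rightarrow> real set \<Rightarrow> (real \<Rightarrow> ennreal) \<Rightarrow> ennreal" where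
  "Lnorm q S f =
     (if q = top then Inf {C. AE x in lebesgue_on S. f x \<le> C}
      else ennreal_powr (\<integral>\<^sup>+ x. ennreal_powr (f x) (enn2real q) \<partial>lebesgue_on S) (recip q))"

definition equivalent_pos :: "(real \<Rightarrow> real) \<Rightarrow> (real \<Rightarrow> real) \<Rightarrow> bool" where
  "equivalent_pos f g \<longleftrightarrow> (\<exists>C>0. \<forall>t>0. g t / C \<le> f t \<and> f t \<le> C * g t)"

definition SV :: "(real \<Rightarrow> real) set" where
  "SV = {b. b \<in> borel_measurable (lebesgue_on {0<..}) \<and> (\<forall>t>0. 0 < b t) \<and>
     (\<forall>\<epsilon>>0.
        (\<exists>g. (\<forall>t>0. 0 < g t) \<and> mono_on {0<..} g \<and>
             equivalent_pos (\<lambda>t. t powr \<epsilon> * b t) g) \<and>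
        (\<exists>g. (\<forall>t>0. 0 < g t) \<and> antimono_on {0<..} g \<and>
             equivalent_pos (\<lambda>t. t powr (- \<epsilon>) * b t) g))}"

section \<open>Quasi-normed spaces and compatible couples\<close>

(* A space is a set of vectors of an ambient vector space together with a functional;
   the values of the functional outside the set are irrelevant. *)
record 'v qspace =
  elems :: "'v set"
  qnorm :: "'v \<Rightarrow> ennreal"

definition quasi_normed :: "'v::real_vector qspace \<Rightarrow> bool" where
  "quasi_normed X \<longleftrightarrow>
     subspace (elems X) \<and>
     (\<forall>x\<in>elems X. qnorm X x < top) \<and>
     (\<forall>x\<in>elems X. qnorm X x = 0 \<longleftrightarrow> x = 0) \<and>
     (\<forall>x\<in>elems X. \<forall>c. qnorm X (c *\<^sub>R x) = ennreal \<bar>c\<bar> * qnorm X x) \<and>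
     (\<exists>C::real. \<forall>x\<in>elems X. \<forall>y\<in>elems X.
        qnorm X (x + y) \<le> ennreal C * (qnorm X x + qnorm X y))"

definition quasi_complete :: "'v::real_vector qspace \<Rightarrow> bool" where
  "quasi_complete X \<longleftrightarrow>
     (\<forall>x::nat \<Rightarrow> 'v. (\<forall>n. x n \<in> elems X) \<and>
        (\<forall>\<epsilon>>0. \<exists>M. \<forall>m\<ge>M. \<forall>n\<ge>M. qnorm X (x m - x n) < \<epsilon>) \<longrightarrow>
        (\<exists>l\<in>elems X. (\<lambda>n. qnorm X (x n - l)) \<longlonglongrightarrow> 0))"

definition quasi_banach :: "'v::real_vector qspace \<Rightarrow> bool" where
  "quasi_banach X \<longleftrightarrow> quasi_normed X \<and> quasi_complete X"

definition hausdorff_tvs :: "'v::real_vector topology \<Rightarrow> bool" where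
  "hausdorff_tvs T \<longleftrightarrow>
     topspace T = UNIV \<and> Hausdorff_space T \<and>
     continuous_map (prod_topology T T) T (\<lambda>(x, y). x + y) \<and>
     continuous_map (prod_topology euclideanreal T) T (\<lambda>(c, x). c *\<^sub>R x)"

(* Continuity at 0, which for the (linear) inclusion is continuity. *)
definition embeds_in_topology :: "'v::real_vector qspace \<Rightarrow> 'v topology \<Rightarrow> bool" where
  "embeds_in_topology X T \<longleftrightarrow>
     (\<forall>U. openin T U \<and> 0 \<in> U \<longrightarrow> (\<exists>\<epsilon>>0. \<forall>x\<in>elems X. qnorm X x < \<epsilon> \<longrightarrow> x \<in> U))"

definition compatible_couple :: "'v::real_vector qspace \<Rightarrow> 'v qspace \<Rightarrow> bool" where
  "compatible_couple X0 X1 \<longleftrightarrow>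
     (\<exists>T. hausdorff_tvs T \<and> embeds_in_topology X0 T \<and> embeds_in_topology X1 T)"

definition embedded :: "'v qspace \<Rightarrow> 'v qspace \<Rightarrow> bool" where
  "embedded X Y \<longleftrightarrow> elems X \<subseteq> elems Y \<and>
     (\<exists>C::real. \<forall>f\<in>elems X. qnorm Y f \<le> ennreal C * qnorm X f)"

definition same_space :: "'v qspace \<Rightarrow> 'v qspace \<Rightarrow> bool" where
  "same_space X Y \<longleftrightarrow> embedded X Y \<and> embedded Y X"

definition inter_space :: "'v qspace \<Rightarrow> 'v qspace \<Rightarrow> 'v qspace" where
  "inter_space X Y =
     \<lparr>elems = elems X \<inter> elems Y, qnorm = (\<lambda>f. max (qnorm X f) (qnorm Y f))\<rparr>"

section \<open>Interpolation spaces\<close>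

definition K_fun :: "'v::real_vector qspace \<Rightarrow> 'v qspace \<Rightarrow> real \<Rightarrow> 'v \<Rightarrow> ennreal" where
  "K_fun X0 X1 t f =
     Inf {qnorm X0 f0 + ennreal t * qnorm X1 f1 | f0 f1.
            f0 \<in> elems X0 \<and> f1 \<in> elems X1 \<and> f = f0 + f1}"

definition finite_part ::
  "'v::real_vector qspace \<Rightarrow> 'v qspace \<Rightarrow> ('v \<Rightarrow> ennreal) \<Rightarrow> 'v qspace" where
  "finite_part X0 X1 N = \<lparr>elems = {f \<in> elems X0 + elems X1. N f < top}, qnorm = N\<rparr>"

(* (X0, X1)_{\<theta>,q,b} *)
definition interp_space ::
  "'v::real_vector qspace \<Rightarrow> 'v qspace \<Rightarrow> real \<Rightarrow> ennreal \<Rightarrow> (real \<Rightarrow> real) \<Rightarrow> 'v qspace" where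
  "interp_space X0 X1 \<theta> q b = finite_part X0 X1
     (\<lambda>f. Lnorm q {0<..} (\<lambda>u. ennreal (u powr (- \<theta> - recip q) * b u) * K_fun X0 X1 u f))"

(* The L-space with parameters \<theta>,r,b,q,a *)
definition L_space ::
  "'v::real_vector qspace \<Rightarrow> 'v qspace \<Rightarrow> real \<Rightarrow>
   ennreal \<Rightarrow> (real \<Rightarrow> real) \<Rightarrow> ennreal \<Rightarrow> (real \<Rightarrow> real) \<Rightarrow> 'v qspace" where
  "L_space X0 X1 \<theta> r b q a = finite_part X0 X1
     (\<lambda>f. Lnorm r {0<..} (\<lambda>t. ennreal (t powr (- recip r) * b t) *
        Lnorm q {0<..<t} (\<lambda>u. ennreal (u powr (- \<theta> - recip q) * a u) * K_fun X0 X1 u f)))"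

(* The L,R-space with parameters \<theta>,p,c,r,b,q,a *)
definition LR_space ::
  "'v::real_vector qspace \<Rightarrow> 'v qspace \<Rightarrow> real \<Rightarrow>
   ennreal \<Rightarrow> (real \<Rightarrow> real) \<Rightarrow> ennreal \<Rightarrow> (real \<Rightarrow> real) \<Rightarrow> ennreal \<Rightarrow> (real \<Rightarrow> real) \<Rightarrow> 'v qspace" where
  "LR_space X0 X1 \<theta> p c r b q a = finite_part X0 X1
     (\<lambda>f. Lnorm p {0<..} (\<lambda>t. ennreal (t powr (- recip p) * c t) *
        Lnorm r {t<..} (\<lambda>u. ennreal (u powr (- recip r) * b u) *
          Lnorm q {t<..<u} (\<lambda>v. ennreal (v powr (- \<theta> - recip q) * a v) * K_fun X0 X1 v f))))"

(* \<parallel>s^{-1/q} b(s)\<parallel>_{q,S} *)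
definition wnorm :: "ennreal \<Rightarrow> (real \<Rightarrow> real) \<Rightarrow> real set \<Rightarrow> ennreal" where
  "wnorm q b S = Lnorm q S (\<lambda>s. ennreal (s powr (- recip q) * b s))"

(* \<parallel>s^{-1/r} b(s) \<parallel>u^{-1/q} a(u)\<parallel>_{q,(0,s)}\<parallel>_{r,(0,t)} *)
definition wnorm2 ::
  "ennreal \<Rightarrow> (real \<Rightarrow> real) \<Rightarrow> ennreal \<Rightarrow> (real \<Rightarrow> real) \<Rightarrow> real \<Rightarrow> ennreal" where
  "wnorm2 r b q a t =
     Lnorm r {0<..<t} (\<lambda>s. ennreal (s powr (- recip r) * b s) * wnorm q a {0<..<s})"

end

(* Write K(t) for K(t,f;A0,A1). The core is a Holmstedt-type formula:
     K(\<rho>(t),f;X0,X1) is equivalent to I(t) + \<chi>0(t)K(t) + \<rho>(t)J(t),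
   where I(t) is the X0-norm with K restricted to (0,t) and J(t) the part of the X1-norm that
   involves only arguments of K larger than t. The upper bound comes from an almost optimal
   decomposition of f at t, the lower bound from comparing K(u,f_i) with the norms of f_i in X_i.
   The weights \<chi>0 and \<chi>1 are slowly varying, so \<rho> is essentially an increasing function; instead of
   substituting v = \<rho>(t) in the norm of the reiterated space, both norms are discretized along
   t = \<Lambda>^n and v = \<rho>(\<Lambda>^n). This needs neither regularity of \<rho> nor measurability of a \<circ> \<rho>.
   A discrete Hardy inequality absorbs the I-term into the K-term if \<theta> > 0, and the J-term if \<theta> < 1. *)

theory Submission
  imports Defs
begin

text \<open>\<open>nn_integral\<close> is a supremum over simple functions below the integrand. For
  nonmeasurable integrands it stays monotone and subadditive over measurable pieces of the domain,
  but not in the integrand. So norms carrying the weight a(\<rho>(t)) are handled by pointwise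
  domination only, and the sum I + \<chi>0 K + \<rho> J is split only for integer sequences, where
  everything is measurable. Up to constants, \<chi>0(t) is the X0 norm produced by a K equal to 1
  beyond t and 0 before it, and \<chi>1(t) the X1 norm produced by K(v) = v on (0,t) and 0 beyond;
  its two summands are the outer ranges s < t and s > t. The choice of \<rho> equalizes the costs
  \<chi>0(t) K(t) and \<rho>(t) \<chi>1(t) K(t) / t of the two parts of a decomposition at t. In the
  Hardy-type estimates a nonzero power is shared: one part pays for replacing a slowly varying
  function by its value at the endpoint, the rest is integrated. For I at \<theta> = 0 and for J at
  \<theta> = 1 no power is left, which is why an extra space survives in the intersection.\<close>

lemma enn2real_exponent_pos: "0 < q \<Longrightarrow> q \<noteq> top \<Longrightarrow> 0 < enn2real q"
  by (simp add: enn2real_positive_iff top.not_eq_extremum)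

lemma recip_eq: "0 < q \<Longrightarrow> q \<noteq> top \<Longrightarrow> recip q = 1 / enn2real q"
  unfolding recip_def
  by (cases q rule: ennreal_cases) (auto simp: divide_ennreal ennreal_zero_less_divide ennreal_less_zero_iff simp flip: ennreal_1)

lemma recip_top [simp]: "recip top = 0"
  by (simp add: recip_def)

lemma recip_pos: "0 < q \<Longrightarrow> q \<noteq> top \<Longrightarrow> 0 < recip q"
  by (simp add: recip_eq enn2real_exponent_pos)

section \<open>Quasi-norms over an arbitrary measure\<close>

lemma ennreal_powr_ennreal [simp]: "0 \<le> x \<Longrightarrow> ennreal_powr (ennreal x) p = ennreal (x powr p)"
  by (simp add: ennreal_powr_def)

lemma ennreal_powr_top [simp]: "ennreal_powr top p = top"
  by (simp add: ennreal_powr_def)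

lemma ennreal_powr_0 [simp]: "ennreal_powr 0 p = 0"
  by (simp add: ennreal_powr_def)

lemma ennreal_powr_mono: "x \<le> y \<Longrightarrow> 0 < p \<Longrightarrow> ennreal_powr x p \<le> ennreal_powr y p"
  unfolding ennreal_powr_def
  by (auto simp: top_unique intro!: ennreal_leI powr_mono2 enn2real_mono simp: top.not_eq_extremum)

lemma ennreal_powr_mult:
  assumes "0 < p" shows "ennreal_powr (x * y) p = ennreal_powr x p * ennreal_powr y p"
  using assms
  by (cases x rule: ennreal_cases; cases y rule: ennreal_cases)
    (auto simp: powr_mult ennreal_mult ennreal_top_mult ennreal_mult_top simp flip: ennreal_mult)

lemma ennreal_powr_inverse:
  assumes "0 < p" "p * r = 1" shows "ennreal_powr (ennreal_powr x p) r = x"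
  using assms by (cases x rule: ennreal_cases) (auto simp: powr_powr)

lemma ennreal_powr_eq_top: "ennreal_powr x p = top \<longleftrightarrow> x = top"
  by (auto simp: ennreal_powr_def)

text \<open>Bounding the sum by twice the maximum avoids separating p < 1 from p >= 1; constants are
  nowhere meant to be sharp.\<close>

lemma ennreal_powr_add_le:
  assumes "0 < p"
  shows "ennreal_powr (x + y) p \<le> ennreal (2 powr p) * (ennreal_powr x p + ennreal_powr y p)"
proof -
  have "ennreal_powr (x + y) p \<le> ennreal_powr (2 * max x y) p"
    by (intro ennreal_powr_mono assms) (simp add: mult_2 add_mono)
  also have "\<dots> = ennreal_powr (ennreal 2) p * ennreal_powr (max x y) p"
    by (simp add: ennreal_powr_mult assms)
  also have "\<dots> \<le> ennreal (2 powr p) * (ennreal_powr x p + ennreal_powr y p)"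
    by (intro mult_mono) (auto simp del: ennreal_numeral simp: max_def)
  finally show ?thesis .
qed

lemma ennreal_powr_measurable [measurable]:
  assumes [measurable]: "f \<in> borel_measurable M"
  shows "(\<lambda>x. ennreal_powr (f x) p) \<in> borel_measurable M"
proof -
  have "{x \<in> space M. f x = top} = f -` {top} \<inter> space M" by auto
  then have [measurable]: "Measurable.pred M (\<lambda>x. f x = top)"
    using measurable_sets[OF assms, of "{top}"] by (simp add: pred_def)
  show ?thesis unfolding ennreal_powr_def by measurable
qed

text \<open>Valid for every f: a simple g below c f gives the simple function g / c below f, and the
  integral is the supremum over such functions.\<close>

lemma nn_integral_cmult_le:
  fixes c :: ennreal
  assumes "c \<noteq> top"
  shows "(\<integral>\<^sup>+ x. c * f x \<partial>M) \<le> c * integral\<^sup>N M f"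
proof (cases "c = 0")
  case False
  have "integral\<^sup>S M g \<le> c * integral\<^sup>N M f" if g: "simple_function M g" "\<And>x. g x \<le> c * f x" for g
  proof -
    have "integral\<^sup>S M g = (\<integral>\<^sup>+ x. c * (g x / c) \<partial>M)"
      using g(1) False assms
      by (subst nn_integral_eq_simple_integral[symmetric])
        (auto intro!: nn_integral_cong simp: ennreal_times_divide mult.commute[of c] mult_divide_eq_ennreal)
    also have "\<dots> = c * (\<integral>\<^sup>+ x. g x / c \<partial>M)"
      using g(1) by (intro nn_integral_cmult) (auto intro: borel_measurable_simple_function)
    also have "\<dots> \<le> c * integral\<^sup>N M f"
    proof (intro mult_left_mono nn_integral_mono)
      fix x
      have "g x / c \<le> (c * f x) / c" using g(2) by (intro divide_right_mono_ennreal)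
      also have "\<dots> = f x" using False assms by (simp add: mult.commute[of c] mult_divide_eq_ennreal)
      finally show "g x / c \<le> f x" .
    qed simp
    finally show ?thesis .
  qed
  then show ?thesis
    unfolding nn_integral_def[of M "\<lambda>x. c * f x"] by (auto intro!: SUP_least simp: le_fun_def)
qed simp

text \<open>Again f is arbitrary. A simple function below f on the union restricts to the measurable
  pieces, so cutting the domain is harmless even where cutting f into a sum is not.\<close>

lemma nn_integral_union_le:
  assumes [measurable]: "S \<in> sets M" "T \<in> sets M"
  shows "(\<integral>\<^sup>+ x. f x * indicator (S \<union> T) x \<partial>M)
    \<le> (\<integral>\<^sup>+ x. f x * indicator S x \<partial>M) + (\<integral>\<^sup>+ x. f x * indicator T x \<partial>M)"
proof -
  have "integral\<^sup>S M g \<le> (\<integral>\<^sup>+ x. f x * indicator S x \<partial>M) + (\<integral>\<^sup>+ x. f x * indicator T x \<partial>M)"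
    if g: "simple_function M g" "\<And>x. g x \<le> f x * indicator (S \<union> T) x" for g
  proof -
    have [measurable]: "g \<in> borel_measurable M" using g(1) by (rule borel_measurable_simple_function)
    have "g x \<le> g x * indicator S x + g x * indicator T x" for x
      using g(2)[of x] by (auto split: split_indicator)
    then have "integral\<^sup>N M g \<le> (\<integral>\<^sup>+ x. g x * indicator S x + g x * indicator T x \<partial>M)"
      by (intro nn_integral_mono)
    also have "\<dots> = (\<integral>\<^sup>+ x. g x * indicator S x \<partial>M) + (\<integral>\<^sup>+ x. g x * indicator T x \<partial>M)"
      by (intro nn_integral_add) auto
    also have "\<dots> \<le> (\<integral>\<^sup>+ x. f x * indicator S x \<partial>M) + (\<integral>\<^sup>+ x. f x * indicator T x \<partial>M)"
      using g(2) by (intro add_mono nn_integral_mono) (auto split: split_indicator elim!: allE dest: spec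
        intro: order_trans[OF g(2)])
    finally show ?thesis using g(1) by (simp add: nn_integral_eq_simple_integral)
  qed
  then show ?thesis
    unfolding nn_integral_def[of M "\<lambda>x. f x * indicator (S \<union> T) x"]
    by (auto intro!: SUP_least simp: le_fun_def)
qed

text \<open>The measure is left open so that Lebesgue norms and norms of integer sequences share
  their lemmas.\<close>

definition gnorm :: "'a measure \<Rightarrow> ennreal \<Rightarrow> ('a \<Rightarrow> ennreal) \<Rightarrow> ennreal" where
  "gnorm M q f =
     (if q = top then Inf {C. AE x in M. f x \<le> C}
      else ennreal_powr (\<integral>\<^sup>+ x. ennreal_powr (f x) (enn2real q) \<partial>M) (recip q))"

lemma Lnorm_eq_gnorm: "Lnorm q S f = gnorm (lebesgue_on S) q f"
  by (simp add: Lnorm_def gnorm_def)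

text \<open>The infimum of all essential bounds is the infimum of a sequence of them, and countably
  many null sets can be discarded at once.\<close>

lemma gnorm_top_AE: "AE x in M. f x \<le> gnorm M top f"
proof -
  let ?A = "{C. AE x in M. f x \<le> C}"
  have "top \<in> ?A" by simp
  then obtain g :: "nat \<Rightarrow> ennreal" where g: "range g \<subseteq> ?A" "Inf ?A = (INF i. g i)"
    using ennreal_Inf_countable_INF[of ?A] by blast
  have "AE x in M. \<forall>i. f x \<le> g i"
    using g(1) by (subst AE_all_countable) auto
  then show ?thesis
    unfolding gnorm_def using g(2) by (auto elim!: eventually_mono intro!: INF_greatest)
qed

lemma gnorm_top_le: "(AE x in M. f x \<le> C) \<Longrightarrow> gnorm M top f \<le> C"
  by (auto simp: gnorm_def intro: Inf_lower)

lemma gnorm_powr: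
  assumes "0 < q" "q \<noteq> top"
  shows "ennreal_powr (gnorm M q f) (enn2real q) = (\<integral>\<^sup>+ x. ennreal_powr (f x) (enn2real q) \<partial>M)"
  using enn2real_exponent_pos[OF assms] recip_eq[OF assms] assms(2)
  by (simp add: gnorm_def ennreal_powr_inverse)

lemma gnorm_leI:
  assumes "0 < q" "q \<noteq> top"
    and "(\<integral>\<^sup>+ x. ennreal_powr (f x) (enn2real q) \<partial>M) \<le> ennreal_powr C (enn2real q)"
  shows "gnorm M q f \<le> C"
proof -
  have "gnorm M q f \<le> ennreal_powr (ennreal_powr C (enn2real q)) (recip q)"
    using assms recip_pos[OF assms(1,2)] by (auto simp: gnorm_def intro!: ennreal_powr_mono)
  then show ?thesis
    using enn2real_exponent_pos[OF assms(1,2)] recip_eq[OF assms(1,2)] by (simp add: ennreal_powr_inverse)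
qed

lemma gnorm_mono:
  assumes "0 < q" "\<And>x. x \<in> space M \<Longrightarrow> f x \<le> g x"
  shows "gnorm M q f \<le> gnorm M q g"
proof (cases "q = top")
  case True
  then show ?thesis
    using gnorm_top_AE[of g M] AE_space[of M] assms(2)
    by (auto intro!: gnorm_top_le elim!: eventually_elim2 intro: order_trans)
next
  case False
  then show ?thesis
    using assms recip_pos[OF assms(1) False] enn2real_exponent_pos[OF assms(1) False]
    by (auto simp: gnorm_def intro!: ennreal_powr_mono nn_integral_mono)
qed

lemma gnorm_cmult_le:
  assumes "0 < q" "c \<noteq> top"
  shows "gnorm M q (\<lambda>x. c * f x) \<le> c * gnorm M q f"
proof (cases "q = top")
  case True
  then show ?thesis
    using gnorm_top_AE[of f M] by (auto intro!: gnorm_top_le mult_left_mono elim!: eventually_mono)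
next
  case False
  let ?p = "enn2real q"
  have p: "0 < ?p" using enn2real_exponent_pos[OF assms(1) False] .
  show ?thesis
  proof (rule gnorm_leI[OF assms(1) False])
    have "(\<integral>\<^sup>+ x. ennreal_powr (c * f x) ?p \<partial>M) = (\<integral>\<^sup>+ x. ennreal_powr c ?p * ennreal_powr (f x) ?p \<partial>M)"
      by (simp add: ennreal_powr_mult p)
    also have "\<dots> \<le> ennreal_powr c ?p * (\<integral>\<^sup>+ x. ennreal_powr (f x) ?p \<partial>M)"
      using assms(2) by (intro nn_integral_cmult_le) (simp add: ennreal_powr_eq_top)
    also have "\<dots> = ennreal_powr (c * gnorm M q f) ?p"
      by (simp add: ennreal_powr_mult p gnorm_powr assms False)
    finally show "(\<integral>\<^sup>+ x. ennreal_powr (c * f x) ?p \<partial>M) \<le> ennreal_powr (c * gnorm M q f) ?p" .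
  qed
qed

text \<open>One factor 2 comes from splitting the q-th power inside the integral,
  \<open>2 powr recip q\<close> from splitting the root outside; the other factor 2 is
  slack.\<close>

definition quasi_const :: "ennreal \<Rightarrow> real" where
  "quasi_const q = (if q = top then 1 else 2 * (2 * 2 powr recip q))"

lemma quasi_const_ge_1: "1 \<le> quasi_const q"
proof -
  have "recip q \<ge> 0" by (simp add: recip_def)
  then have "1 \<le> 2 powr recip q" by (simp add: ge_one_powr_ge_zero)
  then show ?thesis by (simp add: quasi_const_def)
qed

text \<open>The quasi-triangle inequality, in the form in which it applies both to sums of functions
  and to unions of domains.\<close>

lemma gnorm_add_aux:
  assumes "0 < q" "q \<noteq> top"
    and "(\<integral>\<^sup>+ x. ennreal_powr (h x) (enn2real q) \<partial>M) \<le> ennreal (2 powr enn2real q) *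
        ((\<integral>\<^sup>+ x. ennreal_powr (f x) (enn2real q) \<partial>N1) + (\<integral>\<^sup>+ x. ennreal_powr (g x) (enn2real q) \<partial>N2))"
  shows "gnorm M q h \<le> ennreal (quasi_const q) * (gnorm N1 q f + gnorm N2 q g)"
proof -
  let ?p = "enn2real q" and ?r = "recip q"
  let ?F = "\<integral>\<^sup>+ x. ennreal_powr (f x) ?p \<partial>N1" and ?G = "\<integral>\<^sup>+ x. ennreal_powr (g x) ?p \<partial>N2"
  have p: "0 < ?p" and r: "0 < ?r" and pr: "?p * ?r = 1"
    using enn2real_exponent_pos[OF assms(1,2)] recip_eq[OF assms(1,2)] by auto
  have "gnorm M q h \<le> ennreal_powr (ennreal (2 powr ?p) * (?F + ?G)) ?r"
    using assms by (auto simp: gnorm_def intro!: ennreal_powr_mono r)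
  also have "\<dots> = ennreal 2 * ennreal_powr (?F + ?G) ?r"
    using r pr by (simp add: ennreal_powr_mult powr_powr)
  also have "\<dots> \<le> ennreal 2 * (ennreal (2 powr ?r) * (ennreal_powr ?F ?r + ennreal_powr ?G ?r))"
    by (intro mult_left_mono ennreal_powr_add_le r) auto
  also have "\<dots> \<le> ennreal (quasi_const q) * (gnorm N1 q f + gnorm N2 q g)"
    using assms(2) by (simp add: gnorm_def quasi_const_def ennreal_mult mult.assoc mult_right_mono)
  finally show ?thesis .
qed

text \<open>Measurability is essential: the indicators of a nonmeasurable set and of its complement
  may both have integral 0 while their sum has not. Hence sums weighted by a(\<rho>(t)) wait for the
  discretization.\<close>

lemma gnorm_add:
  assumes "0 < q" and [measurable]: "f \<in> borel_measurable M" "g \<in> borel_measurable M"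
  shows "gnorm M q (\<lambda>x. f x + g x) \<le> ennreal (quasi_const q) * (gnorm M q f + gnorm M q g)"
proof (cases "q = top")
  case True
  then show ?thesis
    using gnorm_top_AE[of f M] gnorm_top_AE[of g M]
    by (auto intro!: gnorm_top_le add_mono elim!: eventually_elim2 simp: quasi_const_def)
next
  case False
  let ?p = "enn2real q"
  have p: "0 < ?p" using enn2real_exponent_pos[OF assms(1) False] .
  show ?thesis
  proof (rule gnorm_add_aux[OF assms(1) False])
    have "(\<integral>\<^sup>+ x. ennreal_powr (f x + g x) ?p \<partial>M)
      \<le> (\<integral>\<^sup>+ x. ennreal (2 powr ?p) * (ennreal_powr (f x) ?p + ennreal_powr (g x) ?p) \<partial>M)"
      by (intro nn_integral_mono ennreal_powr_add_le p)
    also have "\<dots> = ennreal (2 powr ?p) *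
        ((\<integral>\<^sup>+ x. ennreal_powr (f x) ?p \<partial>M) + (\<integral>\<^sup>+ x. ennreal_powr (g x) ?p \<partial>M))"
      by (simp add: nn_integral_cmult nn_integral_add)
    finally show "(\<integral>\<^sup>+ x. ennreal_powr (f x + g x) ?p \<partial>M) \<le> \<dots>" .
  qed
qed

lemma Lnorm_mono:
  assumes "0 < q" "S \<subseteq> T" and [measurable]: "S \<in> sets lebesgue" "T \<in> sets lebesgue"
    and "\<And>x. x \<in> S \<Longrightarrow> f x \<le> g x"
  shows "Lnorm q S f \<le> Lnorm q T g"
proof -
  have "Lnorm q S f \<le> Lnorm q S g"
    using assms by (auto simp: Lnorm_eq_gnorm intro!: gnorm_mono)
  also have "\<dots> \<le> Lnorm q T g"
  proof (cases "q = top")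
    case True
    have "AE x in lebesgue. x \<in> T \<longrightarrow> g x \<le> gnorm (lebesgue_on T) top g"
      using gnorm_top_AE[of g "lebesgue_on T"] by (subst (asm) AE_restrict_space_iff) auto
    then show ?thesis
      using assms(2) unfolding Lnorm_eq_gnorm True
      by (intro gnorm_top_le) (auto simp: AE_restrict_space_iff elim!: eventually_mono)
  next
    case False
    show ?thesis
      unfolding Lnorm_eq_gnorm
      using assms(2) False recip_pos[OF assms(1) False]
      by (auto simp: gnorm_def nn_integral_restrict_space intro!: ennreal_powr_mono nn_integral_mono
          split: split_indicator)
  qed
  finally show ?thesis .
qed

lemma Lnorm_union:
  assumes "0 < q" and [measurable]: "S \<in> sets lebesgue" "T \<in> sets lebesgue"
  shows "Lnorm q (S \<union> T) f \<le> ennreal (quasi_const q) * (Lnorm q S f + Lnorm q T f)"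
proof (cases "q = top")
  case True
  have "AE x in lebesgue. x \<in> S \<longrightarrow> f x \<le> gnorm (lebesgue_on S) top f"
       "AE x in lebesgue. x \<in> T \<longrightarrow> f x \<le> gnorm (lebesgue_on T) top f"
    using gnorm_top_AE[of f "lebesgue_on S"] gnorm_top_AE[of f "lebesgue_on T"]
    by (simp_all add: AE_restrict_space_iff)
  then have "AE x in lebesgue. x \<in> S \<union> T \<longrightarrow> f x \<le> gnorm (lebesgue_on S) top f + gnorm (lebesgue_on T) top f"
    by eventually_elim (auto intro: add_increasing add_increasing2)
  then show ?thesis
    unfolding Lnorm_eq_gnorm True
    by (intro gnorm_top_le) (simp add: AE_restrict_space_iff quasi_const_def)
next
  case False
  let ?p = "enn2real q"
  let ?I = "\<lambda>S. \<integral>\<^sup>+ x. ennreal_powr (f x) ?p \<partial>lebesgue_on S"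
  have "1 \<le> 2 powr ?p" by (simp add: ge_one_powr_ge_zero)
  have "?I (S \<union> T) \<le> 1 * (?I S + ?I T)"
    by (simp add: nn_integral_restrict_space nn_integral_union_le)
  \<comment> \<open>Splitting the domain costs only the factor 1; it is enlarged to fit
    \<open>gnorm_add_aux\<close>.\<close>
  also have "\<dots> \<le> ennreal (2 powr ?p) * (?I S + ?I T)"
    using \<open>1 \<le> 2 powr ?p\<close> by (intro mult_right_mono) (auto simp: ennreal_leI simp flip: ennreal_1)
  finally show ?thesis
    unfolding Lnorm_eq_gnorm by (intro gnorm_add_aux assms(1) False)
qed

section \<open>Norms with respect to the measure du/u\<close>

definition Nrm :: "ennreal \<Rightarrow> real set \<Rightarrow> (real \<Rightarrow> ennreal) \<Rightarrow> ennreal" where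
  "Nrm q S g = Lnorm q S (\<lambda>u. ennreal (u powr (- recip q)) * g u)"

lemma borel_lebesgue: "S \<in> sets borel \<Longrightarrow> S \<in> sets lebesgue"
  by (simp add: sets_completionI_sets)

lemma Nrm_mono:
  assumes "0 < q" "S \<subseteq> T" "S \<in> sets borel" "T \<in> sets borel" "\<And>u. u \<in> S \<Longrightarrow> g u \<le> h u"
  shows "Nrm q S g \<le> Nrm q T h"
  unfolding Nrm_def using assms by (intro Lnorm_mono borel_lebesgue mult_left_mono) auto

lemma Nrm_le_cmult:
  assumes "0 < q" "S \<subseteq> T" "S \<in> sets borel" "T \<in> sets borel"
    and "c \<noteq> top" "\<And>u. u \<in> S \<Longrightarrow> g u \<le> c * h u"
  shows "Nrm q S g \<le> c * Nrm q T h"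
proof -
  have "Nrm q S g \<le> Nrm q T (\<lambda>u. c * h u)"
    using assms by (intro Nrm_mono)
  also have "\<dots> = gnorm (lebesgue_on T) q (\<lambda>u. c * (ennreal (u powr (- recip q)) * h u))"
    by (simp add: Nrm_def Lnorm_eq_gnorm mult.left_commute)
  also have "\<dots> \<le> c * Nrm q T h"
    unfolding Nrm_def Lnorm_eq_gnorm using assms by (intro gnorm_cmult_le)
  finally show ?thesis .
qed

lemma Nrm_le_union:
  assumes "0 < q" "R \<subseteq> S \<union> T" "R \<in> sets borel" "S \<in> sets borel" "T \<in> sets borel"
  shows "Nrm q R g \<le> ennreal (quasi_const q) * (Nrm q S g + Nrm q T g)"
proof -
  have "Nrm q R g \<le> Nrm q (S \<union> T) g"
    using assms by (intro Nrm_mono) auto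
  then show ?thesis
    using Lnorm_union[OF assms(1) borel_lebesgue[OF assms(4)] borel_lebesgue[OF assms(5)]]
    by (auto simp: Nrm_def intro: order_trans)
qed

lemma Nrm_add:
  assumes "0 < q" "g \<in> borel_measurable (lebesgue_on S)" "h \<in> borel_measurable (lebesgue_on S)"
  shows "Nrm q S (\<lambda>u. g u + h u) \<le> ennreal (quasi_const q) * (Nrm q S g + Nrm q S h)"
proof -
  have m: "(\<lambda>u. ennreal (u powr (- recip q))) \<in> borel_measurable (lebesgue_on S)"
    by (intro measurable_restrict_space1 measurable_completion) measurable
  let ?w = "\<lambda>u. ennreal (u powr (- recip q))"
  have "Nrm q S (\<lambda>u. g u + h u) = gnorm (lebesgue_on S) q (\<lambda>u. ?w u * g u + ?w u * h u)"
    by (simp add: Nrm_def Lnorm_eq_gnorm distrib_left)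
  also have "\<dots> \<le> ennreal (quasi_const q) * (Nrm q S g + Nrm q S h)"
    unfolding Nrm_def Lnorm_eq_gnorm
    using assms m by (intro gnorm_add borel_measurable_times_ennreal)
  finally show ?thesis .
qed

text \<open>Raising u^(e - 1/q) to the power q gives u^(e q - 1). The integral may be known on a
  larger T, so that the closed interval produced by the fundamental theorem can serve for an
  interval open at 0.\<close>

lemma Nrm_integral_le:
  assumes "0 < q" "q \<noteq> top" "0 \<le> I" "S \<subseteq> {0<..}" "S \<subseteq> T" "S \<in> sets borel"
    and I: "((\<lambda>u. u powr (e * enn2real q - 1)) has_integral I) T"
  shows "Nrm q S (\<lambda>u. ennreal (u powr e)) \<le> ennreal (I powr recip q)"
proof -
  let ?p = "enn2real q"
  have p: "0 < ?p" "recip q * ?p = 1"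
    using enn2real_exponent_pos[OF assms(1,2)] recip_eq[OF assms(1,2)] by auto
  have eq: "ennreal_powr (ennreal (u powr (- recip q)) * ennreal (u powr e)) ?p = ennreal (u powr (e * ?p - 1))" for u
    using p by (simp add: powr_powr algebra_simps flip: ennreal_mult powr_add)
  have "(\<integral>\<^sup>+ u. ennreal (u powr (e * ?p - 1)) * indicator S u \<partial>lebesgue)
      \<le> (\<integral>\<^sup>+ u. ennreal (u powr (e * ?p - 1)) * indicator T u \<partial>lebesgue)"
    using assms(5) by (intro nn_integral_mono) (auto split: split_indicator)
  also have "\<dots> = ennreal I"
    unfolding nn_integral_completion using I by (intro nn_integral_has_integral_lebesgue') auto
  finally have "(\<integral>\<^sup>+ u. ennreal_powr (ennreal (u powr (- recip q)) * ennreal (u powr e)) ?p \<partial>lebesgue_on S)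
      \<le> ennreal_powr (ennreal (I powr recip q)) ?p"
    using assms(3) p assms(6) by (simp add: eq nn_integral_restrict_space borel_lebesgue powr_powr)
  then show ?thesis
    unfolding Nrm_def Lnorm_eq_gnorm by (rule gnorm_leI[OF assms(1,2)])
qed

lemma Nrm_power_head:
  assumes "0 < q" "0 < d"
  shows "\<exists>C>0. \<forall>t>0. Nrm q {0<..t} (\<lambda>u. ennreal (u powr d)) \<le> ennreal (C * t powr d)"
proof (cases "q = top")
  case True
  have "Nrm top {0<..t} (\<lambda>u. ennreal (u powr d)) \<le> ennreal (1 * t powr d)" if "0 < t" for t
    unfolding Nrm_def Lnorm_eq_gnorm using that assms(2)
    by (intro gnorm_top_le AE_I2) (auto intro!: ennreal_leI powr_mono2)
  then show ?thesis using True by (intro exI[of _ 1]) auto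
next
  case False
  let ?p = "enn2real q"
  have p: "0 < ?p" "recip q * ?p = 1"
    using enn2real_exponent_pos[OF assms(1) False] recip_eq[OF assms(1) False] by auto
  have "Nrm q {0<..t} (\<lambda>u. ennreal (u powr d)) \<le> ennreal ((1 / (d * ?p)) powr recip q * t powr d)" if t: "0 < t" for t
  proof -
    \<comment> \<open>The antiderivative is continuous up to 0, where \<open>0 powr (d * ?p)\<close>
      evaluates to 0; the integrand itself may be unbounded there.\<close>
    have "((\<lambda>u. u powr (d * ?p - 1)) has_integral (t powr (d * ?p) / (d * ?p) - 0 powr (d * ?p) / (d * ?p))) {0..t}"
    proof (rule fundamental_theorem_of_calculus_interior)
      show "continuous_on {0..t} (\<lambda>u. u powr (d * ?p) / (d * ?p))"
        using p(1) assms(2) by (intro continuous_on_divide continuous_on_powr' continuous_intros) auto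
      fix u assume "u \<in> {0<..<t}"
      then have "((\<lambda>u. u powr (d * ?p) / (d * ?p)) has_real_derivative (d * ?p * u powr (d * ?p - 1)) / (d * ?p)) (at u)"
        by (intro DERIV_cdivide has_real_derivative_powr) auto
      then show "((\<lambda>u. u powr (d * ?p) / (d * ?p)) has_vector_derivative u powr (d * ?p - 1)) (at u)"
        using p(1) assms(2) by (simp add: has_real_derivative_iff_has_vector_derivative)
    qed (use t in simp)
    then have "Nrm q {0<..t} (\<lambda>u. ennreal (u powr d)) \<le> ennreal ((t powr (d * ?p) / (d * ?p)) powr recip q)"
      using p assms False by (intro Nrm_integral_le) auto
    also have "(t powr (d * ?p) / (d * ?p)) powr recip q = (1 / (d * ?p)) powr recip q * t powr d"
      using p assms t by (simp add: powr_divide powr_powr mult.assoc mult.commute[of ?p])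
    finally show ?thesis .
  qed
  then show ?thesis using p assms by (intro exI[of _ "(1 / (d * ?p)) powr recip q"]) auto
qed

lemma Nrm_power_tail:
  assumes "0 < q" "0 < d"
  shows "\<exists>C>0. \<forall>t>0. Nrm q {t..} (\<lambda>u. ennreal (u powr (- d))) \<le> ennreal (C * t powr (- d))"
proof (cases "q = top")
  case True
  have "Nrm top {t..} (\<lambda>u. ennreal (u powr (- d))) \<le> ennreal (1 * t powr (- d))" if "0 < t" for t
    unfolding Nrm_def Lnorm_eq_gnorm using that assms(2)
    by (intro gnorm_top_le AE_I2) (auto intro!: ennreal_leI powr_mono2')
  then show ?thesis using True by (intro exI[of _ 1]) auto
next
  case False
  let ?p = "enn2real q"
  have p: "0 < ?p" "recip q * ?p = 1"
    using enn2real_exponent_pos[OF assms(1) False] recip_eq[OF assms(1) False] by auto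
  have "Nrm q {t..} (\<lambda>u. ennreal (u powr (- d))) \<le> ennreal ((1 / (d * ?p)) powr recip q * t powr (- d))" if t: "0 < t" for t
  proof -
    have "((\<lambda>u. u powr (- d * ?p - 1)) has_integral (t powr (- d * ?p) / (d * ?p))) {t..}"
      using has_integral_powr_to_inf[of "- d * ?p - 1" t] t p(1) assms(2) by simp
    then have "Nrm q {t..} (\<lambda>u. ennreal (u powr (- d))) \<le> ennreal ((t powr (- d * ?p) / (d * ?p)) powr recip q)"
      using p assms False t by (intro Nrm_integral_le) auto
    also have "(t powr (- d * ?p) / (d * ?p)) powr recip q = (1 / (d * ?p)) powr recip q * t powr (- d)"
      using p assms t by (simp add: powr_divide powr_powr mult.assoc mult.commute[of ?p])
    finally show ?thesis .
  qed
  then show ?thesis using p assms by (intro exI[of _ "(1 / (d * ?p)) powr recip q"]) auto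
qed

text \<open>A dyadic block has du/u-mass at least 1/2, whatever t is: its length is t and 1/u
  exceeds 1/(2t) on it. For q = top it is enough that the block is not null.\<close>

lemma Nrm_const_ge:
  assumes "0 < q"
  shows "\<exists>c>0. \<forall>t>0. ennreal c \<le> Nrm q {t<..<2*t} (\<lambda>_. 1)"
proof (cases "q = top")
  case True
  have "1 \<le> Nrm top {t<..<2*t} (\<lambda>_. 1)" if "0 < t" for t
  proof (rule ccontr)
    let ?M = "lebesgue_on {t<..<2*t}" and ?f = "\<lambda>u::real. ennreal (u powr (- recip top)) * 1"
    assume "\<not> ?thesis"
    then have "AE u in ?M. False"
      using gnorm_top_AE[of ?f ?M] AE_space[of ?M] that
      by (auto elim!: eventually_elim2 simp: Nrm_def Lnorm_eq_gnorm split: if_splits)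
    then have "AE u in lebesgue. u \<notin> {t<..<2*t}"
      by (subst (asm) AE_restrict_space_iff) auto
    then have "{t<..<2*t} \<in> null_sets lebesgue"
      by (subst (asm) AE_iff_null_sets[symmetric]) auto
    then show False using that by (auto simp: null_sets_def)
  qed
  then show ?thesis using True by (intro exI[of _ 1]) auto
next
  case False
  let ?p = "enn2real q"
  have p: "0 < ?p" "recip q * ?p = 1" "0 < recip q"
    using enn2real_exponent_pos[OF assms(1) False] recip_eq[OF assms(1) False] by auto
  have "ennreal ((1/2) powr recip q) \<le> Nrm q {t<..<2*t} (\<lambda>_. 1)" if t: "0 < t" for t
  proof -
    have "ennreal (1/2) = (\<integral>\<^sup>+ u. ennreal (1 / (2*t)) * indicator {t<..<2*t} u \<partial>lebesgue)"
      using t by (subst nn_integral_cmult_indicator) (auto simp flip: ennreal_mult)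
    also have "\<dots> \<le> (\<integral>\<^sup>+ u. ennreal_powr (ennreal (u powr (- recip q)) * 1) ?p * indicator {t<..<2*t} u \<partial>lebesgue)"
      using t p by (intro nn_integral_mono)
        (auto split: split_indicator simp: powr_powr powr_minus_divide[of _ 1] intro!: ennreal_leI divide_left_mono)
    finally have "ennreal_powr (ennreal (1/2)) (recip q) \<le> Nrm q {t<..<2*t} (\<lambda>_. 1)"
      using p False unfolding Nrm_def Lnorm_eq_gnorm gnorm_def
      by (simp del: ennreal_powr_ennreal add: nn_integral_restrict_space ennreal_powr_mono)
    then show ?thesis by (subst (asm) ennreal_powr_ennreal) simp_all
  qed
  then show ?thesis by (intro exI[of _ "(1/2) powr recip q"]) auto
qed

section \<open>Slowly varying functions\<close>

text \<open>Potter's inequality. It characterises membership in the class \<open>SV\<close> up to measurability.\<close>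

definition sv :: "(real \<Rightarrow> real) \<Rightarrow> bool" where
  "sv b \<longleftrightarrow> (\<forall>t>0. 0 < b t) \<and>
     (\<forall>\<epsilon>>0. \<exists>C>0. \<forall>s>0. \<forall>t>0. b t \<le> C * max (t / s) (s / t) powr \<epsilon> * b s)"

lemma sv_pos: "sv b \<Longrightarrow> 0 < t \<Longrightarrow> 0 < b t"
  by (simp add: sv_def)

lemma svE:
  assumes "sv b" "0 < \<epsilon>"
  obtains C where "0 < C" "\<And>s t. 0 < s \<Longrightarrow> 0 < t \<Longrightarrow> b t \<le> C * max (t / s) (s / t) powr \<epsilon> * b s"
  using assms unfolding sv_def by metis

lemma max_ratio_ge_1: "0 < s \<Longrightarrow> 0 < t \<Longrightarrow> 1 \<le> max (t / s) (s / (t::real))"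
  by (cases "t \<le> s") (auto simp: le_max_iff_disj)

lemma equivalent_posE:
  assumes "equivalent_pos f g"
  obtains C where "0 < C" "\<And>t. 0 < t \<Longrightarrow> g t \<le> C * f t" "\<And>t. 0 < t \<Longrightarrow> f t \<le> C * g t"
  using assms unfolding equivalent_pos_def by (auto simp: field_simps)

text \<open>For t below s the almost increasing function t^\<epsilon> b(t) gives the estimate, for t
  above s the almost decreasing t^(-\<epsilon>) b(t). Passing to the monotone function and back uses
  the equivalence constant twice, hence the squares.\<close>

lemma SV_imp_sv:
  assumes "b \<in> SV" shows "sv b"
proof -
  have pos: "\<And>t. 0 < t \<Longrightarrow> 0 < b t" using assms by (auto simp: SV_def)
  have "\<exists>C>0. \<forall>s>0. \<forall>t>0. b t \<le> C * max (t / s) (s / t) powr \<epsilon> * b s" if e: "0 < \<epsilon>" for \<epsilon>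
  proof -
    obtain g h where g: "mono_on {0<..} g" "equivalent_pos (\<lambda>t. t powr \<epsilon> * b t) g"
      and h: "antimono_on {0<..} h" "equivalent_pos (\<lambda>t. t powr (- \<epsilon>) * b t) h"
      using assms e unfolding SV_def by blast
    obtain C where C: "0 < C" "\<And>t. 0 < t \<Longrightarrow> g t \<le> C * (t powr \<epsilon> * b t)" "\<And>t. 0 < t \<Longrightarrow> t powr \<epsilon> * b t \<le> C * g t"
      using equivalent_posE[OF g(2)] by metis
    obtain D where D: "0 < D" "\<And>t. 0 < t \<Longrightarrow> h t \<le> D * (t powr (- \<epsilon>) * b t)" "\<And>t. 0 < t \<Longrightarrow> t powr (- \<epsilon>) * b t \<le> D * h t"
      using equivalent_posE[OF h(2)] by metis
    have "b t \<le> (C * C + D * D) * max (t / s) (s / t) powr \<epsilon> * b s" if st: "0 < s" "0 < t" for s t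
    proof (cases "t \<le> s")
      case True
      have "t powr \<epsilon> * b t \<le> C * g t" using C st by blast
      also have "\<dots> \<le> C * g s" using C(1) g(1) st True by (auto simp: mono_on_def)
      also have "\<dots> \<le> C * (C * (s powr \<epsilon> * b s))" using C st by (intro mult_left_mono) auto
      finally have "b t \<le> C * C * (s / t) powr \<epsilon> * b s"
        using st by (simp add: powr_divide field_simps)
      also have "\<dots> \<le> (C * C + D * D) * max (t / s) (s / t) powr \<epsilon> * b s"
        using st pos[of s] e C(1) D(1) by (intro mult_mono powr_mono2) auto
      finally show ?thesis .
    next
      case False
      have "t powr (- \<epsilon>) * b t \<le> D * h t" using D st by blast
      also have "\<dots> \<le> D * h s" using D(1) h(1) st False by (auto simp: monotone_on_def)
      also have "\<dots> \<le> D * (D * (s powr (- \<epsilon>) * b s))" using D st by (intro mult_left_mono) auto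
      finally have "b t \<le> D * D * (t / s) powr \<epsilon> * b s"
        using st by (simp add: powr_divide powr_minus field_simps)
      also have "\<dots> \<le> (C * C + D * D) * max (t / s) (s / t) powr \<epsilon> * b s"
        using st pos[of s] e C(1) D(1) by (intro mult_mono powr_mono2) auto
      finally show ?thesis .
    qed
    then show ?thesis using C(1) D(1) by (intro exI[of _ "C * C + D * D"]) (auto intro: add_pos_pos)
  qed
  then show ?thesis using pos by (auto simp: sv_def)
qed

lemma sv_mult:
  assumes "sv b" "sv c" shows "sv (\<lambda>t. b t * c t)"
  unfolding sv_def
proof (intro conjI allI impI)
  fix \<epsilon> :: real assume e: "0 < \<epsilon>"
  obtain C where C: "0 < C" "\<And>s t. 0 < s \<Longrightarrow> 0 < t \<Longrightarrow> b t \<le> C * max (t / s) (s / t) powr (\<epsilon>/2) * b s"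
    using svE[OF assms(1), of "\<epsilon>/2"] e by auto
  obtain D where D: "0 < D" "\<And>s t. 0 < s \<Longrightarrow> 0 < t \<Longrightarrow> c t \<le> D * max (t / s) (s / t) powr (\<epsilon>/2) * c s"
    using svE[OF assms(2), of "\<epsilon>/2"] e by auto
  have "b t * c t \<le> (C * D) * max (t / s) (s / t) powr \<epsilon> * (b s * c s)" if "0 < s" "0 < t" for s t
  proof -
    let ?m = "max (t / s) (s / t)"
    have "b t * c t \<le> (C * ?m powr (\<epsilon>/2) * b s) * (D * ?m powr (\<epsilon>/2) * c s)"
      using that C D sv_pos[OF assms(1)] sv_pos[OF assms(2)]
      by (intro mult_mono mult_nonneg_nonneg) (auto simp: less_imp_le)
    also have "\<dots> = (C * D) * (?m powr (\<epsilon>/2) * ?m powr (\<epsilon>/2)) * (b s * c s)" by (simp add: ac_simps)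
    also have "?m powr (\<epsilon>/2) * ?m powr (\<epsilon>/2) = ?m powr \<epsilon>" by (simp flip: powr_add)
    finally show ?thesis .
  qed
  then show "\<exists>C>0. \<forall>s>0. \<forall>t>0. b t * c t \<le> C * max (t / s) (s / t) powr \<epsilon> * (b s * c s)"
    using C D by (intro exI[of _ "C * D"]) auto
qed (use sv_pos[OF assms(1)] sv_pos[OF assms(2)] in auto)

lemma sv_add:
  assumes "sv b" "sv c" shows "sv (\<lambda>t. b t + c t)"
  unfolding sv_def
proof (intro conjI allI impI)
  fix \<epsilon> :: real assume e: "0 < \<epsilon>"
  obtain C where C: "0 < C" "\<And>s t. 0 < s \<Longrightarrow> 0 < t \<Longrightarrow> b t \<le> C * max (t / s) (s / t) powr \<epsilon> * b s"
    using svE[OF assms(1) e] by auto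
  obtain D where D: "0 < D" "\<And>s t. 0 < s \<Longrightarrow> 0 < t \<Longrightarrow> c t \<le> D * max (t / s) (s / t) powr \<epsilon> * c s"
    using svE[OF assms(2) e] by auto
  have "b t + c t \<le> (C + D) * max (t / s) (s / t) powr \<epsilon> * (b s + c s)" if st: "0 < s" "0 < t" for s t
  proof -
    let ?m = "max (t / s) (s / t) powr \<epsilon>"
    have "b t + c t \<le> C * ?m * b s + D * ?m * c s" using C D st by (intro add_mono) auto
    also have "\<dots> \<le> (C + D) * ?m * b s + (C + D) * ?m * c s"
      using C(1) D(1) sv_pos[OF assms(1) st(1)] sv_pos[OF assms(2) st(1)]
      by (intro add_mono mult_right_mono) auto
    finally show ?thesis by (simp add: distrib_left)
  qed
  then show "\<exists>C>0. \<forall>s>0. \<forall>t>0. b t + c t \<le> C * max (t / s) (s / t) powr \<epsilon> * (b s + c s)"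
    using C D by (intro exI[of _ "C + D"]) auto
qed (use sv_pos[OF assms(1)] sv_pos[OF assms(2)] in \<open>auto intro: add_pos_pos\<close>)

lemma sv_inverse:
  assumes "sv b" shows "sv (\<lambda>t. 1 / b t)"
  unfolding sv_def
proof (intro conjI allI impI)
  fix \<epsilon> :: real assume e: "0 < \<epsilon>"
  obtain C where C: "0 < C" "\<And>s t. 0 < s \<Longrightarrow> 0 < t \<Longrightarrow> b t \<le> C * max (t / s) (s / t) powr \<epsilon> * b s"
    using svE[OF assms(1) e] by auto
  have "1 / b t \<le> C * max (t / s) (s / t) powr \<epsilon> * (1 / b s)" if "0 < s" "0 < t" for s t
    using C(2)[of t s] that sv_pos[OF assms] by (simp add: field_simps max.commute)
  then show "\<exists>C>0. \<forall>s>0. \<forall>t>0. 1 / b t \<le> C * max (t / s) (s / t) powr \<epsilon> * (1 / b s)"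
    using C by (intro exI[of _ C]) auto
qed (use sv_pos[OF assms] in auto)

lemma sv_powr:
  assumes "sv b" "0 \<le> p" "p \<le> 1" shows "sv (\<lambda>t. b t powr p)"
  unfolding sv_def
proof (intro conjI allI impI)
  fix \<epsilon> :: real assume e: "0 < \<epsilon>"
  obtain C where C: "0 < C" "\<And>s t. 0 < s \<Longrightarrow> 0 < t \<Longrightarrow> b t \<le> C * max (t / s) (s / t) powr \<epsilon> * b s"
    using svE[OF assms(1) e] by auto
  have "b t powr p \<le> C powr p * max (t / s) (s / t) powr \<epsilon> * b s powr p" if st: "0 < s" "0 < t" for s t
  proof -
    let ?m = "max (t / s) (s / t)"
    have "b t powr p \<le> (C * ?m powr \<epsilon> * b s) powr p"
      using C(2)[of s t] st sv_pos[OF assms(1) st(2)] assms(2) by (intro powr_mono2) auto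
    also have "\<dots> = C powr p * ?m powr (\<epsilon> * p) * b s powr p"
      using C(1) sv_pos[OF assms(1) st(1)] max_ratio_ge_1[OF st] by (simp add: powr_mult powr_powr)
    also have "\<dots> \<le> C powr p * ?m powr \<epsilon> * b s powr p"
      using C(1) sv_pos[OF assms(1) st(1)] max_ratio_ge_1[OF st] e assms(3)
      by (intro mult_right_mono mult_left_mono powr_mono) (auto simp: mult_left_le)
    finally show ?thesis .
  qed
  then show "\<exists>C>0. \<forall>s>0. \<forall>t>0. b t powr p \<le> C * max (t / s) (s / t) powr \<epsilon> * b s powr p"
    using C by (intro exI[of _ "C powr p"]) auto
qed (use sv_pos[OF assms(1)] in force)

text \<open>Ratios of \<rho> are at most a constant times the square of the ratio of the arguments:
  one power from the factor t, one from Potter's inequality for c with exponent 1. So Potter's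
  inequality for a with \<epsilon>/2 becomes one for the composition with \<epsilon>. Being free of
  measurability, \<open>sv\<close> survives composition.\<close>

lemma sv_comp:
  assumes "sv a" "sv c" "\<And>t. 0 < t \<Longrightarrow> \<rho> t = t * c t" shows "sv (\<lambda>t. a (\<rho> t))"
  unfolding sv_def
proof (intro conjI allI impI)
  have pos: "0 < \<rho> t" if "0 < t" for t using assms(3) sv_pos[OF assms(2)] that by auto
  show "0 < a (\<rho> t)" if "0 < t" for t using pos[OF that] sv_pos[OF assms(1)] by auto
  fix \<epsilon> :: real assume e: "0 < \<epsilon>"
  obtain C where C: "0 < C" "\<And>s t. 0 < s \<Longrightarrow> 0 < t \<Longrightarrow> a t \<le> C * max (t / s) (s / t) powr (\<epsilon>/2) * a s"
    using svE[OF assms(1), of "\<epsilon>/2"] e by auto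
  obtain D where D: "0 < D" "\<And>s t. 0 < s \<Longrightarrow> 0 < t \<Longrightarrow> c t \<le> D * max (t / s) (s / t) powr 1 * c s"
    using svE[OF assms(2), of 1] by auto
  have ratio: "\<rho> t / \<rho> s \<le> D * max (t / s) (s / t) powr 2" if st: "0 < s" "0 < t" for s t
  proof -
    let ?m = "max (t / s) (s / t)"
    have m: "1 \<le> ?m" using max_ratio_ge_1[OF st] .
    have "\<rho> t / \<rho> s = (t / s) * (c t / c s)" using assms(3) st by simp
    also have "\<dots> \<le> ?m * (D * ?m)"
      using D(2)[OF st] sv_pos[OF assms(2) st(1)] sv_pos[OF assms(2) st(2)] st m
      by (intro mult_mono) (auto simp: pos_divide_le_eq)
    also have "\<dots> = D * ?m powr 2" using m by (simp add: power2_eq_square)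
    finally show ?thesis .
  qed
  have "a (\<rho> t) \<le> (C * D powr (\<epsilon>/2)) * max (t / s) (s / t) powr \<epsilon> * a (\<rho> s)" if st: "0 < s" "0 < t" for s t
  proof -
    let ?m = "max (t / s) (s / t)" and ?n = "max (\<rho> t / \<rho> s) (\<rho> s / \<rho> t)"
    have n: "1 \<le> ?n" using max_ratio_ge_1[OF pos[OF st(1)] pos[OF st(2)]] .
    have "?n \<le> D * ?m powr 2" using ratio[OF st] ratio[OF st(2,1)] by (simp add: max.commute)
    then have "?n powr (\<epsilon>/2) \<le> (D * ?m powr 2) powr (\<epsilon>/2)" using n e by (intro powr_mono2) auto
    also have "\<dots> = D powr (\<epsilon>/2) * ?m powr \<epsilon>"
      using D(1) max_ratio_ge_1[OF st] by (simp add: powr_mult powr_powr del: powr_numeral)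
    finally have "C * ?n powr (\<epsilon>/2) * a (\<rho> s) \<le> C * (D powr (\<epsilon>/2) * ?m powr \<epsilon>) * a (\<rho> s)"
      using C(1) sv_pos[OF assms(1) pos[OF st(1)]] by (intro mult_right_mono mult_left_mono) auto
    then show ?thesis using C(2)[OF pos[OF st(1)] pos[OF st(2)]] by (simp add: mult.assoc)
  qed
  then show "\<exists>C>0. \<forall>s>0. \<forall>t>0. a (\<rho> t) \<le> C * max (t / s) (s / t) powr \<epsilon> * a (\<rho> s)"
    using C D by (intro exI[of _ "C * D powr (\<epsilon>/2)"]) auto
qed

section \<open>Head and tail norms of slowly varying weights\<close>

lemma wnorm_eq_Nrm: "wnorm q b S = Nrm q S (\<lambda>s. ennreal (b s))"
  by (simp add: wnorm_def Nrm_def ennreal_mult')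

text \<open>Common core of the head (e > 0) and the tail (e < 0). Potter's inequality replaces c(u)
  by c(t) at the price of (t/u)^(e/2); this consumes half of the power u^e, and the other half still
  has a norm of the right size.\<close>

lemma Nrm_sv_power:
  assumes "0 < q" "sv c" "0 < P" "0 < d" "\<And>t. S t \<in> sets borel"
    and P: "\<And>t. 0 < t \<Longrightarrow> Nrm q (S t) (\<lambda>u. ennreal (u powr (e/2))) \<le> ennreal (P * t powr (e/2))"
    and ratio: "\<And>t u. 0 < t \<Longrightarrow> u \<in> S t \<Longrightarrow> 0 < u \<and> max (u / t) (t / u) powr d = (t / u) powr (e/2)"
  shows "\<exists>C>0. \<forall>t>0. Nrm q (S t) (\<lambda>u. ennreal (u powr e * c u)) \<le> ennreal (C * (t powr e * c t))"
proof -
  obtain K where K: "0 < K" "\<And>s t. 0 < s \<Longrightarrow> 0 < t \<Longrightarrow> c t \<le> K * max (t / s) (s / t) powr d * c s"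
    using svE[OF assms(2,4)] by auto
  have "Nrm q (S t) (\<lambda>u. ennreal (u powr e * c u)) \<le> ennreal (K * P * (t powr e * c t))" if t: "0 < t" for t
  proof -
    let ?A = "K * t powr (e/2) * c t"
    have ct: "0 < c t" using sv_pos[OF assms(2) t] .
    have "Nrm q (S t) (\<lambda>u. ennreal (u powr e * c u)) \<le> ennreal ?A * Nrm q (S t) (\<lambda>u. ennreal (u powr (e/2)))"
    proof (rule Nrm_le_cmult)
      fix u assume "u \<in> S t"
      then have u: "0 < u" "max (u / t) (t / u) powr d = (t / u) powr (e/2)" using ratio[OF t] by auto
      have "u powr e * c u \<le> u powr e * (K * (t / u) powr (e/2) * c t)"
        using K(2)[OF t u(1)] u(2) by (intro mult_left_mono) auto
      also have "\<dots> = ?A * (u powr e / u powr (e/2))" using u t by (simp add: powr_divide)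
      also have "u powr e / u powr (e/2) = u powr (e/2)" using u by (simp flip: powr_diff)
      finally show "ennreal (u powr e * c u) \<le> ennreal ?A * ennreal (u powr (e/2))"
        using K(1) ct by (simp add: ennreal_leI flip: ennreal_mult)
    qed (use assms in auto)
    also have "\<dots> \<le> ennreal ?A * ennreal (P * t powr (e/2))" using P[OF t] by (intro mult_left_mono) auto
    also have "\<dots> = ennreal (K * P * ((t powr (e/2) * t powr (e/2)) * c t))"
      using K(1) assms(3) ct by (simp add: ac_simps flip: ennreal_mult)
    also have "t powr (e/2) * t powr (e/2) = t powr e" by (simp flip: powr_add)
    finally show ?thesis .
  qed
  then show ?thesis using K assms(3) by (intro exI[of _ "K * P"]) auto
qed

lemma Nrm_sv_head:
  assumes "0 < q" "0 < d" "sv c"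
  shows "\<exists>C>0. \<forall>t>0. Nrm q {0<..t} (\<lambda>u. ennreal (u powr d * c u)) \<le> ennreal (C * (t powr d * c t))"
proof -
  obtain P where P: "0 < P" "\<And>t. 0 < t \<Longrightarrow> Nrm q {0<..t} (\<lambda>u. ennreal (u powr (d/2))) \<le> ennreal (P * t powr (d/2))"
    using Nrm_power_head[OF assms(1), of "d/2"] assms(2) by auto
  have "max (u / t) (t / u) = t / u" if "0 < t" "u \<in> {0<..t}" for t u :: real
    using that mult_mono[of u t u t] by (intro max_absorb2) (auto simp: field_simps)
  then show ?thesis using P assms by (intro Nrm_sv_power[where d = "d/2"]) auto
qed

lemma Nrm_sv_tail:
  assumes "0 < q" "0 < d" "sv c"
  shows "\<exists>C>0. \<forall>t>0. Nrm q {t..} (\<lambda>u. ennreal (u powr (- d) * c u)) \<le> ennreal (C * (t powr (- d) * c t))"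
proof -
  obtain P where P: "0 < P" "\<And>t. 0 < t \<Longrightarrow> Nrm q {t..} (\<lambda>u. ennreal (u powr (- (d/2)))) \<le> ennreal (P * t powr (- (d/2)))"
    using Nrm_power_tail[OF assms(1), of "d/2"] assms(2) by auto
  have "max (u / t) (t / u) powr (d/2) = (t / u) powr (- d / 2)" if "0 < t" "u \<in> {t..}" for t u
  proof -
    have "max (u / t) (t / u) = u / t"
      using that mult_mono[of t u t u] by (intro max_absorb1) (auto simp: field_simps)
    then show ?thesis using that by (simp add: powr_divide powr_minus_divide)
  qed
  then show ?thesis using P assms by (intro Nrm_sv_power[where d = "d/2" and P = P]) auto
qed

text \<open>Converts the value b(t) into a norm over a nearby dyadic block, on which b is comparable
  to b(t). The freedom in s serves both sides: s = t/2 puts the block inside (0,t), s = t puts it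
  inside (t,\<infinity>).\<close>

lemma wnorm_block:
  assumes "0 < q" "sv b"
  shows "\<exists>C>0. \<forall>t>0. \<forall>s. t / 2 \<le> s \<longrightarrow> s \<le> t \<longrightarrow> ennreal (b t) \<le> ennreal C * wnorm q b {s<..<2 * s}"
proof -
  obtain K where K: "0 < K" "\<And>s t. 0 < s \<Longrightarrow> 0 < t \<Longrightarrow> b t \<le> K * max (t / s) (s / t) powr 1 * b s"
    using svE[OF assms(2), of 1] by auto
  obtain c where c: "0 < c" "\<And>t. 0 < t \<Longrightarrow> ennreal c \<le> Nrm q {t<..<2*t} (\<lambda>_. 1)"
    using Nrm_const_ge[OF assms(1)] by auto
  have "ennreal (b t) \<le> ennreal (2 * K / c) * wnorm q b {s<..<2 * s}" if t: "0 < t" and s: "t / 2 \<le> s" "s \<le> t" for t s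
  proof -
    have bt: "0 < b t" using sv_pos[OF assms(2) t] .
    have "ennreal c \<le> Nrm q {s<..<2 * s} (\<lambda>_. 1)" using c(2)[of s] s t by simp
    also have "\<dots> \<le> ennreal (2 * K / b t) * wnorm q b {s<..<2 * s}"
      unfolding wnorm_eq_Nrm
    proof (rule Nrm_le_cmult)
      fix u assume u: "u \<in> {s<..<2 * s}"
      then have "t / u \<le> 2" "u / t \<le> 2" "0 < u" using s t by (auto simp: pos_divide_le_eq)
      then have m: "max (t / u) (u / t) powr 1 \<le> 2" using t by (subst powr_one) (auto simp: le_max_iff_disj)
      have "b t \<le> K * max (t / u) (u / t) powr 1 * b u" using K(2) \<open>0 < u\<close> t by blast
      also have "\<dots> \<le> K * 2 * b u"
        using K(1) m sv_pos[OF assms(2) \<open>0 < u\<close>] by (intro mult_right_mono mult_left_mono) auto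
      finally have "b t \<le> K * 2 * b u" .
      then have "1 \<le> 2 * K / b t * b u" using bt by (simp add: field_simps)
      then show "1 \<le> ennreal (2 * K / b t) * ennreal (b u)"
        using K(1) bt sv_pos[OF assms(2) \<open>0 < u\<close>] by (simp add: ennreal_leI flip: ennreal_mult ennreal_1)
    qed (use assms in auto)
    finally have "ennreal (b t / c) * ennreal c \<le> ennreal (b t / c) * (ennreal (2 * K / b t) * wnorm q b {s<..<2 * s})"
      by (intro mult_left_mono) auto
    then show ?thesis using c(1) K(1) bt by (simp add: mult.assoc[symmetric] flip: ennreal_mult)
  qed
  then show ?thesis using K c by (intro exI[of _ "2 * K / c"]) auto
qed

text \<open>The maximum in Potter's inequality is symmetric under t -> 1/t. This turns decreasing
  tail norms into increasing functions.\<close>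

lemma sv_reflect:
  assumes "sv (\<lambda>t. h (1 / t))" shows "sv h"
  unfolding sv_def
proof (intro conjI allI impI)
  show "0 < h t" if "0 < t" for t using sv_pos[OF assms, of "1 / t"] that by simp
  fix \<epsilon> :: real assume e: "0 < \<epsilon>"
  obtain C where C: "0 < C" "\<And>s t. 0 < s \<Longrightarrow> 0 < t \<Longrightarrow> h (1 / t) \<le> C * max (t / s) (s / t) powr \<epsilon> * h (1 / s)"
    using svE[OF assms e] by auto
  have "h t \<le> C * max (t / s) (s / t) powr \<epsilon> * h s" if "0 < s" "0 < t" for s t
    using C(2)[of "1 / s" "1 / t"] that by (simp add: max.commute)
  then show "\<exists>C>0. \<forall>s>0. \<forall>t>0. h t \<le> C * max (t / s) (s / t) powr \<epsilon> * h s" using C(1) by auto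
qed

text \<open>Downwards, monotonicity of H already gives Potter's inequality. Upwards, the increment
  is controlled by (t/s)^\<epsilon> b(s), and b(s) is absorbed into H(s) through the lower
  bound.\<close>

lemma sv_enn2real:
  fixes H :: "real \<Rightarrow> ennreal"
  assumes b: "\<And>t. 0 < t \<Longrightarrow> 0 < b t" and fin: "\<And>t. 0 < t \<Longrightarrow> H t < top"
    and mono: "\<And>s t. 0 < s \<Longrightarrow> s \<le> t \<Longrightarrow> H s \<le> H t"
    and B: "0 < B" and lower: "\<And>t. 0 < t \<Longrightarrow> b t \<le> B * enn2real (H t)"
    and inc: "\<And>\<epsilon>. 0 < \<epsilon> \<Longrightarrow>
      \<exists>C>0. \<forall>s t. 0 < s \<longrightarrow> s < t \<longrightarrow> H t \<le> ennreal (quasi_const q) * (H s + ennreal (C * (t / s) powr \<epsilon> * b s))"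
  shows "sv (\<lambda>t. enn2real (H t))"
  unfolding sv_def
proof (intro conjI allI impI)
  let ?Q = "quasi_const q" and ?h = "\<lambda>t. enn2real (H t)"
  show pos: "0 < ?h t" if "0 < t" for t
    using lower[OF that] b[OF that] B by (smt (verit) zero_less_mult_iff)
  fix \<epsilon> :: real assume e: "0 < \<epsilon>"
  obtain C where C: "0 < C" "\<And>s t. 0 < s \<Longrightarrow> s < t \<Longrightarrow> H t \<le> ennreal ?Q * (H s + ennreal (C * (t / s) powr \<epsilon> * b s))"
    using inc[OF e] by auto
  have Q: "1 \<le> ?Q" by (rule quasi_const_ge_1)
  let ?D = "?Q * (1 + C * B)"
  have D: "1 \<le> ?D" using Q C(1) B mult_mono[of 1 ?Q 1 "1 + C * B"] by auto
  have "?h t \<le> ?D * max (t / s) (s / t) powr \<epsilon> * ?h s" if st: "0 < s" "0 < t" for s t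
  proof (cases "t \<le> s")
    case True
    have "?h t \<le> 1 * 1 * ?h s" using mono[OF st(2) True] fin[OF st(1)] by (simp add: enn2real_mono)
    also have "\<dots> \<le> ?D * max (t / s) (s / t) powr \<epsilon> * ?h s"
      using D e max_ratio_ge_1[OF st] pos[OF st(1)] by (intro mult_mono) (auto intro: ge_one_powr_ge_zero)
    finally show ?thesis .
  next
    case False
    let ?m = "(t / s) powr \<epsilon>"
    have m: "1 \<le> ?m" using st False e by (intro ge_one_powr_ge_zero) auto
    have "H t \<le> ennreal ?Q * (ennreal (?h s) + ennreal (C * ?m * b s))"
      using C(2)[OF st(1), of t] False fin[OF st(1)] by simp
    also have "\<dots> = ennreal (?Q * (?h s + C * ?m * b s))"
      using Q C(1) m b[OF st(1)] by (simp add: ennreal_mult ennreal_plus)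
    finally have "?h t \<le> ?Q * (?h s + C * ?m * b s)"
      using Q C(1) m b[OF st(1)] by (intro enn2real_leI) auto
    also have "\<dots> \<le> ?Q * (?m * ?h s + C * ?m * (B * ?h s))"
      using Q C(1) m lower[OF st(1)] pos[OF st(1)] by (intro mult_left_mono add_mono) auto
    also have "\<dots> = ?D * ?m * ?h s" by (simp add: algebra_simps)
    also have "\<dots> \<le> ?D * max (t / s) (s / t) powr \<epsilon> * ?h s"
      using D st e pos[OF st(1)] by (intro mult_right_mono mult_left_mono powr_mono2) auto
    finally show ?thesis .
  qed
  then show "\<exists>C>0. \<forall>s>0. \<forall>t>0. ?h t \<le> C * max (t / s) (s / t) powr \<epsilon> * ?h s"
    using D by (intro exI[of _ ?D]) auto
qed

text \<open>All three facts come from one growth estimate: enlarging (0,s) to (0,t) adds at most a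
  constant times (t/s)^d b(s). The norm dominates b because (0,t) contains a dyadic block next to
  t.\<close>

lemma wnorm_head:
  assumes "0 < q" "sv b" "wnorm q b {0<..<1} < top"
  shows wnorm_head_finite: "\<And>t. 0 < t \<Longrightarrow> wnorm q b {0<..<t} < top"
    and wnorm_head_sv: "sv (\<lambda>t. enn2real (wnorm q b {0<..<t}))"
    and wnorm_head_ge: "\<exists>C>0. \<forall>t>0. b t \<le> C * enn2real (wnorm q b {0<..<t})"
proof -
  let ?H = "\<lambda>t. wnorm q b {0<..<t}" and ?Q = "quasi_const q"
  have H_mono: "?H s \<le> ?H t" if "s \<le> t" for s t
    unfolding wnorm_eq_Nrm using assms(1) that by (intro Nrm_mono) auto
  have inc: "\<exists>C>0. \<forall>s t. 0 < s \<longrightarrow> s < t \<longrightarrow> ?H t \<le> ennreal ?Q * (?H s + ennreal (C * (t / s) powr d * b s))"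
    if d: "0 < d" for d
  proof -
    obtain C where C: "0 < C" "\<And>t. 0 < t \<Longrightarrow> Nrm q {t..} (\<lambda>u. ennreal (u powr (- d) * b u)) \<le> ennreal (C * (t powr (- d) * b t))"
      using Nrm_sv_tail[OF assms(1) d assms(2)] by auto
    have "?H t \<le> ennreal ?Q * (?H s + ennreal (C * (t / s) powr d * b s))" if st: "0 < s" "s < t" for s t
    proof -
      \<comment> \<open>On [s,t) the factor (t/u)^d is at least 1. Inserting it makes the norm over
        the whole half-line from s finite and of size s^(-d) b(s).\<close>
      have "Nrm q {s..<t} (\<lambda>u. ennreal (b u)) \<le> ennreal (t powr d) * Nrm q {s..} (\<lambda>u. ennreal (u powr (- d) * b u))"
      proof (rule Nrm_le_cmult)
        fix u assume u: "u \<in> {s..<t}"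
        have bu: "0 < b u" using sv_pos[OF assms(2)] u st by auto
        have "1 \<le> t powr d * u powr (- d)"
          using u st d by (auto simp: powr_minus field_simps intro!: powr_mono2)
        then have "1 * b u \<le> t powr d * u powr (- d) * b u"
          using bu by (intro mult_right_mono) auto
        then show "ennreal (b u) \<le> ennreal (t powr d) * ennreal (u powr (- d) * b u)"
          using bu by (simp add: ennreal_leI mult.assoc flip: ennreal_mult)
      qed (use assms in auto)
      also have "\<dots> \<le> ennreal (t powr d) * ennreal (C * (s powr (- d) * b s))"
        using C(2) st by (intro mult_left_mono) auto
      also have "\<dots> = ennreal (C * (t / s) powr d * b s)"
        using st C(1) sv_pos[OF assms(2) st(1)]
        by (simp add: powr_divide powr_minus_divide mult_ac flip: ennreal_mult)
      finally have 1: "Nrm q {s..<t} (\<lambda>u. ennreal (b u)) \<le> ennreal (C * (t / s) powr d * b s)" .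
      have "?H t \<le> ennreal ?Q * (?H s + Nrm q {s..<t} (\<lambda>u. ennreal (b u)))"
        unfolding wnorm_eq_Nrm using assms(1) by (intro Nrm_le_union) auto
      also have "\<dots> \<le> ennreal ?Q * (?H s + ennreal (C * (t / s) powr d * b s))"
        by (intro mult_left_mono add_left_mono 1) auto
      finally show ?thesis .
    qed
    then show ?thesis using C(1) by blast
  qed
  show fin: "?H t < top" if t: "0 < t" for t
  proof (cases "t \<le> 1")
    case True
    then show ?thesis using H_mono[OF True] assms(3) by (auto intro: le_less_trans)
  next
    case False
    \<comment> \<open>The growth estimate started at s = 1 carries finiteness on (0,1) to every
      (0,t).\<close>
    obtain C where "\<And>s t. 0 < s \<Longrightarrow> s < t \<Longrightarrow> ?H t \<le> ennreal ?Q * (?H s + ennreal (C * (t / s) powr 1 * b s))"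
      using inc[of 1] by auto
    from this[of 1 t] show ?thesis
      using False assms(3) by (auto simp: ennreal_mult_less_top intro: le_less_trans)
  qed
  obtain B where B: "0 < B" "\<And>t s. 0 < t \<Longrightarrow> t / 2 \<le> s \<Longrightarrow> s \<le> t \<Longrightarrow> ennreal (b t) \<le> ennreal B * wnorm q b {s<..<2 * s}"
    using wnorm_block[OF assms(1,2)] by auto
  have lower: "b t \<le> B * enn2real (?H t)" if t: "0 < t" for t
  proof -
    have "ennreal (b t) \<le> ennreal B * wnorm q b {t/2<..<2*(t/2)}" using B(2)[of t "t/2"] t by simp
    also have "\<dots> \<le> ennreal B * ?H t"
      unfolding wnorm_eq_Nrm using t assms(1) by (intro mult_left_mono Nrm_mono) auto
    also have "\<dots> = ennreal (B * enn2real (?H t))" using fin[OF t] B(1) by (simp add: ennreal_mult)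
    finally show ?thesis using B(1) by (simp add: ennreal_le_iff)
  qed
  then show "\<exists>C>0. \<forall>t>0. b t \<le> C * enn2real (?H t)" using B(1) by blast
  show "sv (\<lambda>t. enn2real (?H t))"
    using sv_pos[OF assms(2)] fin H_mono B(1) lower inc by (intro sv_enn2real[where b = b and q = q]) auto
qed

text \<open>Mirror image of the head: the added piece (t,s] is weighted with (u/t)^d and bounded by
  the head norm of u^d b(u). Slow variation is proved for the increasing function t -> H(1/t) and
  reflected back.\<close>

lemma wnorm_tail:
  assumes "0 < q" "sv b" "wnorm q b {1<..} < top"
  shows wnorm_tail_finite: "\<And>t. 0 < t \<Longrightarrow> wnorm q b {t<..} < top"
    and wnorm_tail_sv: "sv (\<lambda>t. enn2real (wnorm q b {t<..}))"
    and wnorm_tail_ge: "\<exists>C>0. \<forall>t>0. b t \<le> C * enn2real (wnorm q b {t<..})"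
proof -
  let ?H = "\<lambda>t. wnorm q b {t<..}" and ?Q = "quasi_const q"
  have H_mono: "?H s \<le> ?H t" if "t \<le> s" for s t
    unfolding wnorm_eq_Nrm using assms(1) that by (intro Nrm_mono) auto
  have inc: "\<exists>C>0. \<forall>s t. 0 < t \<longrightarrow> t < s \<longrightarrow> ?H t \<le> ennreal ?Q * (?H s + ennreal (C * (s / t) powr d * b s))"
    if d: "0 < d" for d
  proof -
    obtain C where C: "0 < C" "\<And>t. 0 < t \<Longrightarrow> Nrm q {0<..t} (\<lambda>u. ennreal (u powr d * b u)) \<le> ennreal (C * (t powr d * b t))"
      using Nrm_sv_head[OF assms(1) d assms(2)] by auto
    have "?H t \<le> ennreal ?Q * (?H s + ennreal (C * (s / t) powr d * b s))" if st: "0 < t" "t < s" for s t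
    proof -
      have "Nrm q {t<..s} (\<lambda>u. ennreal (b u)) \<le> ennreal (t powr (- d)) * Nrm q {0<..s} (\<lambda>u. ennreal (u powr d * b u))"
      proof (rule Nrm_le_cmult)
        fix u assume u: "u \<in> {t<..s}"
        have bu: "0 < b u" using sv_pos[OF assms(2)] u st by auto
        have "1 \<le> t powr (- d) * u powr d"
          using u st d by (auto simp: powr_minus field_simps intro!: powr_mono2)
        then have "1 * b u \<le> t powr (- d) * u powr d * b u"
          using bu by (intro mult_right_mono) auto
        then show "ennreal (b u) \<le> ennreal (t powr (- d)) * ennreal (u powr d * b u)"
          using bu by (simp add: ennreal_leI mult.assoc flip: ennreal_mult)
      qed (use assms st in auto)
      also have "\<dots> \<le> ennreal (t powr (- d)) * ennreal (C * (s powr d * b s))"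
        using C(2) st by (intro mult_left_mono) auto
      also have "\<dots> = ennreal (C * (s / t) powr d * b s)"
        using st C(1) sv_pos[OF assms(2), of s]
        by (simp add: powr_divide powr_minus_divide mult_ac flip: ennreal_mult)
      finally have 1: "Nrm q {t<..s} (\<lambda>u. ennreal (b u)) \<le> ennreal (C * (s / t) powr d * b s)" .
      have "?H t \<le> ennreal ?Q * (?H s + Nrm q {t<..s} (\<lambda>u. ennreal (b u)))"
        unfolding wnorm_eq_Nrm using assms(1) by (intro Nrm_le_union) auto
      also have "\<dots> \<le> ennreal ?Q * (?H s + ennreal (C * (s / t) powr d * b s))"
        by (intro mult_left_mono add_left_mono 1) auto
      finally show ?thesis .
    qed
    then show ?thesis using C(1) by blast
  qed
  show fin: "?H t < top" if t: "0 < t" for t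
  proof (cases "1 \<le> t")
    case True
    then show ?thesis using H_mono[OF True] assms(3) by (auto intro: le_less_trans)
  next
    case False
    obtain C where "\<And>s t. 0 < t \<Longrightarrow> t < s \<Longrightarrow> ?H t \<le> ennreal ?Q * (?H s + ennreal (C * (s / t) powr 1 * b s))"
      using inc[of 1] by auto
    from this[of t 1] show ?thesis
      using False assms(3) t by (auto simp: ennreal_mult_less_top intro: le_less_trans)
  qed
  obtain B where B: "0 < B" "\<And>t s. 0 < t \<Longrightarrow> t / 2 \<le> s \<Longrightarrow> s \<le> t \<Longrightarrow> ennreal (b t) \<le> ennreal B * wnorm q b {s<..<2 * s}"
    using wnorm_block[OF assms(1,2)] by auto
  have lower: "b t \<le> B * enn2real (?H t)" if t: "0 < t" for t
  proof -
    have "ennreal (b t) \<le> ennreal B * wnorm q b {t<..<2*t}" using B(2)[of t t] t by simp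
    also have "\<dots> \<le> ennreal B * ?H t"
      unfolding wnorm_eq_Nrm using t assms(1) by (intro mult_left_mono Nrm_mono) auto
    also have "\<dots> = ennreal (B * enn2real (?H t))" using fin[OF t] B(1) by (simp add: ennreal_mult)
    finally show ?thesis using B(1) by (simp add: ennreal_le_iff)
  qed
  then show "\<exists>C>0. \<forall>t>0. b t \<le> C * enn2real (?H t)" using B(1) by blast
  have "sv (\<lambda>t. enn2real (?H (1 / t)))"
  proof (rule sv_enn2real[where b = "\<lambda>t. b (1 / t)" and q = q])
    fix \<epsilon> :: real assume "0 < \<epsilon>"
    then obtain C where C: "0 < C" "\<And>s t. 0 < t \<Longrightarrow> t < s \<Longrightarrow> ?H t \<le> ennreal ?Q * (?H s + ennreal (C * (s / t) powr \<epsilon> * b s))"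
      using inc by blast
    have "?H (1 / t) \<le> ennreal ?Q * (?H (1 / s) + ennreal (C * (t / s) powr \<epsilon> * b (1 / s)))" if "0 < s" "s < t" for s t
      using C(2)[of "1 / t" "1 / s"] that by (simp add: field_simps)
    then show "\<exists>C>0. \<forall>s t. 0 < s \<longrightarrow> s < t \<longrightarrow> ?H (1 / t) \<le> ennreal ?Q * (?H (1 / s) + ennreal (C * (t / s) powr \<epsilon> * b (1 / s)))"
      using C(1) by blast
  qed (use sv_pos[OF assms(2)] fin H_mono B(1) lower in \<open>auto simp: field_simps\<close>)
  then show "sv (\<lambda>t. enn2real (?H t))" by (rule sv_reflect)
qed

lemma Lnorm_eq_Nrm:
  "Lnorm q S (\<lambda>u. ennreal (u powr (- \<theta> - recip q) * b u) * k u) = Nrm q S (\<lambda>u. ennreal (u powr (- \<theta>) * b u) * k u)"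
proof -
  have "u powr (- \<theta> - recip q) = u powr (- recip q) * u powr (- \<theta>)" for u
    using powr_add[of u "- \<theta>" "- recip q"] by (simp add: mult.commute)
  then show ?thesis by (simp add: Nrm_def ennreal_mult' mult.assoc)
qed

lemma Nrm_cong:
  assumes "0 < q" "S \<in> sets borel" "\<And>u. u \<in> S \<Longrightarrow> g u = h u" shows "Nrm q S g = Nrm q S h"
  using assms by (intro antisym Nrm_mono) auto

lemma Nrm_cmult_ge:
  assumes "0 < q" "S \<in> sets borel" "c \<noteq> top"
  shows "c * Nrm q S g \<le> Nrm q S (\<lambda>u. c * g u)"
proof (cases "c = 0")
  case False
  have "1 / c \<noteq> top" using False by (simp add: ennreal_divide_eq_top_iff)
  have inv: "c * (1 / c) = 1" using False assms(3) mult_divide_eq_ennreal[of c 1] by (simp add: ennreal_times_divide)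
  have "Nrm q S g \<le> 1 / c * Nrm q S (\<lambda>u. c * g u)"
  proof (rule Nrm_le_cmult)
    show "g u \<le> 1 / c * (c * g u)" for u
      using inv by (simp add: mult.assoc[symmetric] mult.commute[of "1 / c"])
  qed (use assms \<open>1 / c \<noteq> top\<close> in auto)
  then have "c * Nrm q S g \<le> c * (1 / c * Nrm q S (\<lambda>u. c * g u))" by (rule mult_left_mono) simp
  then show ?thesis using inv by (simp add: mult.assoc[symmetric])
qed simp

lemma Nrm_weight_le:
  assumes "0 < q" "S \<in> sets borel" "c \<noteq> top"
  shows "Nrm q S (\<lambda>u. ennreal (b u) * c) \<le> c * wnorm q b S"
  unfolding wnorm_eq_Nrm using assms by (intro Nrm_le_cmult) (auto simp: mult.commute)

text \<open>If g were infinite on the whole block, then 1 <= e g there for every e > 0, so the norm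
  of the constant 1 on the block would be arbitrarily small. No measurability of g enters.\<close>

lemma Nrm_finite_imp_ex:
  assumes "0 < q" "S \<in> sets borel" "0 < s" "{s<..<2 * s} \<subseteq> S" "Nrm q S g < top"
  shows "\<exists>u\<in>{s<..<2 * s}. g u < top"
proof (rule ccontr)
  assume "\<not> ?thesis"
  then have top: "\<And>u. u \<in> {s<..<2 * s} \<Longrightarrow> g u = top" by (metis top.not_eq_extremum)
  obtain c where c: "0 < c" "ennreal c \<le> Nrm q {s<..<2 * s} (\<lambda>_. 1)"
    using Nrm_const_ge[OF assms(1)] assms(3) by blast
  obtain n where n: "Nrm q S g = ennreal n" "0 \<le> n"
    using assms(5) by (cases "Nrm q S g" rule: ennreal_cases) auto
  \<comment> \<open>Chosen so that \<open>?e * n < c\<close>, with n + 1 in place of n because the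
    norm n may be 0.\<close>
  let ?e = "c / (2 * (n + 1))"
  have e: "0 < ?e" using c n by simp
  have "Nrm q {s<..<2 * s} (\<lambda>_. 1) \<le> ennreal ?e * Nrm q S g"
    using assms top e by (intro Nrm_le_cmult) (auto simp: ennreal_mult_top)
  also have "\<dots> = ennreal (?e * n)" unfolding n(1) using n e by (intro ennreal_mult[symmetric]) auto
  finally have "ennreal c \<le> ennreal (?e * n)" using c(2) by (rule order_trans[rotated])
  then have "c \<le> ?e * n" using mult_nonneg_nonneg[OF less_imp_le[OF e] n(2)] by (subst (asm) ennreal_le_iff)
  also have "\<dots> < ?e * (2 * (n + 1))" using n(2) by (intro mult_strict_left_mono e) simp
  also have "\<dots> = c" using n(2) by simp
  finally show False by simp
qed

lemma wnorm_atLeastLessThan_finite: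
  assumes "0 < q" "sv b" "0 < s" shows "wnorm q b {s..<t} < top"
proof -
  obtain C where C: "Nrm q {s..} (\<lambda>u. ennreal (u powr (- 1) * b u)) \<le> ennreal (C * (s powr (- 1) * b s))"
    using Nrm_sv_tail[OF assms(1), of 1 b] assms(2,3) by auto
  have "wnorm q b {s..<t} \<le> ennreal t * Nrm q {s..} (\<lambda>u. ennreal (u powr (- 1) * b u))"
    unfolding wnorm_eq_Nrm
  proof (rule Nrm_le_cmult)
    fix u assume u: "u \<in> {s..<t}"
    then have "b u \<le> t * (u powr (- 1) * b u)"
      using sv_pos[OF assms(2), of u] assms(3) by (simp add: powr_minus_divide field_simps)
    then show "ennreal (b u) \<le> ennreal t * ennreal (u powr (- 1) * b u)"
      using u assms(3) by (simp add: ennreal_leI flip: ennreal_mult')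
  qed (use assms in auto)
  also have "\<dots> < top" using C by (auto simp: ennreal_mult_less_top intro: le_less_trans)
  finally show ?thesis .
qed

lemma sv_cong: "sv b \<Longrightarrow> (\<And>t. 0 < t \<Longrightarrow> c t = b t) \<Longrightarrow> sv c"
  by (simp add: sv_def)

lemma sv_double:
  assumes "sv b" shows "\<exists>C>0. \<forall>t>0. b (2 * t) \<le> C * b t \<and> b (t / 2) \<le> C * b t"
proof -
  obtain C where C: "0 < C" "\<And>s t. 0 < s \<Longrightarrow> 0 < t \<Longrightarrow> b t \<le> C * max (t / s) (s / t) powr 1 * b s"
    using svE[OF assms, of 1] by auto
  have "b (2 * t) \<le> C * 2 * b t \<and> b (t / 2) \<le> C * 2 * b t" if "0 < t" for t
    using C(2)[of t "2 * t"] C(2)[of t "t / 2"] that by simp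
  then show ?thesis using C(1) by (intro exI[of _ "C * 2"]) auto
qed

lemma SV_measurable:
  assumes "b \<in> SV" "S \<subseteq> {0<..}" shows "(\<lambda>u. ennreal (b u)) \<in> borel_measurable (lebesgue_on S)"
proof -
  have "b \<in> borel_measurable (lebesgue_on S)"
    using assms by (auto simp: SV_def intro: measurable_restrict_mono)
  then show ?thesis by measurable
qed

lemma sv_block:
  assumes "sv c" "1 \<le> M"
  shows "\<exists>D\<ge>1. \<forall>s t. 0 < s \<longrightarrow> s \<le> t \<longrightarrow> t \<le> M * s \<longrightarrow> c t \<le> D * c s \<and> c s \<le> D * c t"
proof -
  obtain C where C: "0 < C" "\<And>s t. 0 < s \<Longrightarrow> 0 < t \<Longrightarrow> c t \<le> C * max (t / s) (s / t) powr 1 * c s"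
    using svE[OF assms(1), of 1] by auto
  have "c t \<le> max 1 (C * M) * c s \<and> c s \<le> max 1 (C * M) * c t" if st: "0 < s" "s \<le> t" "t \<le> M * s" for s t
  proof -
    have t: "0 < t" using st by simp
    have "max (t / s) (s / t) = t / s"
      using st t by (intro max_absorb1) (auto intro: order_trans[of _ 1])
    then have m: "max (t / s) (s / t) powr 1 \<le> M" "max (s / t) (t / s) powr 1 \<le> M"
      using st t by (auto simp: max.commute pos_divide_le_eq)
    have "c t \<le> C * max (t / s) (s / t) powr 1 * c s" by (rule C(2)[OF st(1) t])
    also have "\<dots> \<le> max 1 (C * M) * c s"
      using m C(1) sv_pos[OF assms(1) st(1)] by (intro mult_right_mono) (auto simp: le_max_iff_disj)
    finally have 1: "c t \<le> max 1 (C * M) * c s" .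
    have "c s \<le> C * max (s / t) (t / s) powr 1 * c t" by (rule C(2)[OF t st(1)])
    also have "\<dots> \<le> max 1 (C * M) * c t"
      using m C(1) sv_pos[OF assms(1) t] by (intro mult_right_mono) (auto simp: le_max_iff_disj)
    finally show ?thesis using 1 by simp
  qed
  then show ?thesis by (intro exI[of _ "max 1 (C * M)"]) auto
qed

section \<open>Discretization\<close>

text \<open>The l_r quasi-norm over the integers. Every function on a counting space is measurable,
  so \<open>ell_add\<close> holds without conditions.\<close>

definition ell :: "ennreal \<Rightarrow> (int \<Rightarrow> ennreal) \<Rightarrow> ennreal" where
  "ell r x = gnorm (count_space UNIV) r x"

lemma ell_mono: "0 < r \<Longrightarrow> (\<And>n. x n \<le> y n) \<Longrightarrow> ell r x \<le> ell r y"
  unfolding ell_def by (rule gnorm_mono)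

lemma ell_le_cmult:
  assumes "0 < r" "c \<noteq> top" "\<And>n. x n \<le> c * y n" shows "ell r x \<le> c * ell r y"
  using ell_mono[OF assms(1), of x "\<lambda>n. c * y n"] gnorm_cmult_le[OF assms(1,2), of "count_space UNIV" y] assms(3)
  unfolding ell_def by (auto intro: order_trans)

lemma ell_add: "0 < r \<Longrightarrow> ell r (\<lambda>n. x n + y n) \<le> ennreal (quasi_const r) * (ell r x + ell r y)"
  unfolding ell_def by (rule gnorm_add) auto

lemma le_ell_top: "x n \<le> ell top x"
  using gnorm_top_AE[of x "count_space UNIV"] by (simp add: ell_def AE_count_space)

lemma ell_top_le: "(\<And>n. x n \<le> C) \<Longrightarrow> ell top x \<le> C"
  unfolding ell_def by (rule gnorm_top_le) (simp add: AE_count_space)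

lemma ell_shift: "ell r (\<lambda>n. x (n + 1)) = ell r x"
proof (cases "r = top")
  case True
  have "x n \<le> ell top (\<lambda>n. x (n + 1))" for n
    using le_ell_top[of "\<lambda>n. x (n + 1)" "n - 1"] by simp
  then show ?thesis
    unfolding True by (intro antisym ell_top_le) (auto intro: le_ell_top)
next
  case False
  have "bij (\<lambda>n::int. n + 1)" by (rule bij_betwI[of _ _ _ "\<lambda>n. n - 1"]) auto
  then have "(\<integral>\<^sup>+ n. ennreal_powr (x (n + 1)) (enn2real r) \<partial>count_space UNIV)
      = (\<integral>\<^sup>+ n. ennreal_powr (x n) (enn2real r) \<partial>count_space UNIV)"
    by (rule nn_integral_bij_count_space[of "\<lambda>n. n + 1"])
  then show ?thesis using False by (simp add: ell_def gnorm_def)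
qed

lemma ennreal_powr_weight:
  assumes "0 < r" "r \<noteq> top" "0 < u"
  shows "ennreal_powr (ennreal (u powr (- recip r)) * z) (enn2real r) = ennreal (1 / u) * ennreal_powr z (enn2real r)"
  using enn2real_exponent_pos[OF assms(1,2)] recip_eq[OF assms(1,2)] assms(3)
  by (simp add: ennreal_powr_mult powr_powr powr_minus_divide[of _ 1])

text \<open>Meant for the grid \<Lambda>^n and for its image under \<rho>. The lower ratio 2 makes
  the points exhaust (0,\<infinity>) and gives each cell du/u-mass at least ln 2; the upper ratio
  bounds that mass by ln M.\<close>

locale partition =
  fixes x :: "int \<Rightarrow> real" and M :: real
  assumes pos: "\<And>n. 0 < x n"
    and double: "\<And>n. 2 * x n \<le> x (n + 1)"
    and ratio: "\<And>n. x (n + 1) \<le> M * x n"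
begin

lemma growth: "2 ^ k * x m \<le> x (m + int k)"
proof (induction k)
  case (Suc k)
  have "2 ^ Suc k * x m \<le> 2 * x (m + int k)" using Suc by simp
  also have "\<dots> \<le> x (m + int (Suc k))" using double[of "m + int k"] by (simp add: algebra_simps)
  finally show ?case .
qed simp

lemma strict_mono: "m < n \<Longrightarrow> x m < x n"
proof -
  assume "m < n"
  then obtain k where k: "n = m + 1 + int k" using zless_iff_Suc_zadd by auto
  have "x m < 2 * x m" using pos[of m] by simp
  also have "\<dots> \<le> 1 * x (m + 1)" using double by simp
  also have "\<dots> \<le> 2 ^ k * x (m + 1)" using pos[of "m + 1"] by (intro mult_right_mono) auto
  also have "\<dots> \<le> x n" using growth k by simp
  finally show ?thesis .
qed

lemma mono: "m \<le> n \<Longrightarrow> x m \<le> x n"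
  using strict_mono[of m n] by (cases "m = n") auto

lemma M_ge_2: "2 \<le> M"
proof -
  have "2 * x 0 \<le> M * x 0" using double[of 0] ratio[of 0] by simp
  then show ?thesis using pos[of 0] by simp
qed

lemma ex_index:
  assumes "0 < u" shows "\<exists>n. x n \<le> u \<and> u < x (n + 1)"
proof -
  obtain K where "u / x 0 < 2 ^ K" using real_arch_pow[of 2] by auto
  then have "u < 2 ^ K * x 0" using pos[of 0] by (simp add: field_simps)
  then have K: "u < x (int K)" using growth[of K 0] by simp
  obtain L where "x 0 / u < 2 ^ L" using real_arch_pow[of 2] by auto
  then have "x 0 < 2 ^ L * u" using assms by (simp add: field_simps)
  moreover have "2 ^ L * x (- int L) \<le> x 0" using growth[of L "- int L"] by simp
  ultimately have "2 ^ L * x (- int L) \<le> 2 ^ L * u" by linarith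
  then have L: "x (- int L) \<le> u" by simp
  \<comment> \<open>u lies between the grid points with indices -L and K, so the last grid point not
    above u is a maximum over a finite set.\<close>
  let ?A = "{n \<in> {- int L..int K}. x n \<le> u}"
  have ne: "?A \<noteq> {}" using L by (auto intro!: exI[of _ "- int L"])
  have "finite ?A" by (rule finite_subset[of _ "{- int L..int K}"]) auto
  then have Max: "Max ?A \<in> ?A" "\<And>n. n \<in> ?A \<Longrightarrow> n \<le> Max ?A" using ne Max_in by auto
  have "u < x (Max ?A + 1)"
  proof (rule ccontr)
    assume "\<not> ?thesis"
    then have le: "x (Max ?A + 1) \<le> u" by simp
    then have "Max ?A + 1 < int K" using K mono[of "int K" "Max ?A + 1"] by (rule_tac ccontr) auto
    then have "Max ?A + 1 \<in> ?A" using le Max(1) by auto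
    then show False using Max(2) by fastforce
  qed
  then show ?thesis using Max(1) by auto
qed

lemma unique_index:
  assumes "x m \<le> u" "u < x (m + 1)" "x n \<le> u" "u < x (n + 1)" shows "m = n"
  using assms mono[of "m + 1" n] mono[of "n + 1" m] by (cases m n rule: linorder_cases) auto

text \<open>G is the step function Y(n)/u on the n-th cell, written as a sum over all cells so that
  summation and integration can be exchanged. It is the measurable object with which arbitrary
  functions are later compared.\<close>

lemma nn_integral_step:
  fixes Y :: "int \<Rightarrow> ennreal"
  shows "\<exists>G. (\<integral>\<^sup>+ u. G u * indicator {0<..} u \<partial>lebesgue) = (\<integral>\<^sup>+ n. Y n * ennreal (ln (x (n + 1) / x n)) \<partial>count_space UNIV)
    \<and> (\<forall>n u. x n \<le> u \<longrightarrow> u < x (n + 1) \<longrightarrow> G u = ennreal (1 / u) * Y n)"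
proof -
  define g where "g n u = Y n * (ennreal (1 / u) * indicator {x n..<x (n+1)} u)" for n u
  define G where "G u = (\<integral>\<^sup>+ n. g n u \<partial>count_space UNIV)" for u
  have meas: "g n \<in> borel_measurable lborel" for n unfolding g_def by measurable
  have g_int: "(\<integral>\<^sup>+ u. g n u \<partial>lborel) = Y n * ennreal (ln (x (n + 1) / x n))" for n
  proof -
    have "((\<lambda>u. 1 / u) has_integral (ln (x (n + 1)) - ln (x n))) {x n..x (n+1)}"
      using pos[of n] strict_mono[of n "n+1"]
      by (intro fundamental_theorem_of_calculus)
        (auto intro!: derivative_eq_intros simp flip: has_real_derivative_iff_has_vector_derivative)
    then have "(\<integral>\<^sup>+ u. ennreal (1 / u) * indicator {x n..x (n+1)} u \<partial>lborel) = ennreal (ln (x (n + 1)) - ln (x n))"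
      using pos[of n] by (intro nn_integral_has_integral_lebesgue') auto
    \<comment> \<open>Calculus supplies the closed interval, disjointness of the cells requires the
      half-open one; a single point separates them.\<close>
    moreover have "(\<integral>\<^sup>+ u. ennreal (1 / u) * indicator {x n..x (n+1)} u \<partial>lborel)
        = (\<integral>\<^sup>+ u. ennreal (1 / u) * indicator {x n..<x (n+1)} u \<partial>lborel)"
      using AE_lborel_singleton[of "x (n+1)"]
      by (intro nn_integral_cong_AE) (auto split: split_indicator elim!: eventually_mono)
    ultimately show ?thesis
      unfolding g_def using pos[of n] pos[of "n+1"] by (subst nn_integral_cmult) (auto simp: ln_div)
  qed
  have G_eq: "G u = ennreal (1 / u) * Y n" if "x n \<le> u" "u < x (n + 1)" for n u
  proof -
    have "g m u = (ennreal (1 / u) * Y n) * indicator {n} m" for m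
    proof (cases "m = n")
      case True
      then show ?thesis using that by (simp add: g_def mult.commute)
    next
      case False
      then have "u \<notin> {x m..<x (m + 1)}" using unique_index[of m u n] that by auto
      then show ?thesis using False by (simp add: g_def)
    qed
    then have "G u = (\<integral>\<^sup>+ m. (ennreal (1 / u) * Y n) * indicator {n} m \<partial>count_space UNIV)"
      by (simp add: G_def)
    then show ?thesis by (subst (asm) nn_integral_cmult_indicator) auto
  qed
  have "G u * indicator {0<..} u = G u" for u
  proof (cases "0 < u")
    case False
    then have "u \<notin> {x n..<x (n + 1)}" for n using pos[of n] by auto
    then have "g n u = 0" for n by (simp add: g_def)
    then show ?thesis by (simp add: G_def)
  qed simp
  then have "(\<integral>\<^sup>+ u. G u * indicator {0<..} u \<partial>lebesgue) = (\<integral>\<^sup>+ u. G u \<partial>lborel)"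
    by (simp add: nn_integral_completion)
  also have "\<dots> = (\<integral>\<^sup>+ n. (\<integral>\<^sup>+ u. g n u \<partial>lborel) \<partial>count_space UNIV)"
    unfolding G_def using meas by (intro nn_integral_count_space_nn_integral) auto
  finally show ?thesis using G_eq by (intro exI[of _ G]) (simp add: g_int)
qed

text \<open>F may be nonmeasurable: only its pointwise domination by the step function of y is
  integrated, and no cell has mass above ln M.\<close>

lemma Nrm_le_ell:
  assumes "0 < r" and F: "\<And>n u. x n \<le> u \<Longrightarrow> u < x (n + 1) \<Longrightarrow> F u \<le> y n"
  shows "Nrm r {0<..} F \<le> ennreal (ln M powr recip r) * ell r y"
proof (cases "r = top")
  case True
  have "Nrm top {0<..} F \<le> ell top y"
    unfolding Nrm_def Lnorm_eq_gnorm
  proof (intro gnorm_top_le AE_I2)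
    fix u :: real assume "u \<in> space (lebesgue_on {0<..})"
    then have u: "0 < u" by simp
    then obtain n where "x n \<le> u" "u < x (n + 1)" using ex_index by blast
    then have "F u \<le> ell top y" using F[of n u] le_ell_top[of y n] by (auto intro: order_trans)
    then show "ennreal (u powr - recip top) * F u \<le> ell top y" using u by simp
  qed
  then show ?thesis using True M_ge_2 by simp
next
  case False
  let ?p = "enn2real r"
  have p: "0 < ?p" "recip r * ?p = 1" 
    using enn2real_exponent_pos[OF assms(1) False] recip_eq[OF assms(1) False] by auto
  obtain G where G: "(\<integral>\<^sup>+ u. G u * indicator {0<..} u \<partial>lebesgue)
      = (\<integral>\<^sup>+ n. ennreal_powr (y n) ?p * ennreal (ln (x (n + 1) / x n)) \<partial>count_space UNIV)"
    "\<And>n u. x n \<le> u \<Longrightarrow> u < x (n + 1) \<Longrightarrow> G u = ennreal (1 / u) * ennreal_powr (y n) ?p"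
    using nn_integral_step[of "\<lambda>n. ennreal_powr (y n) ?p"] by blast
  show ?thesis
    unfolding Nrm_def Lnorm_eq_gnorm
  proof (rule gnorm_leI[OF assms(1) False])
    have "(\<integral>\<^sup>+ u. ennreal_powr (ennreal (u powr (- recip r)) * F u) ?p \<partial>lebesgue_on {0<..})
        \<le> (\<integral>\<^sup>+ u. G u \<partial>lebesgue_on {0<..})"
    proof (rule nn_integral_mono)
      fix u :: real assume "u \<in> space (lebesgue_on {0<..})"
      then have u: "0 < u" by simp
      then obtain n where n: "x n \<le> u" "u < x (n + 1)" using ex_index by blast
      show "ennreal_powr (ennreal (u powr (- recip r)) * F u) ?p \<le> G u"
        using ennreal_powr_weight[OF assms(1) False u] G(2)[OF n] F[OF n] p(1)
        by (auto intro!: mult_left_mono ennreal_powr_mono)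
    qed
    also have "\<dots> = (\<integral>\<^sup>+ n. ennreal_powr (y n) ?p * ennreal (ln (x (n + 1) / x n)) \<partial>count_space UNIV)"
      using G(1) by (simp add: nn_integral_restrict_space)
    also have "\<dots> \<le> (\<integral>\<^sup>+ n. ennreal (ln M) * ennreal_powr (y n) ?p \<partial>count_space UNIV)"
    proof (rule nn_integral_mono)
      fix n
      have "ln (x (n + 1) / x n) \<le> ln M"
        using ratio[of n] pos[of n] pos[of "n+1"] M_ge_2 by (simp add: pos_divide_le_eq)
      then show "ennreal_powr (y n) ?p * ennreal (ln (x (n + 1) / x n)) \<le> ennreal (ln M) * ennreal_powr (y n) ?p"
        by (subst mult.commute) (intro mult_right_mono ennreal_leI, auto)
    qed
    also have "\<dots> = ennreal (ln M) * ennreal_powr (ell r y) ?p"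
      unfolding ell_def gnorm_powr[OF assms(1) False] by (intro nn_integral_cmult) auto
    also have "\<dots> = ennreal_powr (ennreal (ln M powr recip r) * ell r y) ?p"
      using p M_ge_2 by (simp add: ennreal_powr_mult powr_powr)
    finally show "(\<integral>\<^sup>+ u. ennreal_powr (ennreal (u powr (- recip r)) * F u) ?p \<partial>lebesgue_on {0<..}) \<le> \<dots>" .
  qed
qed

text \<open>Here F dominates the step function, and a cell mass of at least ln 2 recovers the
  sequence norm.\<close>

lemma ell_le_Nrm:
  assumes "0 < r" and F: "\<And>n u. x n \<le> u \<Longrightarrow> u < x (n + 1) \<Longrightarrow> y n \<le> F u"
  shows "ell r y \<le> ennreal ((1 / ln 2) powr recip r) * Nrm r {0<..} F"
proof (cases "r = top")
  case True
  have "y n \<le> Nrm top {0<..} F" for n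
  proof (rule ccontr)
    let ?M = "lebesgue_on {0<..}" and ?f = "\<lambda>u::real. ennreal (u powr (- recip top)) * F u"
    assume *: "\<not> ?thesis"
    have "AE u in ?M. ?f u \<le> Nrm top {0<..} F"
      unfolding Nrm_def Lnorm_eq_gnorm by (rule gnorm_top_AE)
    then have "AE u in lebesgue. 0 < u \<longrightarrow> ?f u \<le> Nrm top {0<..} F"
      by (subst (asm) AE_restrict_space_iff) auto
    \<comment> \<open>Otherwise F would exceed its essential bound on the whole n-th cell, which has
      positive length.\<close>
    then have "AE u in lebesgue. u \<notin> {x n..<x (n+1)}"
    proof (rule eventually_mono, intro notI)
      fix u assume u: "0 < u \<longrightarrow> ?f u \<le> Nrm top {0<..} F" "u \<in> {x n..<x (n+1)}"
      then have "0 < u" using pos[of n] by auto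
      then have "F u \<le> Nrm top {0<..} F" using u(1) by simp
      then show False using F[of n u] u(2) * by (auto dest: order_trans)
    qed
    then have "{x n..<x (n+1)} \<in> null_sets lebesgue"
      by (subst (asm) AE_iff_null_sets[symmetric]) auto
    then show False using strict_mono[of n "n+1"] by (auto simp: null_sets_def)
  qed
  then show ?thesis using True by (auto intro!: ell_top_le)
next
  case False
  let ?p = "enn2real r"
  have p: "0 < ?p" "recip r * ?p = 1" 
    using enn2real_exponent_pos[OF assms(1) False] recip_eq[OF assms(1) False] by auto
  obtain G where G: "(\<integral>\<^sup>+ u. G u * indicator {0<..} u \<partial>lebesgue)
      = (\<integral>\<^sup>+ n. ennreal_powr (y n) ?p * ennreal (ln (x (n + 1) / x n)) \<partial>count_space UNIV)"
    "\<And>n u. x n \<le> u \<Longrightarrow> u < x (n + 1) \<Longrightarrow> G u = ennreal (1 / u) * ennreal_powr (y n) ?p"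
    using nn_integral_step[of "\<lambda>n. ennreal_powr (y n) ?p"] by blast
  show ?thesis
    unfolding ell_def
  proof (rule gnorm_leI[OF assms(1) False])
    have "(\<integral>\<^sup>+ n. ennreal_powr (y n) ?p \<partial>count_space UNIV)
        \<le> (\<integral>\<^sup>+ n. ennreal (1 / ln 2) * (ennreal_powr (y n) ?p * ennreal (ln (x (n + 1) / x n))) \<partial>count_space UNIV)"
    proof (rule nn_integral_mono)
      fix n
      have "ln 2 \<le> ln (x (n + 1) / x n)"
        using double[of n] pos[of n] pos[of "n+1"] by (simp add: pos_le_divide_eq)
      then have "1 \<le> 1 / ln 2 * ln (x (n + 1) / x n)" by (simp add: field_simps)
      then have "1 \<le> ennreal (1 / ln 2) * ennreal (ln (x (n + 1) / x n))"
        by (subst ennreal_mult'[symmetric]) (auto simp flip: ennreal_1 intro: ennreal_leI)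
      then have "ennreal_powr (y n) ?p * 1 \<le> ennreal_powr (y n) ?p * (ennreal (1 / ln 2) * ennreal (ln (x (n + 1) / x n)))"
        by (intro mult_left_mono) auto
      then show "ennreal_powr (y n) ?p \<le> ennreal (1 / ln 2) * (ennreal_powr (y n) ?p * ennreal (ln (x (n + 1) / x n)))"
        by (simp add: mult.left_commute)
    qed
    also have "\<dots> = ennreal (1 / ln 2) * (\<integral>\<^sup>+ u. G u \<partial>lebesgue_on {0<..})"
      using G(1) by (subst nn_integral_cmult) (auto simp: nn_integral_restrict_space)
    also have "(\<integral>\<^sup>+ u. G u \<partial>lebesgue_on {0<..})
        \<le> (\<integral>\<^sup>+ u. ennreal_powr (ennreal (u powr (- recip r)) * F u) ?p \<partial>lebesgue_on {0<..})"
    proof (rule nn_integral_mono)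
      fix u :: real assume "u \<in> space (lebesgue_on {0<..})"
      then have u: "0 < u" by simp
      then obtain n where n: "x n \<le> u" "u < x (n + 1)" using ex_index by blast
      show "G u \<le> ennreal_powr (ennreal (u powr (- recip r)) * F u) ?p"
        using ennreal_powr_weight[OF assms(1) False u] G(2)[OF n] F[OF n] p(1)
        by (auto intro!: mult_left_mono ennreal_powr_mono)
    qed
    also have "\<dots> = ennreal_powr (Nrm r {0<..} F) ?p"
      unfolding Nrm_def Lnorm_eq_gnorm by (rule gnorm_powr[OF assms(1) False, symmetric])
    finally show "(\<integral>\<^sup>+ n. ennreal_powr (y n) ?p \<partial>count_space UNIV)
        \<le> ennreal_powr (ennreal ((1 / ln 2) powr recip r) * Nrm r {0<..} F) ?p"
      using p by (simp add: ennreal_powr_mult powr_powr mult_left_mono)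
  qed
qed

lemma Nrm_le_cmult_ell:
  assumes "0 < r" "\<And>n u. x n \<le> u \<Longrightarrow> u < x (n + 1) \<Longrightarrow> F u \<le> ennreal c * y n"
  shows "Nrm r {0<..} F \<le> ennreal (ln M powr recip r * c) * ell r y"
proof -
  have "Nrm r {0<..} F \<le> ennreal (ln M powr recip r) * ell r (\<lambda>n. ennreal c * y n)"
    using assms by (rule Nrm_le_ell)
  also have "\<dots> \<le> ennreal (ln M powr recip r) * (ennreal c * ell r y)"
    by (intro mult_left_mono ell_le_cmult assms(1)) auto
  finally show ?thesis by (simp add: ennreal_mult' mult.assoc)
qed

lemma ell_le_cmult_Nrm:
  assumes "0 < r" "\<And>n u. x n \<le> u \<Longrightarrow> u < x (n + 1) \<Longrightarrow> y n \<le> ennreal c * F u"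
  shows "ell r y \<le> ennreal ((1 / ln 2) powr recip r * c) * Nrm r {0<..} F"
proof -
  have "ell r y \<le> ennreal ((1 / ln 2) powr recip r) * Nrm r {0<..} (\<lambda>u. ennreal c * F u)"
    using assms by (rule ell_le_Nrm)
  also have "\<dots> \<le> ennreal ((1 / ln 2) powr recip r) * (ennreal c * Nrm r {0<..} F)"
    by (intro mult_left_mono Nrm_le_cmult assms(1)) auto
  finally show ?thesis by (simp add: ennreal_mult' mult.assoc)
qed

end

section \<open>A discrete Hardy inequality\<close>

text \<open>The integers are covered by the nonnegative and the nonpositive ones; counting 0 twice
  only weakens the constant.\<close>

lemma nn_integral_geometric_int:
  assumes "0 < z" "z < 1"
  shows "(\<integral>\<^sup>+ m. ennreal (z ^ nat \<bar>m\<bar>) \<partial>count_space (UNIV::int set)) \<le> ennreal (2 / (1 - z))"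
proof -
  let ?f = "\<lambda>m::int. ennreal (z ^ nat \<bar>m\<bar>)"
  have geo: "(\<integral>\<^sup>+ m. ?f m * indicator (range g) m \<partial>count_space UNIV) = ennreal (1 / (1 - z))"
    if g: "inj g" "\<And>k. \<bar>g k\<bar> = int k" for g :: "nat \<Rightarrow> int"
  proof -
    have "(\<integral>\<^sup>+ m. ?f m * indicator (range g) m \<partial>count_space UNIV) = (\<integral>\<^sup>+ m. ?f m \<partial>count_space (range g))"
      by (simp add: nn_integral_count_space_indicator)
    also have "\<dots> = (\<integral>\<^sup>+ k. ?f (g k) \<partial>count_space UNIV)"
      using g(1) by (intro nn_integral_bij_count_space[symmetric]) (simp add: inj_on_imp_bij_betw)
    also have "\<dots> = (\<Sum>k. ennreal (z ^ k))" by (simp add: nn_integral_count_space_nat g(2))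
    also have "\<dots> = ennreal (1 / (1 - z))"
      using assms by (intro suminf_ennreal_eq geometric_sums) auto
    finally show ?thesis .
  qed
  have "m \<in> range int \<union> range (\<lambda>k. - int k)" for m :: int
    by (cases m rule: int_cases2) auto
  then have U: "range int \<union> range (\<lambda>k. - int k) = UNIV" by blast
  have "(\<integral>\<^sup>+ m. ?f m \<partial>count_space UNIV)
      \<le> (\<integral>\<^sup>+ m. ?f m * indicator (range int) m \<partial>count_space UNIV)
        + (\<integral>\<^sup>+ m. ?f m * indicator (range (\<lambda>k. - int k)) m \<partial>count_space UNIV)"
    using nn_integral_union_le[of "range int" "count_space UNIV" "range (\<lambda>k. - int k)" ?f] unfolding U by simp
  also have "\<dots> = ennreal (1 / (1 - z)) + ennreal (1 / (1 - z))"
    by (subst (1 2) geo) (auto simp: inj_def)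
  also have "\<dots> = ennreal (2 / (1 - z))" using assms by (simp flip: ennreal_plus)
  finally show ?thesis .
qed

text \<open>For finite r the r-th power of a supremum is at most the sum of the r-th powers, which
  is again a geometric convolution, with ratio z^r; Tonelli and the geometric series finish. Using a
  supremum instead of a sum makes r < 1 no different from r >= 1.\<close>

lemma ell_hardy:
  assumes "0 < r" "0 < z" "z < 1"
  shows "\<exists>C>0. \<forall>E. ell r (\<lambda>n. SUP k. ennreal (z ^ nat \<bar>n - k\<bar>) * E k) \<le> ennreal C * ell r E"
proof (cases "r = top")
  case True
  have "ell top (\<lambda>n. SUP k. ennreal (z ^ nat \<bar>n - k\<bar>) * E k) \<le> ennreal 1 * ell top E" for E
  proof (intro ell_top_le SUP_least)
    fix n k
    have "ennreal (z ^ nat \<bar>n - k\<bar>) * E k \<le> ennreal 1 * ell top E"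
      using assms by (intro mult_mono le_ell_top ennreal_leI power_le_one) auto
    then show "ennreal (z ^ nat \<bar>n - k\<bar>) * E k \<le> ennreal 1 * ell top E" .
  qed
  then show ?thesis using True by (intro exI[of _ 1]) auto
next
  case False
  let ?p = "enn2real r"
  have p: "0 < ?p" "recip r * ?p = 1" "?p * recip r = 1" "0 < recip r"
    using enn2real_exponent_pos[OF assms(1) False] recip_eq[OF assms(1) False] by auto
  define w where "w = z powr ?p"
  have w: "0 < w" "w < 1" using assms(2,3) p(1) powr_less_mono2[of ?p z 1] by (auto simp: w_def)
  define D where "D = 2 / (1 - w)"
  have D: "0 < D" using w by (simp add: D_def)
  have "ell r (\<lambda>n. SUP k. ennreal (z ^ nat \<bar>n - k\<bar>) * E k) \<le> ennreal (D powr recip r) * ell r E" for E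
    unfolding ell_def
  proof (rule gnorm_leI[OF assms(1) False])
    let ?c = "count_space (UNIV :: int set)"
    let ?e = "\<lambda>k. ennreal_powr (E k) ?p"
    have summand: "ennreal_powr (ennreal (z ^ nat \<bar>n - k\<bar>) * E k) ?p = ennreal (w ^ nat \<bar>n - k\<bar>) * ?e k" for n k
      using assms(2) p(1) by (simp add: ennreal_powr_mult w_def powr_powr mult.commute flip: powr_realpow)
    have "ennreal_powr (SUP k. ennreal (z ^ nat \<bar>n - k\<bar>) * E k) ?p \<le> (\<integral>\<^sup>+ k. ennreal (w ^ nat \<bar>n - k\<bar>) * ?e k \<partial>?c)" for n
    proof -
      let ?I = "\<integral>\<^sup>+ k. ennreal (w ^ nat \<bar>n - k\<bar>) * ?e k \<partial>?c"
      have "(SUP k. ennreal (z ^ nat \<bar>n - k\<bar>) * E k) \<le> ennreal_powr ?I (recip r)"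
      proof (rule SUP_least)
        fix k
        have "ennreal (w ^ nat \<bar>n - k\<bar>) * ?e k \<le> ?I" by (rule nn_integral_ge_point) auto
        then have "ennreal_powr (ennreal_powr (ennreal (z ^ nat \<bar>n - k\<bar>) * E k) ?p) (recip r) \<le> ennreal_powr ?I (recip r)"
          unfolding summand using p by (intro ennreal_powr_mono) auto
        then show "ennreal (z ^ nat \<bar>n - k\<bar>) * E k \<le> ennreal_powr ?I (recip r)"
          using p by (simp add: ennreal_powr_inverse)
      qed
      then have "ennreal_powr (SUP k. ennreal (z ^ nat \<bar>n - k\<bar>) * E k) ?p \<le> ennreal_powr (ennreal_powr ?I (recip r)) ?p"
        using p by (intro ennreal_powr_mono) auto
      then show ?thesis using p by (simp add: ennreal_powr_inverse)
    qed
    then have "(\<integral>\<^sup>+ n. ennreal_powr (SUP k. ennreal (z ^ nat \<bar>n - k\<bar>) * E k) ?p \<partial>?c)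
        \<le> (\<integral>\<^sup>+ n. \<integral>\<^sup>+ k. ennreal (w ^ nat \<bar>n - k\<bar>) * ?e k \<partial>?c \<partial>?c)"
      by (intro nn_integral_mono)
    also have "\<dots> = (\<integral>\<^sup>+ k. \<integral>\<^sup>+ n. ennreal (w ^ nat \<bar>n - k\<bar>) * ?e k \<partial>?c \<partial>?c)"
      using nn_integral_fst_count_space[of "\<lambda>(n, k). ennreal (w ^ nat \<bar>n - k\<bar>) * ?e k"]
        nn_integral_snd_count_space[of "\<lambda>(n, k). ennreal (w ^ nat \<bar>n - k\<bar>) * ?e k"] by simp
    also have "\<dots> = (\<integral>\<^sup>+ k. (\<integral>\<^sup>+ n. ennreal (w ^ nat \<bar>n - k\<bar>) \<partial>?c) * ?e k \<partial>?c)"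
      by (intro nn_integral_cong nn_integral_multc) auto
    also have "\<dots> \<le> (\<integral>\<^sup>+ k. ennreal D * ?e k \<partial>?c)"
    proof (intro nn_integral_mono mult_right_mono)
      fix k
      have "bij (\<lambda>n::int. n - k)" by (rule bij_betwI[of _ _ _ "\<lambda>n. n + k"]) auto
      then have "(\<integral>\<^sup>+ n. ennreal (w ^ nat \<bar>n - k\<bar>) \<partial>?c) = (\<integral>\<^sup>+ m. ennreal (w ^ nat \<bar>m\<bar>) \<partial>?c)"
        by (rule nn_integral_bij_count_space[of "\<lambda>n. n - k"])
      then show "(\<integral>\<^sup>+ n. ennreal (w ^ nat \<bar>n - k\<bar>) \<partial>?c) \<le> ennreal D"
        using nn_integral_geometric_int[OF w] by (simp add: D_def)
    qed simp
    also have "\<dots> = ennreal D * ennreal_powr (gnorm ?c r E) ?p"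
      unfolding gnorm_powr[OF assms(1) False] by (intro nn_integral_cmult) auto
    also have "\<dots> = ennreal_powr (ennreal (D powr recip r) * gnorm ?c r E) ?p"
      using p D by (simp add: ennreal_powr_mult powr_powr)
    finally show "(\<integral>\<^sup>+ n. ennreal_powr (SUP k. ennreal (z ^ nat \<bar>n - k\<bar>) * E k) ?p \<partial>?c) \<le> \<dots>" .
  qed
  then show ?thesis using D by (intro exI[of _ "D powr recip r"]) auto
qed

section \<open>The K-functional\<close>

lemma le_cmult_trans:
  fixes x y z :: ennreal
  assumes "x \<le> ennreal C * y" "y \<le> ennreal D * z" "0 \<le> C"
  shows "x \<le> ennreal (C * D) * z"
proof -
  have "ennreal C * y \<le> ennreal C * (ennreal D * z)" using assms(2) by (rule mult_left_mono) simp
  also have "\<dots> = ennreal (C * D) * z" using assms(3) by (simp add: ennreal_mult' mult.assoc)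
  finally show ?thesis using assms(1) by (rule order_trans[rotated])
qed

lemma add_le_cmult:
  fixes x y z :: ennreal
  assumes "x \<le> ennreal C * z" "y \<le> ennreal D * z" "0 \<le> C" "0 \<le> D"
  shows "x + y \<le> ennreal (C + D) * z"
  using add_mono[OF assms(1,2)] assms(3,4) by (simp add: distrib_right)

lemma K_fun_le:
  "f0 \<in> elems X0 \<Longrightarrow> f1 \<in> elems X1 \<Longrightarrow> K_fun X0 X1 t (f0 + f1) \<le> qnorm X0 f0 + ennreal t * qnorm X1 f1"
  unfolding K_fun_def by (rule Inf_lower) blast

lemma K_fun_greatest:
  assumes "\<And>f0 f1. f0 \<in> elems X0 \<Longrightarrow> f1 \<in> elems X1 \<Longrightarrow> f = f0 + f1 \<Longrightarrow> B \<le> qnorm X0 f0 + ennreal t * qnorm X1 f1"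
  shows "B \<le> K_fun X0 X1 t f"
  unfolding K_fun_def by (rule Inf_greatest) (use assms in blast)

lemma le_cmult_iff:
  fixes x y :: ennreal
  assumes "0 < C" shows "x \<le> ennreal C * y \<longleftrightarrow> ennreal (1 / C) * x \<le> y"
proof
  assume "x \<le> ennreal C * y"
  then have "ennreal (1 / C) * x \<le> ennreal (1 / C) * (ennreal C * y)" by (rule mult_left_mono) simp
  also have "\<dots> = y" using assms by (simp add: mult.assoc[symmetric] flip: ennreal_mult)
  finally show "ennreal (1 / C) * x \<le> y" .
next
  assume "ennreal (1 / C) * x \<le> y"
  then have "ennreal C * (ennreal (1 / C) * x) \<le> ennreal C * y" by (rule mult_left_mono) simp
  also have "ennreal C * (ennreal (1 / C) * x) = x" using assms by (simp add: mult.assoc[symmetric] flip: ennreal_mult)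
  finally show "x \<le> ennreal C * y" .
qed

lemma K_fun_greatest_cmult:
  assumes "0 < C" and
    "\<And>f0 f1. f0 \<in> elems X0 \<Longrightarrow> f1 \<in> elems X1 \<Longrightarrow> f = f0 + f1 \<Longrightarrow> B \<le> ennreal C * (qnorm X0 f0 + ennreal t * qnorm X1 f1)"
  shows "B \<le> ennreal C * K_fun X0 X1 t f"
  unfolding le_cmult_iff[OF assms(1)]
  by (rule K_fun_greatest) (use assms(2) in \<open>simp add: le_cmult_iff[OF assms(1)]\<close>)

lemma K_fun_mono: "s \<le> t \<Longrightarrow> K_fun X0 X1 s f \<le> K_fun X0 X1 t f"
  by (rule K_fun_greatest) (auto intro!: order_trans[OF K_fun_le] add_left_mono mult_right_mono ennreal_leI)

lemma K_fun_scale: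
  assumes "0 < s" "s \<le> t" shows "K_fun X0 X1 t f \<le> ennreal (t / s) * K_fun X0 X1 s f"
proof (rule K_fun_greatest_cmult)
  fix f0 f1 assume f: "f0 \<in> elems X0" "f1 \<in> elems X1" "f = f0 + f1"
  have "1 * qnorm X0 f0 + ennreal t * qnorm X1 f1 \<le> ennreal (t / s) * qnorm X0 f0 + ennreal (t / s) * (ennreal s * qnorm X1 f1)"
    using assms by (intro add_mono mult_right_mono)
      (auto simp: mult.assoc[symmetric] ennreal_leI simp flip: ennreal_mult ennreal_1)
  then show "K_fun X0 X1 t f \<le> ennreal (t / s) * (qnorm X0 f0 + ennreal s * qnorm X1 f1)"
    using K_fun_le[OF f(1,2), of t] f(3) by (auto simp: distrib_left)
qed (use assms in auto)

text \<open>Outside the sum of the spaces the infimum is over the empty set and equals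
  \<open>top\<close>, so finiteness of K encodes membership.\<close>

lemma K_fun_finite_imp: "K_fun X0 X1 t f < top \<Longrightarrow> f \<in> elems X0 + elems X1"
  unfolding K_fun_def by (auto simp: Inf_less_iff)

text \<open>Sublevel sets of a monotone function are intervals. This supplies measurability of K and
  of the inner norms without regard to the spaces.\<close>

lemma borel_measurable_mono_ennreal:
  fixes f :: "real \<Rightarrow> ennreal"
  assumes "mono f" shows "f \<in> borel_measurable borel"
proof (rule borel_measurableI_less)
  fix y
  have "is_interval {x. f x < y}"
    unfolding is_interval_1 using assms by (auto dest: monoD intro: le_less_trans)
  then show "{x \<in> space borel. f x < y} \<in> sets borel"
    by (simp add: real_interval_borel_measurable)
qed

lemma K_fun_measurable: "(\<lambda>t. K_fun X0 X1 t f) \<in> borel_measurable (lebesgue_on S)"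
  using borel_measurable_mono_ennreal[of "\<lambda>t. K_fun X0 X1 t f"]
  by (intro measurable_restrict_space1 measurable_completion) (simp add: monoI K_fun_mono)

section \<open>Properties of K for a compatible couple\<close>

locale couple =
  fixes A0 A1 :: "'v::real_vector qspace"
  assumes A0: "quasi_normed A0" and A1: "quasi_normed A1" and compatible: "compatible_couple A0 A1"
begin

abbreviation K :: "real \<Rightarrow> 'v \<Rightarrow> ennreal" where "K \<equiv> K_fun A0 A1"
abbreviation A01 :: "'v set" where "A01 \<equiv> elems A0 + elems A1"

lemma zero_in: "0 \<in> elems A0" "0 \<in> elems A1"
  using A0 A1 by (auto simp: quasi_normed_def subspace_0)

lemma qnorm_zero: "qnorm A0 0 = 0" "qnorm A1 0 = 0"
  using A0 A1 zero_in by (auto simp: quasi_normed_def)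

lemma in_sum: "f \<in> elems A0 \<Longrightarrow> f \<in> A01" "f \<in> elems A1 \<Longrightarrow> f \<in> A01"
  using set_plus_intro[of f "elems A0" 0 "elems A1"] set_plus_intro[of 0 "elems A0" f "elems A1"] zero_in by auto

lemma sum_add: "f \<in> A01 \<Longrightarrow> g \<in> A01 \<Longrightarrow> f + g \<in> A01"
proof -
  assume "f \<in> A01" "g \<in> A01"
  then obtain f0 f1 g0 g1 where *: "f0 \<in> elems A0" "f1 \<in> elems A1" "g0 \<in> elems A0" "g1 \<in> elems A1"
    "f = f0 + f1" "g = g0 + g1" by (auto elim!: set_plus_elim)
  then have "f0 + g0 \<in> elems A0" "f1 + g1 \<in> elems A1"
    using A0 A1 by (auto simp: quasi_normed_def intro: subspace_add)
  then have "(f0 + g0) + (f1 + g1) \<in> A01" by (rule set_plus_intro)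
  then show ?thesis using * by (simp add: algebra_simps)
qed

lemma K_le_0: "f \<in> elems A0 \<Longrightarrow> K t f \<le> qnorm A0 f"
  using K_fun_le[of f A0 0 A1 t] zero_in qnorm_zero by simp

lemma K_le_1: "f \<in> elems A1 \<Longrightarrow> K t f \<le> ennreal t * qnorm A1 f"
  using K_fun_le[of 0 A0 f A1 t] zero_in qnorm_zero by simp

lemma K_finite: "f \<in> A01 \<Longrightarrow> K t f < top"
proof -
  assume "f \<in> A01"
  then obtain f0 f1 where f: "f0 \<in> elems A0" "f1 \<in> elems A1" "f = f0 + f1" by (auto elim!: set_plus_elim)
  then have "qnorm A0 f0 + ennreal t * qnorm A1 f1 < top"
    using A0 A1 by (auto simp: quasi_normed_def ennreal_mult_less_top)
  then show ?thesis using K_fun_le[OF f(1,2), of t] f(3) by (auto intro: le_less_trans)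
qed

text \<open>The parts of a decomposition are estimated through f0 = f + (- f1) and f1 = f + (-
  f0).\<close>

lemma K_uminus: "f \<in> elems A0 \<Longrightarrow> K t (- f) \<le> qnorm A0 f" "f \<in> elems A1 \<Longrightarrow> K t (- f) \<le> ennreal t * qnorm A1 f"
proof -
  assume f: "f \<in> elems A0"
  then have "- f \<in> elems A0" using A0 by (auto simp: quasi_normed_def intro: subspace_neg)
  moreover have "qnorm A0 ((-1) *\<^sub>R f) = ennreal \<bar>-1\<bar> * qnorm A0 f"
    using A0 f unfolding quasi_normed_def by blast
  ultimately show "K t (- f) \<le> qnorm A0 f" using K_le_0[of "- f" t] by simp
next
  assume f: "f \<in> elems A1"
  then have "- f \<in> elems A1" using A1 by (auto simp: quasi_normed_def intro: subspace_neg)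
  moreover have "qnorm A1 ((-1) *\<^sub>R f) = ennreal \<bar>-1\<bar> * qnorm A1 f"
    using A1 f unfolding quasi_normed_def by blast
  ultimately show "K t (- f) \<le> ennreal t * qnorm A1 f" using K_le_1[of "- f" t] by simp
qed

text \<open>This is the only place where compatibility of the couple is needed.\<close>

lemma K_eq_0_imp:
  assumes "0 < t" "K t f = 0" shows "f = 0"
proof (rule ccontr)
  assume f: "f \<noteq> 0"
  obtain T where T: "hausdorff_tvs T" "embeds_in_topology A0 T" "embeds_in_topology A1 T"
    using compatible by (auto simp: compatible_couple_def)
  obtain U V where UV: "openin T U" "openin T V" "0 \<in> U" "f \<in> V" "disjnt U V"
    using T(1) f unfolding hausdorff_tvs_def Hausdorff_space_def by (metis UNIV_I)
  then have fU: "f \<notin> U" by (auto simp: disjnt_iff)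
  \<comment> \<open>The preimage of U under addition is a neighbourhood of (0,0) and hence contains
    a product V0 x V1: a sum of two small vectors lies in U.\<close>
  let ?W = "{z \<in> topspace (prod_topology T T). (case z of (x, y) \<Rightarrow> x + y) \<in> U}"
  have "openin (prod_topology T T) ?W"
    using T(1) UV(1) unfolding hausdorff_tvs_def by (blast intro: openin_continuous_map_preimage)
  then have "\<forall>x y. (x, y) \<in> ?W \<longrightarrow> (\<exists>V0 V1. openin T V0 \<and> openin T V1 \<and> x \<in> V0 \<and> y \<in> V1 \<and> V0 \<times> V1 \<subseteq> ?W)"
    by (rule openin_prod_topology_alt[THEN iffD1])
  moreover have "(0, 0) \<in> ?W" using T(1) UV(3) by (simp add: hausdorff_tvs_def)
  ultimately have "\<exists>V0 V1. openin T V0 \<and> openin T V1 \<and> 0 \<in> V0 \<and> 0 \<in> V1 \<and> V0 \<times> V1 \<subseteq> ?W"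
    by meson
  then obtain V0 V1 where V: "openin T V0" "openin T V1" "0 \<in> V0" "0 \<in> V1" and sub: "V0 \<times> V1 \<subseteq> ?W"
    by (elim exE conjE)
  obtain e0 where e0: "0 < e0" "\<And>x. x \<in> elems A0 \<Longrightarrow> qnorm A0 x < e0 \<Longrightarrow> x \<in> V0"
    using T(2) V(1,3) unfolding embeds_in_topology_def by meson
  obtain e1 where e1: "0 < e1" "\<And>x. x \<in> elems A1 \<Longrightarrow> qnorm A1 x < e1 \<Longrightarrow> x \<in> V1"
    using T(3) V(2,4) unfolding embeds_in_topology_def by meson
  \<comment> \<open>This threshold forces both parts of some decomposition below their own bounds e0
    and e1.\<close>
  have "K t f < min e0 (ennreal t * e1)"
    using assms e0(1) e1(1) by (auto simp: ennreal_zero_less_mult_iff)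
  then obtain f0 f1 where f01: "f0 \<in> elems A0" "f1 \<in> elems A1" "f = f0 + f1"
    "qnorm A0 f0 + ennreal t * qnorm A1 f1 < min e0 (ennreal t * e1)"
    unfolding K_fun_def Inf_less_iff by blast
  have "qnorm A0 f0 < e0" using f01(4) by (auto intro: le_less_trans[rotated])
  moreover have "ennreal t * qnorm A1 f1 < ennreal t * e1" using f01(4) by (auto intro: le_less_trans[rotated])
  then have "qnorm A1 f1 < e1" by (meson mult_left_mono not_less zero_le)
  ultimately have "(f0, f1) \<in> ?W" using e0(2)[OF f01(1)] e1(2)[OF f01(2)] sub by blast
  then have "f \<in> U" using f01(3) by simp
  then show False using fU by simp
qed

text \<open>When K is positive and finite, K < 2K leaves room for an almost optimal decomposition.
  When K = 0 there is no room, and f = 0 has to be known instead.\<close>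

lemma K_decomp:
  assumes "0 < t" "f \<in> A01"
  shows "\<exists>f0\<in>elems A0. \<exists>f1\<in>elems A1. f = f0 + f1 \<and> qnorm A0 f0 + ennreal t * qnorm A1 f1 \<le> 2 * K t f"
proof (cases "K t f = 0")
  case True
  then have "f = 0 + 0" using K_eq_0_imp[OF assms(1)] by simp
  then show ?thesis using zero_in qnorm_zero by (intro bexI[of _ 0]) auto
next
  case False
  obtain k where k: "K t f = ennreal k" "0 \<le> k"
    using K_finite[OF assms(2), of t] by (cases "K t f" rule: ennreal_cases) auto
  then have "k \<noteq> 0" using False by auto
  then have "ennreal k < ennreal (2 * k)" using k(2) by (intro ennreal_lessI) auto
  then have "K t f < 2 * K t f" using k by (simp add: ennreal_mult)
  then obtain f0 f1 where "f0 \<in> elems A0" "f1 \<in> elems A1" "f = f0 + f1"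
    "qnorm A0 f0 + ennreal t * qnorm A1 f1 < 2 * K t f"
    unfolding K_fun_def[of _ _ _ f] Inf_less_iff by blast
  then show ?thesis by (auto intro: less_imp_le)
qed

lemma K_add: "\<exists>C>0. \<forall>t>0. \<forall>f g. K t (f + g) \<le> ennreal C * (K t f + K t g)"
proof -
  obtain C0 C1 where C0: "\<And>x y. x \<in> elems A0 \<Longrightarrow> y \<in> elems A0 \<Longrightarrow> qnorm A0 (x + y) \<le> ennreal C0 * (qnorm A0 x + qnorm A0 y)"
    and C1: "\<And>x y. x \<in> elems A1 \<Longrightarrow> y \<in> elems A1 \<Longrightarrow> qnorm A1 (x + y) \<le> ennreal C1 * (qnorm A1 x + qnorm A1 y)"
    using A0 A1 unfolding quasi_normed_def by metis
  \<comment> \<open>The constants in \<open>quasi_normed\<close> are arbitrary reals, and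
    \<open>ennreal\<close> sends negative ones to 0; the maximum with 1 avoids this. The further
    factor 2 comes from \<open>K_decomp\<close>.\<close>
  let ?C = "max 1 (max C0 C1)"
  have "K t (f + g) \<le> ennreal (?C * 2) * (K t f + K t g)" if t: "0 < t" for t f g
  proof (cases "f \<in> A01 \<and> g \<in> A01")
    case False
    then have "K t f = top \<or> K t g = top"
      by (metis K_fun_finite_imp top.not_eq_extremum)
    then show ?thesis by (auto simp: ennreal_mult_top)
  next
    case True
    obtain f0 f1 where f: "f0 \<in> elems A0" "f1 \<in> elems A1" "f = f0 + f1" "qnorm A0 f0 + ennreal t * qnorm A1 f1 \<le> 2 * K t f"
      using K_decomp[OF t] True by blast
    obtain g0 g1 where g: "g0 \<in> elems A0" "g1 \<in> elems A1" "g = g0 + g1" "qnorm A0 g0 + ennreal t * qnorm A1 g1 \<le> 2 * K t g"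
      using K_decomp[OF t] True by blast
    have in_A: "f0 + g0 \<in> elems A0" "f1 + g1 \<in> elems A1"
      using A0 A1 f g by (auto simp: quasi_normed_def intro: subspace_add)
    have "K t (f + g) = K t ((f0 + g0) + (f1 + g1))" using f g by (simp add: algebra_simps)
    also have "\<dots> \<le> qnorm A0 (f0 + g0) + ennreal t * qnorm A1 (f1 + g1)" by (rule K_fun_le[OF in_A])
    also have "\<dots> \<le> ennreal ?C * (qnorm A0 f0 + qnorm A0 g0) + ennreal t * (ennreal ?C * (qnorm A1 f1 + qnorm A1 g1))"
      using f g by (intro add_mono mult_left_mono order_trans[OF C0] order_trans[OF C1] mult_right_mono ennreal_leI) auto
    also have "\<dots> = ennreal ?C * ((qnorm A0 f0 + ennreal t * qnorm A1 f1) + (qnorm A0 g0 + ennreal t * qnorm A1 g1))"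
      by (simp add: algebra_simps)
    also have "\<dots> \<le> ennreal ?C * (2 * K t f + 2 * K t g)" using f g by (intro mult_left_mono add_mono) auto
    also have "\<dots> = ennreal (?C * 2) * (K t f + K t g)"
      by (subst ennreal_mult) (auto simp: algebra_simps)
    finally show ?thesis .
  qed
  then show ?thesis by (intro exI[of _ "?C * 2"]) auto
qed

end

section \<open>A Holmstedt-type formula\<close>

locale holmstedt = couple A0 A1 for A0 A1 :: "'v::real_vector qspace" +
  fixes q1 r1 r0 :: ennreal and a1 b1 b0 \<chi>0 \<chi>1 \<rho> :: "real \<Rightarrow> real"
  assumes q1: "0 < q1" and r1: "0 < r1" and r0: "0 < r0"
    and a1: "a1 \<in> SV" and b1: "b1 \<in> SV" and b0: "b0 \<in> SV"
    and b1_finite: "wnorm r1 b1 {1<..} < top"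
    and W_finite: "wnorm2 r1 b1 q1 a1 1 < top"
    and b0_finite: "wnorm r0 b0 {1<..} < top"
    and \<chi>1: "\<And>t. 0 < t \<Longrightarrow>
      \<chi>1 t = enn2real (wnorm2 r1 b1 q1 a1 t + wnorm r1 b1 {t<..} * wnorm q1 a1 {0<..<t})"
    and \<chi>0: "\<And>t. 0 < t \<Longrightarrow> \<chi>0 t = enn2real (wnorm r0 b0 {t<..})"
    and \<rho>: "\<And>t. 0 < t \<Longrightarrow> \<rho> t = t * (\<chi>0 t / \<chi>1 t)"
begin

lemmas sv_a1 = SV_imp_sv[OF a1] and sv_b1 = SV_imp_sv[OF b1] and sv_b0 = SV_imp_sv[OF b0]

text \<open>Real-valued forms of the ingredients of \<chi>1. Since \<open>enn2real top\<close> is 0,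
  they carry information only together with the finiteness lemmas \<open>ennreal_\<alpha>\<close>,
  \<open>ennreal_\<beta>\<close> and \<open>ennreal_\<omega>\<close>.\<close>

definition "\<alpha> t = enn2real (wnorm q1 a1 {0<..<t})"
definition "\<beta> t = enn2real (wnorm r1 b1 {t<..})"
definition "\<omega> t = enn2real (wnorm2 r1 b1 q1 a1 t)"

text \<open>Only the double norm over (0,1) is assumed finite. This gives one s in (1/2,1) with
  finite inner norm, and the missing piece [s,1) stays away from 0.\<close>

lemma a1_finite: "wnorm q1 a1 {0<..<1} < top"
proof -
  have "Nrm r1 {0<..<1} (\<lambda>s. ennreal (b1 s) * wnorm q1 a1 {0<..<s}) < top"
    using W_finite by (simp add: wnorm2_def Nrm_def ennreal_mult' mult.assoc)
  then have "\<exists>s\<in>{1/2<..<2 * (1/2)}. ennreal (b1 s) * wnorm q1 a1 {0<..<s} < top"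
    by (intro Nrm_finite_imp_ex[OF r1, where S = "{0<..<1}"]) auto
  then obtain s where s: "1/2 < s" "s < 1" "ennreal (b1 s) * wnorm q1 a1 {0<..<s} < top" by auto
  then have "wnorm q1 a1 {0<..<s} < top"
    using sv_pos[OF sv_b1, of s] by (auto simp: ennreal_mult_less_top)
  moreover have "wnorm q1 a1 {s..<1} < top"
    using s by (intro wnorm_atLeastLessThan_finite q1 sv_a1) auto
  moreover have "wnorm q1 a1 {0<..<1} \<le> ennreal (quasi_const q1) * (wnorm q1 a1 {0<..<s} + wnorm q1 a1 {s..<1})"
    unfolding wnorm_eq_Nrm by (intro Nrm_le_union q1) auto
  ultimately show ?thesis by (auto simp: ennreal_mult_less_top intro: le_less_trans)
qed

lemma ennreal_\<alpha>: "0 < t \<Longrightarrow> wnorm q1 a1 {0<..<t} = ennreal (\<alpha> t)"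
  using wnorm_head_finite[OF q1 sv_a1 a1_finite] by (simp add: \<alpha>_def)

lemma sv_\<alpha>: "sv \<alpha>"
  using wnorm_head_sv[OF q1 sv_a1 a1_finite] by (simp add: \<alpha>_def[abs_def])

lemma a1_le_\<alpha>: "\<exists>C>0. \<forall>t>0. a1 t \<le> C * \<alpha> t"
  using wnorm_head_ge[OF q1 sv_a1 a1_finite] by (simp add: \<alpha>_def)

lemma ennreal_\<beta>: "0 < t \<Longrightarrow> wnorm r1 b1 {t<..} = ennreal (\<beta> t)"
  using wnorm_tail_finite[OF r1 sv_b1 b1_finite] by (simp add: \<beta>_def)

lemma sv_\<beta>: "sv \<beta>"
  using wnorm_tail_sv[OF r1 sv_b1 b1_finite] by (simp add: \<beta>_def[abs_def])

text \<open>The double norm becomes the head norm of a single slowly varying weight, to which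
  \<open>wnorm_head\<close> applies.\<close>

lemma wnorm2_eq: "wnorm2 r1 b1 q1 a1 t = wnorm r1 (\<lambda>s. b1 s * \<alpha> s) {0<..<t}"
proof -
  have "wnorm2 r1 b1 q1 a1 t = Nrm r1 {0<..<t} (\<lambda>s. ennreal (b1 s) * wnorm q1 a1 {0<..<s})"
    by (simp add: wnorm2_def Nrm_def ennreal_mult' mult.assoc)
  also have "\<dots> = Nrm r1 {0<..<t} (\<lambda>s. ennreal (b1 s * \<alpha> s))"
    using sv_pos[OF sv_b1] by (intro Nrm_cong r1) (auto simp: ennreal_\<alpha> ennreal_mult' less_imp_le)
  finally show ?thesis by (simp add: wnorm_eq_Nrm)
qed

lemma ennreal_\<omega>: "0 < t \<Longrightarrow> wnorm2 r1 b1 q1 a1 t = ennreal (\<omega> t)"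
  and sv_\<omega>: "sv \<omega>"
proof -
  have sv: "sv (\<lambda>s. b1 s * \<alpha> s)" by (intro sv_mult sv_b1 sv_\<alpha>)
  have fin: "wnorm r1 (\<lambda>s. b1 s * \<alpha> s) {0<..<1} < top" using W_finite by (simp add: wnorm2_eq)
  show "0 < t \<Longrightarrow> wnorm2 r1 b1 q1 a1 t = ennreal (\<omega> t)"
    using wnorm_head_finite[OF r1 sv fin] by (simp add: \<omega>_def wnorm2_eq)
  show "sv \<omega>"
    using wnorm_head_sv[OF r1 sv fin] by (simp add: \<omega>_def[abs_def] wnorm2_eq)
qed

lemma \<chi>1_eq: "0 < t \<Longrightarrow> \<chi>1 t = \<omega> t + \<beta> t * \<alpha> t"
  using sv_pos[OF sv_\<alpha>, of t] sv_pos[OF sv_\<beta>, of t] sv_pos[OF sv_\<omega>, of t]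
  by (simp add: \<chi>1 ennreal_\<alpha> ennreal_\<beta> ennreal_\<omega> less_imp_le flip: ennreal_mult ennreal_plus)

lemma sv_\<chi>1: "sv \<chi>1"
  by (rule sv_cong[of "\<lambda>t. \<omega> t + \<beta> t * \<alpha> t"]) (auto intro!: sv_add sv_mult sv_\<omega> sv_\<beta> sv_\<alpha> \<chi>1_eq)

lemma ennreal_\<chi>0: "0 < t \<Longrightarrow> wnorm r0 b0 {t<..} = ennreal (\<chi>0 t)"
  using wnorm_tail_finite[OF r0 sv_b0 b0_finite] by (simp add: \<chi>0)

lemma sv_\<chi>0: "sv \<chi>0"
  using wnorm_tail_sv[OF r0 sv_b0 b0_finite] by (rule sv_cong) (rule \<chi>0)

lemma b0_le_\<chi>0: "\<exists>C>0. \<forall>t>0. b0 t \<le> C * \<chi>0 t"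
  using wnorm_tail_ge[OF r0 sv_b0 b0_finite] by (simp add: \<chi>0)

lemma \<chi>_pos: "0 < t \<Longrightarrow> 0 < \<chi>0 t" "0 < t \<Longrightarrow> 0 < \<chi>1 t"
  using sv_pos[OF sv_\<chi>0] sv_pos[OF sv_\<chi>1] by auto

lemma \<rho>_pos: "0 < t \<Longrightarrow> 0 < \<rho> t"
  using \<chi>_pos by (simp add: \<rho>)

section \<open>The functionals of the Holmstedt-type formula\<close>

text \<open>The factor 1/v is v^(-\<theta>) of the X1 norm, where \<theta> = 1. \<open>Jin\<close>
  started at 0 enters the X1 norm \<open>N1\<close>; \<open>J\<close> truncates both the inner and
  the outer norm at t.\<close>

definition ker :: "'v \<Rightarrow> real \<Rightarrow> ennreal" where "ker f v = ennreal (a1 v / v) * K v f"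
definition Jin :: "real \<Rightarrow> real \<Rightarrow> 'v \<Rightarrow> ennreal" where "Jin t s f = Nrm q1 {t<..<s} (ker f)"
definition I :: "real \<Rightarrow> 'v \<Rightarrow> ennreal" where "I t f = Nrm r0 {0<..<t} (\<lambda>u. ennreal (b0 u) * K u f)"
definition J :: "real \<Rightarrow> 'v \<Rightarrow> ennreal" where "J t f = Nrm r1 {t<..} (\<lambda>s. ennreal (b1 s) * Jin t s f)"
definition P :: "real \<Rightarrow> 'v \<Rightarrow> ennreal" where "P t f = I t f + ennreal (\<chi>0 t) * K t f + ennreal (\<rho> t) * J t f"
definition N0 :: "'v \<Rightarrow> ennreal" where "N0 f = Nrm r0 {0<..} (\<lambda>u. ennreal (b0 u) * K u f)"
definition N1 :: "'v \<Rightarrow> ennreal" where "N1 f = Nrm r1 {0<..} (\<lambda>s. ennreal (b1 s) * Jin 0 s f)"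

lemma Jin_mono: "t' \<le> t \<Longrightarrow> s \<le> s' \<Longrightarrow> Jin t s f \<le> Jin t' s' f"
  unfolding Jin_def by (intro Nrm_mono q1) auto

lemma ker_measurable: "S \<subseteq> {0<..} \<Longrightarrow> ker f \<in> borel_measurable (lebesgue_on S)"
proof -
  assume S: "S \<subseteq> {0<..}"
  have "a1 \<in> borel_measurable (lebesgue_on S)"
    using S a1 by (auto simp: SV_def intro: measurable_restrict_mono)
  moreover have "(\<lambda>v::real. v) \<in> borel_measurable (lebesgue_on S)"
    by (intro measurable_restrict_space1 measurable_completion) simp
  ultimately show ?thesis
    unfolding ker_def using K_fun_measurable[of A0 A1 f S] by measurable
qed

text \<open>The inner norm is monotone in its right endpoint, hence Borel, whatever the
  integrand.\<close>

lemma weighted_Jin_measurable: "0 \<le> t \<Longrightarrow> (\<lambda>s. ennreal (b1 s) * Jin t s f) \<in> borel_measurable (lebesgue_on {t<..})"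
proof -
  assume t: "0 \<le> t"
  have "(\<lambda>s. Jin t s f) \<in> borel_measurable borel"
    by (intro borel_measurable_mono_ennreal monoI Jin_mono) auto
  then have "(\<lambda>s. Jin t s f) \<in> borel_measurable (lebesgue_on {t<..})"
    by (intro measurable_restrict_space1 measurable_completion) simp
  then show ?thesis using SV_measurable[OF b1, of "{t<..}"] t by (intro borel_measurable_times_ennreal) auto
qed

text \<open>With d > 0 the head norm of u^d b0(u) c(u) is governed by its value at t, and b0 is at
  most a multiple of \<chi>0. Applied with d = 1, c = 1/\<chi>1 for the Holmstedt lower bound and
  with c = \<open>c\<^sub>w\<close> for the Hardy estimate.\<close>

lemma I_bound:
  assumes "0 < d" "sv c"
  shows "\<exists>C>0. \<forall>t>0. \<forall>f N. N \<noteq> top \<longrightarrow> (\<forall>u. 0 < u \<longrightarrow> u < t \<longrightarrow> K u f \<le> N * ennreal (u powr d * c u)) \<longrightarrow>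
    I t f \<le> N * ennreal (C * (t powr d * c t * \<chi>0 t))"
proof -
  obtain D where D: "0 < D" "\<And>t. 0 < t \<Longrightarrow> Nrm r0 {0<..t} (\<lambda>u. ennreal (u powr d * (b0 u * c u))) \<le> ennreal (D * (t powr d * (b0 t * c t)))"
    using Nrm_sv_head[OF r0 assms(1) sv_mult[OF sv_b0 assms(2)]] by auto
  obtain E where E: "0 < E" "\<And>t. 0 < t \<Longrightarrow> b0 t \<le> E * \<chi>0 t" using b0_le_\<chi>0 by auto
  have "I t f \<le> N * ennreal (D * E * (t powr d * c t * \<chi>0 t))"
    if t: "0 < t" and N: "N \<noteq> top" and Kf: "\<And>u. 0 < u \<Longrightarrow> u < t \<Longrightarrow> K u f \<le> N * ennreal (u powr d * c u)" for t f N
  proof -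
    have "I t f \<le> N * Nrm r0 {0<..t} (\<lambda>u. ennreal (u powr d * (b0 u * c u)))"
      unfolding I_def
    proof (rule Nrm_le_cmult)
      fix u assume u: "u \<in> {0<..<t}"
      have "ennreal (b0 u) * K u f \<le> ennreal (b0 u) * (N * ennreal (u powr d * c u))"
        using Kf u by (intro mult_left_mono) auto
      also have "\<dots> = N * ennreal (u powr d * (b0 u * c u))"
        using u sv_pos[OF sv_b0, of u] sv_pos[OF assms(2), of u]
        by (simp add: mult.left_commute less_imp_le flip: ennreal_mult)
      finally show "ennreal (b0 u) * K u f \<le> N * ennreal (u powr d * (b0 u * c u))" .
    qed (use r0 N in auto)
    also have "\<dots> \<le> N * ennreal (D * (t powr d * (b0 t * c t)))" using D t by (intro mult_left_mono) auto
    also have "\<dots> \<le> N * ennreal (D * (t powr d * (E * \<chi>0 t * c t)))"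
      using D(1) E(2)[OF t] sv_pos[OF assms(2) t] by (intro mult_left_mono ennreal_leI mult_right_mono) auto
    finally show ?thesis by (simp add: ac_simps)
  qed
  then show ?thesis using D(1) E(1) by (intro exI[of _ "D * E"]) auto
qed

text \<open>Dual to \<open>I_bound\<close>: the kernel is at most v^(-d) a1(v) c(v), whose tail is
  governed by its value at t. The outer norm then contributes \<beta>(t), and a1 \<beta> is at most
  a multiple of \<alpha> \<beta>, a summand of \<chi>1.\<close>

lemma J_bound:
  assumes "0 < d" "sv c"
  shows "\<exists>C>0. \<forall>t>0. \<forall>f N. N \<noteq> top \<longrightarrow> (\<forall>v>t. K v f \<le> N * ennreal (v powr (1 - d) * c v)) \<longrightarrow>
    J t f \<le> N * ennreal (C * (t powr (- d) * c t * \<chi>1 t))"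
proof -
  obtain D where D: "0 < D" "\<And>t. 0 < t \<Longrightarrow> Nrm q1 {t..} (\<lambda>v. ennreal (v powr (- d) * (a1 v * c v))) \<le> ennreal (D * (t powr (- d) * (a1 t * c t)))"
    using Nrm_sv_tail[OF q1 assms(1) sv_mult[OF sv_a1 assms(2)]] by auto
  obtain E where E: "0 < E" "\<And>t. 0 < t \<Longrightarrow> a1 t \<le> E * \<alpha> t" using a1_le_\<alpha> by auto
  have "J t f \<le> N * ennreal (D * E * (t powr (- d) * c t * \<chi>1 t))"
    if t: "0 < t" and N: "N \<noteq> top" and Kf: "\<And>v. t < v \<Longrightarrow> K v f \<le> N * ennreal (v powr (1 - d) * c v)" for t f N
  proof -
    let ?X = "D * (t powr (- d) * (a1 t * c t))"
    have X: "0 \<le> ?X" using D(1) sv_pos[OF sv_a1 t] sv_pos[OF assms(2) t] by simp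
    \<comment> \<open>The bound does not depend on s, so it leaves the outer norm as a
      constant.\<close>
    have Jin: "Jin t s f \<le> N * ennreal ?X" for s
    proof -
      have "Jin t s f \<le> N * Nrm q1 {t..} (\<lambda>v. ennreal (v powr (- d) * (a1 v * c v)))"
        unfolding Jin_def
      proof (rule Nrm_le_cmult)
        fix v assume v: "v \<in> {t<..<s}"
        then have v0: "0 < v" using t by simp
        have p: "0 < a1 v" "0 < c v" using v0 sv_pos[OF sv_a1] sv_pos[OF assms(2)] by auto
        have "ker f v \<le> ennreal (a1 v / v) * (N * ennreal (v powr (1 - d) * c v))"
          unfolding ker_def using Kf v by (intro mult_left_mono) auto
        also have "\<dots> = N * ennreal (a1 v / v * (v powr (1 - d) * c v))"
          using v0 p by (simp add: mult.left_commute flip: ennreal_mult)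
        also have "a1 v / v * (v powr (1 - d) * c v) = v powr (- d) * (a1 v * c v)"
          using v0 by (simp add: powr_diff powr_minus field_simps)
        finally show "ker f v \<le> N * ennreal (v powr (- d) * (a1 v * c v))" .
      qed (use q1 N in auto)
      also have "\<dots> \<le> N * ennreal ?X" using D t by (intro mult_left_mono) auto
      finally show ?thesis .
    qed
    have "J t f \<le> Nrm r1 {t<..} (\<lambda>s. ennreal (b1 s) * (N * ennreal ?X))"
      unfolding J_def using Jin by (intro Nrm_mono r1 mult_left_mono) auto
    also have "\<dots> \<le> (N * ennreal ?X) * ennreal (\<beta> t)"
      using Nrm_weight_le[OF r1, of "{t<..}" "N * ennreal ?X" b1] N t by (simp add: ennreal_\<beta> ennreal_mult_eq_top_iff)
    also have "\<dots> = N * ennreal (?X * \<beta> t)" using sv_pos[OF sv_\<beta> t] by (subst ennreal_mult[OF X less_imp_le]) (auto simp only: mult.assoc)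
    also have "\<dots> \<le> N * ennreal (D * E * (t powr (- d) * c t * \<chi>1 t))"
    proof (intro mult_left_mono ennreal_leI)
      have "a1 t * \<beta> t \<le> E * \<alpha> t * \<beta> t" using E t sv_pos[OF sv_\<beta> t] by (intro mult_right_mono) auto
      also have "\<dots> \<le> E * \<chi>1 t" using E(1) sv_pos[OF sv_\<omega> t] t by (simp add: \<chi>1_eq algebra_simps)
      finally have "D * (t powr (- d) * c t) * (a1 t * \<beta> t) \<le> D * (t powr (- d) * c t) * (E * \<chi>1 t)"
        using D(1) sv_pos[OF assms(2) t] by (intro mult_left_mono) auto
      then show "?X * \<beta> t \<le> D * E * (t powr (- d) * c t * \<chi>1 t)" by (simp add: ac_simps)
    qed simp
    finally show ?thesis .
  qed
  then show ?thesis using D(1) E(1) by (intro exI[of _ "D * E"]) auto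
qed

lemma I_add: "\<exists>C>0. \<forall>t>0. \<forall>f g. I t (f + g) \<le> ennreal C * (I t f + I t g)"
proof -
  obtain C where C: "0 < C" "\<And>t f g. 0 < t \<Longrightarrow> K t (f + g) \<le> ennreal C * (K t f + K t g)" using K_add by auto
  have "I t (f + g) \<le> ennreal (C * quasi_const r0) * (I t f + I t g)" if "0 < t" for t f g
  proof (rule le_cmult_trans)
    show "I t (f + g) \<le> ennreal C * Nrm r0 {0<..<t} (\<lambda>u. ennreal (b0 u) * K u f + ennreal (b0 u) * K u g)"
      unfolding I_def
    proof (rule Nrm_le_cmult)
      fix u assume u: "u \<in> {0<..<t}"
      then have "ennreal (b0 u) * K u (f + g) \<le> ennreal (b0 u) * (ennreal C * (K u f + K u g))"
        using C by (intro mult_left_mono) auto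
      then show "ennreal (b0 u) * K u (f + g) \<le> ennreal C * (ennreal (b0 u) * K u f + ennreal (b0 u) * K u g)"
        by (simp add: algebra_simps)
    qed (use r0 in auto)
    show "Nrm r0 {0<..<t} (\<lambda>u. ennreal (b0 u) * K u f + ennreal (b0 u) * K u g) \<le> ennreal (quasi_const r0) * (I t f + I t g)"
      unfolding I_def by (intro Nrm_add r0 borel_measurable_times_ennreal SV_measurable b0 K_fun_measurable) auto
  qed (use C in auto)
  then show ?thesis using C(1) quasi_const_ge_1[of r0] by (intro exI[of _ "C * quasi_const r0"]) auto
qed

lemma J_add: "\<exists>C>0. \<forall>t>0. \<forall>f g. J t (f + g) \<le> ennreal C * (J t f + J t g)"
proof -
  obtain C where C: "0 < C" "\<And>t f g. 0 < t \<Longrightarrow> K t (f + g) \<le> ennreal C * (K t f + K t g)" using K_add by auto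
  let ?D = "C * quasi_const q1"
  have D: "0 < ?D" using C(1) quasi_const_ge_1[of q1] by simp
  have Jin: "Jin t s (f + g) \<le> ennreal ?D * (Jin t s f + Jin t s g)" if t: "0 < t" for t s f g
  proof (rule le_cmult_trans)
    show "Jin t s (f + g) \<le> ennreal C * Nrm q1 {t<..<s} (\<lambda>v. ker f v + ker g v)"
      unfolding Jin_def
    proof (rule Nrm_le_cmult)
      fix u assume u: "u \<in> {t<..<s}"
      then have "ker (f + g) u \<le> ennreal (a1 u / u) * (ennreal C * (K u f + K u g))"
        unfolding ker_def using C t by (intro mult_left_mono) auto
      then show "ker (f + g) u \<le> ennreal C * (ker f u + ker g u)"
        by (simp add: ker_def algebra_simps)
    qed (use q1 in auto)
    show "Nrm q1 {t<..<s} (\<lambda>v. ker f v + ker g v) \<le> ennreal (quasi_const q1) * (Jin t s f + Jin t s g)"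
      unfolding Jin_def using t by (intro Nrm_add q1 ker_measurable) auto
  qed (use C in auto)
  have "J t (f + g) \<le> ennreal (?D * quasi_const r1) * (J t f + J t g)" if t: "0 < t" for t f g
  proof (rule le_cmult_trans)
    show "J t (f + g) \<le> ennreal ?D * Nrm r1 {t<..} (\<lambda>s. ennreal (b1 s) * Jin t s f + ennreal (b1 s) * Jin t s g)"
      unfolding J_def
    proof (rule Nrm_le_cmult)
      fix s
      have "ennreal (b1 s) * Jin t s (f + g) \<le> ennreal (b1 s) * (ennreal ?D * (Jin t s f + Jin t s g))"
        using Jin t by (intro mult_left_mono) auto
      then show "ennreal (b1 s) * Jin t s (f + g) \<le> ennreal ?D * (ennreal (b1 s) * Jin t s f + ennreal (b1 s) * Jin t s g)"
        by (simp add: algebra_simps)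
    qed (use r1 in auto)
    show "Nrm r1 {t<..} (\<lambda>s. ennreal (b1 s) * Jin t s f + ennreal (b1 s) * Jin t s g) \<le> ennreal (quasi_const r1) * (J t f + J t g)"
      unfolding J_def using t by (intro Nrm_add r1 weighted_Jin_measurable) auto
  qed (use D in auto)
  then show ?thesis using D quasi_const_ge_1[of r1] by (intro exI[of _ "?D * quasi_const r1"]) auto
qed

lemma P_add: "\<exists>C>0. \<forall>t>0. \<forall>f g. P t (f + g) \<le> ennreal C * (P t f + P t g)"
proof -
  obtain C where C: "0 < C" "\<And>t f g. 0 < t \<Longrightarrow> K t (f + g) \<le> ennreal C * (K t f + K t g)" using K_add by auto
  obtain D where D: "0 < D" "\<And>t f g. 0 < t \<Longrightarrow> I t (f + g) \<le> ennreal D * (I t f + I t g)" using I_add by auto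
  obtain E where E: "0 < E" "\<And>t f g. 0 < t \<Longrightarrow> J t (f + g) \<le> ennreal E * (J t f + J t g)" using J_add by auto
  let ?M = "max C (max D E)"
  have "P t (f + g) \<le> ennreal ?M * (P t f + P t g)" if t: "0 < t" for t f g
  proof -
    have "P t (f + g) \<le> ennreal D * (I t f + I t g) + ennreal (\<chi>0 t) * (ennreal C * (K t f + K t g))
        + ennreal (\<rho> t) * (ennreal E * (J t f + J t g))"
      unfolding P_def using C D E t by (intro add_mono mult_left_mono) auto
    also have "\<dots> \<le> ennreal ?M * (I t f + I t g) + ennreal (\<chi>0 t) * (ennreal ?M * (K t f + K t g))
        + ennreal (\<rho> t) * (ennreal ?M * (J t f + J t g))"
      by (intro add_mono mult_left_mono mult_right_mono ennreal_leI) auto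
    also have "\<dots> = ennreal ?M * (P t f + P t g)" by (simp add: P_def algebra_simps)
    finally show ?thesis .
  qed
  then show ?thesis using C by (intro exI[of _ ?M]) auto
qed

text \<open>Only arguments beyond t are used, where K is at least K(t); what remains of the X0 norm
  is exactly \<chi>0(t).\<close>

lemma N0_ge: 
  assumes "0 < t" "f \<in> A01" shows "ennreal (\<chi>0 t) * K t f \<le> N0 f"
proof -
  have "ennreal (\<chi>0 t) * K t f = K t f * Nrm r0 {t<..} (\<lambda>u. ennreal (b0 u))"
    using ennreal_\<chi>0[OF assms(1)] by (simp add: wnorm_eq_Nrm mult.commute)
  also have "\<dots> \<le> Nrm r0 {t<..} (\<lambda>u. K t f * ennreal (b0 u))"
    using K_finite[OF assms(2), of t] by (intro Nrm_cmult_ge r0) auto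
  also have "\<dots> \<le> N0 f"
    unfolding N0_def using assms(1)
    unfolding mult.commute[of "K t f"] by (intro Nrm_mono r0 mult_left_mono K_fun_mono) auto
  finally show ?thesis .
qed

text \<open>For v < t one has K(v) >= (v/t) K(t). Restricting the outer variable to s < t yields the
  summand \<omega>(t) of \<chi>1, restricting it to s > t yields \<beta>(t) \<alpha>(t). Each is
  below the X1 norm, and adding them costs the factor 2.\<close>

lemma N1_ge:
  assumes "0 < t" "f \<in> A01" shows "ennreal (\<chi>1 t) * K t f \<le> ennreal (2 * t) * N1 f"
proof -
  let ?k = "ennreal (1 / t) * K t f"
  have k: "?k \<noteq> top" using K_finite[OF assms(2), of t] by (simp add: ennreal_mult_eq_top_iff)
  have inner: "?k * wnorm q1 a1 {0<..<s} \<le> Jin 0 s f" if s: "s \<le> t" for s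
  proof -
    have "?k * wnorm q1 a1 {0<..<s} \<le> Nrm q1 {0<..<s} (\<lambda>v. ?k * ennreal (a1 v))"
      unfolding wnorm_eq_Nrm by (intro Nrm_cmult_ge q1 k) auto
    also have "\<dots> \<le> Jin 0 s f"
      unfolding Jin_def
    proof (intro Nrm_mono q1)
      fix v assume v: "v \<in> {0<..<s}"
      have "?k \<le> ennreal (1 / t) * (ennreal (t / v) * K v f)"
        using v s by (intro mult_left_mono K_fun_scale) auto
      also have "\<dots> = ennreal (1 / v) * K v f"
        using v assms(1) by (simp add: mult.assoc[symmetric] flip: ennreal_mult)
      finally have "?k * ennreal (a1 v) \<le> ennreal (1 / v) * K v f * ennreal (a1 v)" by (rule mult_right_mono) simp
      also have "\<dots> = ker f v"
        using v sv_pos[OF sv_a1, of v] by (simp add: ker_def mult_ac ennreal_mult[symmetric] mult.assoc[symmetric])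
      finally show "?k * ennreal (a1 v) \<le> ker f v" .
    qed auto
    finally show ?thesis .
  qed
  have "?k * ennreal (\<omega> t) = ?k * Nrm r1 {0<..<t} (\<lambda>s. ennreal (b1 s) * wnorm q1 a1 {0<..<s})"
    using ennreal_\<omega>[OF assms(1)] by (simp add: wnorm2_def Nrm_def ennreal_mult' mult.assoc)
  also have "\<dots> \<le> Nrm r1 {0<..<t} (\<lambda>s. ?k * (ennreal (b1 s) * wnorm q1 a1 {0<..<s}))"
    by (intro Nrm_cmult_ge r1 k) auto
  also have "\<dots> \<le> N1 f"
    unfolding N1_def
  proof (intro Nrm_mono r1)
    fix s assume "s \<in> {0<..<t}"
    then have "ennreal (b1 s) * (?k * wnorm q1 a1 {0<..<s}) \<le> ennreal (b1 s) * Jin 0 s f"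
      using inner[of s] by (intro mult_left_mono) auto
    then show "?k * (ennreal (b1 s) * wnorm q1 a1 {0<..<s}) \<le> ennreal (b1 s) * Jin 0 s f"
      by (simp add: mult.left_commute)
  qed auto
  finally have 1: "?k * ennreal (\<omega> t) \<le> N1 f" .
  have "?k * ennreal (\<beta> t * \<alpha> t) = (?k * ennreal (\<alpha> t)) * Nrm r1 {t<..} (\<lambda>s. ennreal (b1 s))"
    using ennreal_\<beta>[OF assms(1)] sv_pos[OF sv_\<alpha> assms(1)] sv_pos[OF sv_\<beta> assms(1)]
    by (simp add: wnorm_eq_Nrm ennreal_mult mult_ac)
  also have "\<dots> \<le> Nrm r1 {t<..} (\<lambda>s. (?k * ennreal (\<alpha> t)) * ennreal (b1 s))"
    using k by (intro Nrm_cmult_ge r1) (auto simp: ennreal_mult_eq_top_iff)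
  also have "\<dots> \<le> N1 f"
    unfolding N1_def
  proof (intro Nrm_mono r1)
    fix s assume "s \<in> {t<..}"
    then have "?k * ennreal (\<alpha> t) \<le> Jin 0 s f"
      using inner[of t] Jin_mono[of 0 0 t s f] assms(1) by (auto simp: ennreal_\<alpha> intro: order_trans)
    then show "(?k * ennreal (\<alpha> t)) * ennreal (b1 s) \<le> ennreal (b1 s) * Jin 0 s f"
      by (subst mult.commute) (intro mult_left_mono, auto)
  qed (use assms in auto)
  finally have 2: "?k * ennreal (\<beta> t * \<alpha> t) \<le> N1 f" .
  \<comment> \<open>Splitting \<chi>1 and cancelling t are done in the reals, where division
    behaves.\<close>
  obtain x where x: "K t f = ennreal x" "0 \<le> x"
    using K_finite[OF assms(2), of t] by (cases "K t f" rule: ennreal_cases) auto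
  have nn: "0 \<le> t" "0 \<le> 1 / t" "0 \<le> \<omega> t" "0 \<le> \<beta> t" "0 \<le> \<alpha> t"
    using assms(1) sv_pos[OF sv_\<alpha> assms(1)] sv_pos[OF sv_\<beta> assms(1)] sv_pos[OF sv_\<omega> assms(1)] by auto
  have eq: "\<chi>1 t * x = t * (1 / t * x * \<omega> t + 1 / t * x * (\<beta> t * \<alpha> t))"
    using assms(1) by (simp add: \<chi>1_eq field_simps)
  have "ennreal (\<chi>1 t) * K t f = ennreal (\<chi>1 t * x)"
    unfolding x(1) using x(2) \<chi>_pos(2)[OF assms(1)] by (intro ennreal_mult[symmetric]) auto
  also have "\<dots> = ennreal (t * (1 / t * x * \<omega> t + 1 / t * x * (\<beta> t * \<alpha> t)))"
    by (simp only: eq)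
  also have "\<dots> = ennreal t * (?k * ennreal (\<omega> t) + ?k * ennreal (\<beta> t * \<alpha> t))"
    unfolding x(1) by (simp only: ennreal_mult ennreal_plus nn x(2) mult_nonneg_nonneg add_nonneg_nonneg)
  also have "\<dots> \<le> ennreal t * (N1 f + N1 f)" using 1 2 by (intro mult_left_mono add_mono) auto
  also have "\<dots> = ennreal (2 * t) * N1 f" using assms(1) by (subst ennreal_mult) (auto simp: mult_ac simp flip: mult_2)
  finally show ?thesis .
qed

text \<open>I and \<chi>0 K are immediate. For J, \<open>N0_ge\<close> bounds K by N0/\<chi>0, which
  is inserted into \<open>J_bound\<close> with d = 1; the resulting factor \<chi>1/(t \<chi>0) is
  cancelled by \<rho>.\<close>

lemma P_le_N0: "\<exists>C>0. \<forall>t>0. \<forall>f\<in>A01. N0 f < top \<longrightarrow> P t f \<le> ennreal C * N0 f"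
proof -
  obtain C where C: "0 < C" "\<And>t f N. 0 < t \<Longrightarrow> N \<noteq> top \<Longrightarrow> (\<forall>v>t. K v f \<le> N * ennreal (v powr (1 - 1) * (1 / \<chi>0 v))) \<Longrightarrow>
    J t f \<le> N * ennreal (C * (t powr (- 1) * (1 / \<chi>0 t) * \<chi>1 t))"
    using J_bound[of 1 "\<lambda>t. 1 / \<chi>0 t"] sv_inverse[OF sv_\<chi>0] by auto
  have "P t f \<le> ennreal (1 + 1 + C) * N0 f" if t: "0 < t" and f: "f \<in> A01" "N0 f < top" for t f
    unfolding P_def
  proof (intro add_le_cmult)
    show "I t f \<le> ennreal 1 * N0 f" unfolding I_def N0_def by (simp, intro Nrm_mono r0) auto
    show "ennreal (\<chi>0 t) * K t f \<le> ennreal 1 * N0 f" using N0_ge[OF t f(1)] by simp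
    have "K v f \<le> N0 f * ennreal (1 / \<chi>0 v)" if "0 < v" for v
    proof -
      have "ennreal (1 / \<chi>0 v) * (ennreal (\<chi>0 v) * K v f) \<le> ennreal (1 / \<chi>0 v) * N0 f"
        using N0_ge[OF that f(1)] by (rule mult_left_mono) simp
      then show ?thesis using \<chi>_pos(1)[OF that] by (simp add: mult.assoc[symmetric] mult.commute flip: ennreal_mult)
    qed
    then have "J t f \<le> N0 f * ennreal (C * (t powr (- 1) * (1 / \<chi>0 t) * \<chi>1 t))"
      using t f by (intro C(2)) auto
    then have "ennreal (\<rho> t) * J t f \<le> ennreal (\<rho> t) * (N0 f * ennreal (C * (t powr (- 1) * (1 / \<chi>0 t) * \<chi>1 t)))"
      by (rule mult_left_mono) simp
    also have "\<dots> = ennreal (\<rho> t * (C * (t powr (- 1) * (1 / \<chi>0 t) * \<chi>1 t))) * N0 f"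
      using \<rho>_pos[OF t] \<chi>_pos[OF t] C(1) by (subst ennreal_mult) (auto simp: mult_ac)
    also have "\<rho> t * (C * (t powr (- 1) * (1 / \<chi>0 t) * \<chi>1 t)) = C"
      using t \<chi>_pos[OF t] by (simp add: \<rho> powr_minus field_simps)
    finally show "ennreal (\<rho> t) * J t f \<le> ennreal C * N0 f" .
  qed (use C in auto)
  then show ?thesis using C(1) by (intro exI[of _ "1 + 1 + C"]) auto
qed

text \<open>J is immediate. For the other terms, \<open>N1_ge\<close> bounds K(v) by 2 N1
  v/\<chi>1(v); \<open>I_bound\<close> with d = 1, or multiplication by \<chi>0, then produces
  \<rho>.\<close>

lemma P_le_N1: "\<exists>C>0. \<forall>t>0. \<forall>f\<in>A01. N1 f < top \<longrightarrow> P t f \<le> ennreal C * (ennreal (\<rho> t) * N1 f)"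
proof -
  obtain C where C: "0 < C" "\<And>t f N. 0 < t \<Longrightarrow> N \<noteq> top \<Longrightarrow> (\<forall>u. 0 < u \<longrightarrow> u < t \<longrightarrow> K u f \<le> N * ennreal (u powr 1 * (1 / \<chi>1 u))) \<Longrightarrow>
    I t f \<le> N * ennreal (C * (t powr 1 * (1 / \<chi>1 t) * \<chi>0 t))"
    using I_bound[of 1 "\<lambda>t. 1 / \<chi>1 t"] sv_inverse[OF sv_\<chi>1] by auto
  have "P t f \<le> ennreal (2 * C + 2 + 1) * (ennreal (\<rho> t) * N1 f)" if t: "0 < t" and f: "f \<in> A01" "N1 f < top" for t f
    unfolding P_def
  proof (intro add_le_cmult)
    have Kle: "K v f \<le> (2 * N1 f) * ennreal (v powr 1 * (1 / \<chi>1 v))" if v: "0 < v" for v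
    proof -
      have "ennreal (1 / \<chi>1 v) * (ennreal (\<chi>1 v) * K v f) \<le> ennreal (1 / \<chi>1 v) * (ennreal (2 * v) * N1 f)"
        using N1_ge[OF v f(1)] by (rule mult_left_mono) simp
      also have "ennreal (1 / \<chi>1 v) * (ennreal (\<chi>1 v) * K v f) = K v f"
        using \<chi>_pos(2)[OF v] by (simp add: mult.assoc[symmetric] flip: ennreal_mult)
      also have "ennreal (1 / \<chi>1 v) * (ennreal (2 * v) * N1 f) = ennreal (1 / \<chi>1 v * (2 * v)) * N1 f"
        using \<chi>_pos(2)[OF v] v by (subst ennreal_mult) (auto simp: mult.assoc)
      also have "1 / \<chi>1 v * (2 * v) = 2 * (v powr 1 * (1 / \<chi>1 v))" using v by simp
      also have "ennreal (2 * (v powr 1 * (1 / \<chi>1 v))) * N1 f = (2 * N1 f) * ennreal (v powr 1 * (1 / \<chi>1 v))"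
        using \<chi>_pos(2)[OF v] by (subst ennreal_mult) (auto simp: mult_ac)
      finally show ?thesis .
    qed
    have "I t f \<le> (2 * N1 f) * ennreal (C * (t powr 1 * (1 / \<chi>1 t) * \<chi>0 t))"
      using t f Kle by (intro C(2)) (auto simp: ennreal_mult_eq_top_iff)
    also have "C * (t powr 1 * (1 / \<chi>1 t) * \<chi>0 t) = C * \<rho> t" using t by (simp add: \<rho>)
    also have "(2 * N1 f) * ennreal (C * \<rho> t) = ennreal (2 * C) * (ennreal (\<rho> t) * N1 f)"
      using C(1) \<rho>_pos[OF t] by (simp add: ennreal_mult mult_ac)
    finally show "I t f \<le> ennreal (2 * C) * (ennreal (\<rho> t) * N1 f)" .
    have "ennreal (\<chi>0 t) * K t f \<le> ennreal (\<chi>0 t) * ((2 * N1 f) * ennreal (t powr 1 * (1 / \<chi>1 t)))"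
      using Kle[OF t] by (rule mult_left_mono) simp
    also have "\<dots> = ennreal (\<chi>0 t * (t powr 1 * (1 / \<chi>1 t))) * (2 * N1 f)"
      using \<chi>_pos[OF t] t by (subst ennreal_mult) (auto simp: mult_ac)
    also have "\<chi>0 t * (t powr 1 * (1 / \<chi>1 t)) = \<rho> t" using t by (simp add: \<rho>)
    finally show "ennreal (\<chi>0 t) * K t f \<le> ennreal 2 * (ennreal (\<rho> t) * N1 f)" by (simp add: mult_ac)
    have "J t f \<le> N1 f"
      unfolding J_def N1_def using t by (intro Nrm_mono r1 mult_left_mono Jin_mono) auto
    then show "ennreal (\<rho> t) * J t f \<le> ennreal 1 * (ennreal (\<rho> t) * N1 f)" by (simp add: mult_left_mono)
  qed (use C in auto)
  then show ?thesis using C(1) by (intro exI[of _ "2 * C + 2 + 1"]) auto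
qed

section \<open>Norms of the two parts of an almost optimal decomposition\<close>

text \<open>Below t write f0 = f - f1: the contribution of f1 is at most u |f1| <= 2 (u/t) K(t,f) <=
  2 K(u,f), whence 3C. Beyond t the bound K(u,f0) <= |f0| <= 2 K(t,f) is constant in u and the
  weight norm is \<chi>0.\<close>

lemma N0_upper:
  "\<exists>C>0. \<forall>t>0. \<forall>f\<in>A01. \<forall>f0\<in>elems A0. \<forall>f1\<in>elems A1.
    f = f0 + f1 \<longrightarrow> qnorm A0 f0 + ennreal t * qnorm A1 f1 \<le> 2 * K t f \<longrightarrow>
    N0 f0 \<le> ennreal C * (I t f + ennreal (\<chi>0 t) * K t f)"
proof -
  obtain C where C: "0 < C" "\<And>t f g. 0 < t \<Longrightarrow> K t (f + g) \<le> ennreal C * (K t f + K t g)" using K_add by auto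
  obtain D where D: "0 < D" "\<And>t. 0 < t \<Longrightarrow> \<chi>0 (t / 2) \<le> D * \<chi>0 t" using sv_double[OF sv_\<chi>0] by auto
  let ?M = "max (3 * C) (2 * D)" and ?Q = "quasi_const r0"
  have Q: "0 < ?Q" using quasi_const_ge_1[of r0] by simp
  have "N0 f0 \<le> ennreal (?Q * ?M) * (I t f + ennreal (\<chi>0 t) * K t f)"
    if t: "0 < t" and f: "f \<in> A01" "f0 \<in> elems A0" "f1 \<in> elems A1" "f = f0 + f1"
      and le: "qnorm A0 f0 + ennreal t * qnorm A1 f1 \<le> 2 * K t f" for t f f0 f1
  proof (rule le_cmult_trans)
    let ?G = "\<lambda>u. ennreal (b0 u) * K u f0"
    have le0: "qnorm A0 f0 \<le> 2 * K t f" and le1: "ennreal t * qnorm A1 f1 \<le> 2 * K t f"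
      using le by (auto intro: order_trans[rotated])
    have Kf0: "K u f0 \<le> ennreal (3 * C) * K u f" if u: "0 < u" "u < t" for u
    proof -
      have "K u (- f1) \<le> ennreal u * qnorm A1 f1" by (rule K_uminus(2)[OF f(3)])
      also have "\<dots> = ennreal (u / t) * (ennreal t * qnorm A1 f1)"
        using u t by (simp add: mult.assoc[symmetric] flip: ennreal_mult)
      also have "\<dots> \<le> ennreal (u / t) * (2 * (ennreal (t / u) * K u f))"
        using u by (intro mult_left_mono order_trans[OF le1] K_fun_scale) auto
      also have "\<dots> = 2 * ((ennreal (u / t) * ennreal (t / u)) * K u f)" by (simp only: mult_ac)
      also have "ennreal (u / t) * ennreal (t / u) = 1" using u by (simp flip: ennreal_mult)
      finally have *: "K u (- f1) \<le> 2 * K u f" by simp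
      have "K u f0 \<le> ennreal C * (K u f + K u (- f1))" using C(2)[OF u(1), of f "- f1"] f(4) by simp
      also have "\<dots> \<le> ennreal C * (K u f + 2 * K u f)" using * by (intro mult_left_mono add_left_mono) auto
      also have "K u f + 2 * K u f = 3 * K u f" by (simp add: distrib_right[of 1 2, simplified])
      finally show ?thesis using C(1) by (simp add: ennreal_mult mult_ac)
    qed
    \<comment> \<open>The open ranges overlap so that the point t is covered; starting at t/2 costs
      only the doubling constant D of \<chi>0.\<close>
    show "N0 f0 \<le> ennreal ?Q * (Nrm r0 {0<..<t} ?G + Nrm r0 {t/2<..} ?G)"
      unfolding N0_def using t by (intro Nrm_le_union r0) auto
    have 1: "Nrm r0 {0<..<t} ?G \<le> ennreal (3 * C) * I t f"
      unfolding I_def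
    proof (rule Nrm_le_cmult)
      fix u assume "u \<in> {0<..<t}"
      then have "ennreal (b0 u) * K u f0 \<le> ennreal (b0 u) * (ennreal (3 * C) * K u f)"
        using Kf0 by (intro mult_left_mono) auto
      then show "ennreal (b0 u) * K u f0 \<le> ennreal (3 * C) * (ennreal (b0 u) * K u f)" by (simp only: mult.left_commute)
    qed (use r0 in auto)
    have "Nrm r0 {t/2<..} ?G \<le> Nrm r0 {t/2<..} (\<lambda>u. ennreal (b0 u) * (2 * K t f))"
      using le0 by (intro Nrm_mono r0 mult_left_mono order_trans[OF K_le_0[OF f(2)]]) auto
    also have "\<dots> \<le> (2 * K t f) * ennreal (\<chi>0 (t/2))"
      using Nrm_weight_le[OF r0, of "{t/2<..}" "2 * K t f" b0] K_finite[OF f(1), of t] t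
      by (simp add: ennreal_mult_eq_top_iff ennreal_\<chi>0)
    also have "\<dots> \<le> (2 * K t f) * ennreal (D * \<chi>0 t)" using D t by (intro mult_left_mono ennreal_leI) auto
    also have "\<dots> = ennreal (2 * D) * (ennreal (\<chi>0 t) * K t f)"
      using D(1) \<chi>_pos(1)[OF t] by (simp add: ennreal_mult mult_ac)
    finally have 2: "Nrm r0 {t/2<..} ?G \<le> \<dots>" .
    have "Nrm r0 {0<..<t} ?G + Nrm r0 {t/2<..} ?G
      \<le> ennreal ?M * I t f + ennreal ?M * (ennreal (\<chi>0 t) * K t f)"
      by (intro add_mono order_trans[OF 1] order_trans[OF 2] mult_right_mono ennreal_leI) auto
    then show "Nrm r0 {0<..<t} ?G + Nrm r0 {t/2<..} ?G
      \<le> ennreal ?M * (I t f + ennreal (\<chi>0 t) * K t f)" by (simp add: distrib_left)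
  qed (use Q in auto)
  then show ?thesis using C(1) Q by (intro exI[of _ "?Q * ?M"]) auto
qed

text \<open>Everywhere K(v,f1) <= v |f1| <= 2 (v/t) K(t,f); for v > t also K(v,f1) <= 3C K(v,f),
  because f1 = f - f0 and |f0| <= 2 K(t,f) <= 2 K(v,f). The first bound leads to \<omega> and
  \<alpha> \<beta>, the two summands of \<chi>1, the second to J.\<close>

lemma N1_upper:
  "\<exists>C>0. \<forall>t>0. \<forall>f\<in>A01. \<forall>f0\<in>elems A0. \<forall>f1\<in>elems A1.
    f = f0 + f1 \<longrightarrow> qnorm A0 f0 + ennreal t * qnorm A1 f1 \<le> 2 * K t f \<longrightarrow>
    N1 f1 \<le> ennreal C * (ennreal (\<chi>1 t / t) * K t f + J t f)"
proof -
  obtain C where C: "0 < C" "\<And>t f g. 0 < t \<Longrightarrow> K t (f + g) \<le> ennreal C * (K t f + K t g)" using K_add by auto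
  obtain D where D: "0 < D" "\<And>t. 0 < t \<Longrightarrow> \<omega> (2 * t) \<le> D * \<omega> t" using sv_double[OF sv_\<omega>] by auto
  obtain E where E: "0 < E" "\<And>t. 0 < t \<Longrightarrow> \<alpha> (2 * t) \<le> E * \<alpha> t" using sv_double[OF sv_\<alpha>] by auto
  let ?Q = "quasi_const q1" and ?R = "quasi_const r1"
  have QR: "0 < ?Q" "0 < ?R" using quasi_const_ge_1[of q1] quasi_const_ge_1[of r1] by auto
  let ?M = "max (2 * E) (3 * C)"
  let ?L = "2 * D + ?Q * (?R * ?M)"
  have M: "0 < ?M" using C(1) by (simp add: less_max_iff_disj)
  then have QRM: "0 < ?Q * (?R * ?M)" using QR by simp
  have "N1 f1 \<le> ennreal (?R * ?L) * (ennreal (\<chi>1 t / t) * K t f + J t f)"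
    if t: "0 < t" and f: "f \<in> A01" "f0 \<in> elems A0" "f1 \<in> elems A1" "f = f0 + f1"
      and le: "qnorm A0 f0 + ennreal t * qnorm A1 f1 \<le> 2 * K t f" for t f f0 f1
  proof (rule le_cmult_trans)
    let ?k = "ennreal (1 / t) * K t f"
    let ?G = "\<lambda>s. ennreal (b1 s) * Jin 0 s f1" and ?H = "\<lambda>s. ennreal (3 * C) * (ennreal (b1 s) * Jin t s f)"
    let ?Z = "ennreal (\<chi>1 t / t) * K t f + J t f"
    have k: "?k \<noteq> top" using K_finite[OF f(1), of t] by (simp add: ennreal_mult_eq_top_iff)
    have Z: "?k * ennreal (\<omega> t) \<le> ?Z" "?k * ennreal (\<alpha> t * \<beta> t) \<le> ?Z"
    proof -
      have nn: "0 \<le> \<omega> t" "0 \<le> \<alpha> t * \<beta> t"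
        using sv_pos[OF sv_\<alpha> t] sv_pos[OF sv_\<beta> t] sv_pos[OF sv_\<omega> t] by auto
      have *: "?k * ennreal c \<le> ?Z" if "0 \<le> c" "c \<le> \<chi>1 t" for c
      proof -
        have "?k * ennreal c = ennreal (c / t) * K t f"
          using that t by (simp add: mult_ac flip: ennreal_mult)
             (simp add: mult.assoc[symmetric] mult.commute flip: ennreal_mult)
        also have "\<dots> \<le> ennreal (\<chi>1 t / t) * K t f" using that t by (intro mult_right_mono ennreal_leI divide_right_mono) auto
        also have "\<dots> \<le> ?Z" by simp
        finally show ?thesis .
      qed
      show "?k * ennreal (\<omega> t) \<le> ?Z" "?k * ennreal (\<alpha> t * \<beta> t) \<le> ?Z"
        using nn *[of "\<omega> t"] *[of "\<alpha> t * \<beta> t"] unfolding \<chi>1_eq[OF t] by (simp_all only: mult.commute[of "\<beta> t"])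
    qed
    have le0: "qnorm A0 f0 \<le> 2 * K t f" and le1: "ennreal t * qnorm A1 f1 \<le> 2 * K t f"
      using le by (auto intro: order_trans[rotated])
    have Kf1: "K v f1 \<le> ennreal v * (2 * ?k)" if v: "0 < v" for v
    proof -
      have "K v f1 \<le> ennreal v * qnorm A1 f1" by (rule K_le_1[OF f(3)])
      also have "\<dots> = ennreal v * (ennreal (1 / t) * (ennreal t * qnorm A1 f1))"
        using t by (simp add: mult.assoc[symmetric] flip: ennreal_mult)
      also have "\<dots> \<le> ennreal v * (ennreal (1 / t) * (2 * K t f))"
        using le1 by (intro mult_left_mono) auto
      finally show ?thesis by (simp add: mult_ac)
    qed
    have Kf1': "K v f1 \<le> ennreal (3 * C) * K v f" if v: "t < v" for v
    proof -
      have "K v f1 \<le> ennreal C * (K v f + K v (- f0))" using C(2)[of v f "- f0"] f(4) v t by simp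
      also have "\<dots> \<le> ennreal C * (K v f + 2 * K v f)"
        using v by (intro mult_left_mono add_left_mono order_trans[OF K_uminus(1)[OF f(2)]] order_trans[OF le0] K_fun_mono) auto
      also have "K v f + 2 * K v f = 3 * K v f" by (simp add: distrib_right[of 1 2, simplified])
      finally show ?thesis using C(1) by (simp add: ennreal_mult mult_ac)
    qed
    have ker_le: "Nrm q1 {0<..<s} (ker f1) \<le> (2 * ?k) * wnorm q1 a1 {0<..<s}" for s
      unfolding wnorm_eq_Nrm
    proof (rule Nrm_le_cmult)
      fix v assume v: "v \<in> {0<..<s}"
      have "ker f1 v \<le> ennreal (a1 v / v) * (ennreal v * (2 * ?k))"
        unfolding ker_def using Kf1 v by (intro mult_left_mono) auto
      also have "\<dots> = (ennreal (a1 v / v) * ennreal v) * (2 * ?k)" by (simp only: mult.assoc)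
      also have "ennreal (a1 v / v) * ennreal v = ennreal (a1 v)"
        using v sv_pos[OF sv_a1, of v] by (simp flip: ennreal_mult)
      finally show "ker f1 v \<le> (2 * ?k) * ennreal (a1 v)" by (simp only: mult.commute)
    qed (use q1 k in \<open>auto simp: ennreal_mult_eq_top_iff\<close>)
    \<comment> \<open>As for f0, the outer range is cut into overlapping open pieces; \<omega>(2t)
      is reduced to \<omega>(t) by doubling.\<close>
    show "N1 f1 \<le> ennreal ?R * (Nrm r1 {0<..<2 * t} ?G + Nrm r1 {t<..} ?G)"
      unfolding N1_def using t by (intro Nrm_le_union r1) auto
    have "Nrm r1 {0<..<2 * t} ?G \<le> (2 * ?k) * Nrm r1 {0<..<2 * t} (\<lambda>s. ennreal (b1 s) * wnorm q1 a1 {0<..<s})"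
    proof (rule Nrm_le_cmult)
      fix s
      have "ennreal (b1 s) * Jin 0 s f1 \<le> ennreal (b1 s) * ((2 * ?k) * wnorm q1 a1 {0<..<s})"
        unfolding Jin_def by (intro mult_left_mono ker_le) auto
      then show "ennreal (b1 s) * Jin 0 s f1 \<le> (2 * ?k) * (ennreal (b1 s) * wnorm q1 a1 {0<..<s})"
        by (simp only: mult.left_commute)
    qed (use r1 k in \<open>auto simp: ennreal_mult_eq_top_iff\<close>)
    also have "Nrm r1 {0<..<2 * t} (\<lambda>s. ennreal (b1 s) * wnorm q1 a1 {0<..<s}) = ennreal (\<omega> (2 * t))"
      using ennreal_\<omega>[of "2 * t"] t by (simp add: wnorm2_def Nrm_def ennreal_mult' mult.assoc)
    also have "(2 * ?k) * ennreal (\<omega> (2 * t)) \<le> (2 * ?k) * ennreal (D * \<omega> t)"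
      using D t by (intro mult_left_mono ennreal_leI) auto
    also have "\<dots> = ennreal (2 * D) * (?k * ennreal (\<omega> t))"
      using D(1) sv_pos[OF sv_\<omega> t] by (simp add: ennreal_mult mult_ac)
    also have "\<dots> \<le> ennreal (2 * D) * ?Z" by (intro mult_left_mono Z) auto
    finally have 1: "Nrm r1 {0<..<2 * t} ?G \<le> ennreal (2 * D) * ?Z" .
    \<comment> \<open>The inner range is cut in the same way: up to 2t the linear bound gives
      \<alpha>(2t), beyond t the comparison with K(v,f) gives the inner norm of J.\<close>
    have Jin: "Jin 0 s f1 \<le> ennreal ?Q * ((2 * ?k) * ennreal (\<alpha> (2 * t)) + ennreal (3 * C) * Jin t s f)" for s
    proof -
      have "Jin 0 s f1 \<le> ennreal ?Q * (Nrm q1 {0<..<2 * t} (ker f1) + Nrm q1 {t<..<s} (ker f1))"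
        unfolding Jin_def using t by (intro Nrm_le_union q1) auto
      also have "\<dots> \<le> ennreal ?Q * ((2 * ?k) * wnorm q1 a1 {0<..<2 * t} + ennreal (3 * C) * Jin t s f)"
      proof (intro mult_left_mono add_mono ker_le)
        show "Nrm q1 {t<..<s} (ker f1) \<le> ennreal (3 * C) * Jin t s f"
          unfolding Jin_def
        proof (rule Nrm_le_cmult)
          fix v assume "v \<in> {t<..<s}"
          then have "ker f1 v \<le> ennreal (a1 v / v) * (ennreal (3 * C) * K v f)"
            unfolding ker_def using Kf1' by (intro mult_left_mono) auto
          then show "ker f1 v \<le> ennreal (3 * C) * ker f v" unfolding ker_def by (simp only: mult.left_commute)
        qed (use q1 in auto)
      qed auto
      finally show ?thesis using ennreal_\<alpha>[of "2 * t"] t by simp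
    qed
    let ?c = "(2 * ?k) * ennreal (\<alpha> (2 * t))"
    have c: "?c \<noteq> top" using k by (simp add: ennreal_mult_eq_top_iff)
    have m1: "(\<lambda>s. ennreal (b1 s) * ?c) \<in> borel_measurable (lebesgue_on {t<..})"
      using SV_measurable[OF b1, of "{t<..}"] t by (intro borel_measurable_times_ennreal) auto
    have m2: "?H \<in> borel_measurable (lebesgue_on {t<..})"
      using t by (intro borel_measurable_times_ennreal[OF borel_measurable_const] weighted_Jin_measurable) auto
    have "Nrm r1 {t<..} ?G
        \<le> ennreal ?Q * Nrm r1 {t<..} (\<lambda>s. ennreal (b1 s) * ?c + ?H s)"
    proof (rule Nrm_le_cmult)
      fix s
      have "ennreal (b1 s) * Jin 0 s f1 \<le> ennreal (b1 s) * (ennreal ?Q * (?c + ennreal (3 * C) * Jin t s f))"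
        by (intro mult_left_mono Jin) auto
      also have "\<dots> = ennreal ?Q * (ennreal (b1 s) * ?c + ?H s)"
        by (simp only: mult.left_commute distrib_left)
      finally show "ennreal (b1 s) * Jin 0 s f1 \<le> ennreal ?Q * (ennreal (b1 s) * ?c + ?H s)" .
    qed (use r1 in auto)
    also have "Nrm r1 {t<..} (\<lambda>s. ennreal (b1 s) * ?c + ?H s)
        \<le> ennreal ?R * (Nrm r1 {t<..} (\<lambda>s. ennreal (b1 s) * ?c) + Nrm r1 {t<..} ?H)"
      by (intro Nrm_add r1 m1 m2)
    also have "\<dots> \<le> ennreal ?R * (ennreal ?M * ?Z)"
    proof (intro mult_left_mono)
      have "Nrm r1 {t<..} (\<lambda>s. ennreal (b1 s) * ?c) \<le> ?c * ennreal (\<beta> t)"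
        using Nrm_weight_le[OF r1, of "{t<..}" ?c b1] c t by (simp add: ennreal_\<beta>)
      also have "\<dots> \<le> ((2 * ?k) * ennreal (E * \<alpha> t)) * ennreal (\<beta> t)"
        using E t by (intro mult_left_mono mult_right_mono ennreal_leI) auto
      also have "\<dots> = ennreal (2 * E) * (?k * ennreal (\<alpha> t * \<beta> t))"
        using E(1) sv_pos[OF sv_\<alpha> t] sv_pos[OF sv_\<beta> t] by (simp add: ennreal_mult mult_ac)
      finally have a: "Nrm r1 {t<..} (\<lambda>s. ennreal (b1 s) * ?c) \<le> ennreal (2 * E) * (?k * ennreal (\<alpha> t * \<beta> t))" .
      have b: "Nrm r1 {t<..} ?H \<le> ennreal (3 * C) * J t f"
        unfolding J_def by (intro Nrm_le_cmult r1) auto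
      have z: "?k * ennreal (\<alpha> t * \<beta> t) \<le> ennreal (\<chi>1 t / t) * K t f"
      proof -
        have "?k * ennreal (\<alpha> t * \<beta> t) = ennreal (1 / t * (\<alpha> t * \<beta> t)) * K t f"
          using t sv_pos[OF sv_\<alpha> t] sv_pos[OF sv_\<beta> t] by (subst ennreal_mult) (auto simp: mult_ac)
        also have "\<dots> \<le> ennreal (\<chi>1 t / t) * K t f"
          using t sv_pos[OF sv_\<omega> t] by (intro mult_right_mono ennreal_leI) (auto simp: \<chi>1_eq[OF t] field_simps)
        finally show ?thesis .
      qed
      then have "Nrm r1 {t<..} (\<lambda>s. ennreal (b1 s) * ?c) + Nrm r1 {t<..} ?H
          \<le> ennreal ?M * (ennreal (\<chi>1 t / t) * K t f) + ennreal ?M * J t f"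
        by (intro add_mono order_trans[OF a mult_mono] order_trans[OF b mult_right_mono]) (auto intro: ennreal_leI)
      then show "Nrm r1 {t<..} (\<lambda>s. ennreal (b1 s) * ?c) + Nrm r1 {t<..} ?H \<le> ennreal ?M * ?Z"
        by (simp only: distrib_left)
    qed auto
    finally have 2: "Nrm r1 {t<..} ?G \<le> ennreal (?Q * (?R * ?M)) * ?Z"
      using QR M by (simp add: ennreal_mult mult.assoc mult_left_mono)
    show "Nrm r1 {0<..<2 * t} ?G + Nrm r1 {t<..} ?G \<le> ennreal ?L * ?Z"
      using QRM D(1) by (intro add_le_cmult 1 2) auto
  qed (use QR in auto)
  moreover have "0 < ?L" using D(1) QRM by linarith
  then have "0 < ?R * ?L" by (rule mult_pos_pos[OF QR(2)])
  ultimately show ?thesis by (intro exI[of _ "?R * ?L"]) auto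
qed

section \<open>The two-sided Holmstedt-type formula\<close>

abbreviation "X0 \<equiv> interp_space A0 A1 0 r0 b0"
abbreviation "X1 \<equiv> L_space A0 A1 1 r1 b1 q1 a1"

lemma X0_simps: "elems X0 = {f \<in> A01. N0 f < top}" "qnorm X0 = N0"
  by (auto simp: interp_space_def finite_part_def N0_def[abs_def] Nrm_def ennreal_mult' mult.assoc)

lemma Jin_eq: "0 \<le> t \<Longrightarrow> Lnorm q1 {t<..<s} (\<lambda>u. ennreal (u powr (- 1 - recip q1) * a1 u) * K u f) = Jin t s f"
  unfolding Lnorm_eq_Nrm Jin_def ker_def by (intro Nrm_cong q1) (auto simp: powr_minus_divide)

lemma X1_simps: "elems X1 = {f \<in> A01. N1 f < top}" "qnorm X1 = N1"
proof -
  have "Lnorm r1 {0<..} (\<lambda>t. ennreal (t powr (- recip r1) * b1 t) *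
      Lnorm q1 {0<..<t} (\<lambda>u. ennreal (u powr (- 1 - recip q1) * a1 u) * K u f)) = N1 f" for f
    unfolding N1_def Nrm_def by (simp only: Jin_eq order_refl) (simp add: ennreal_mult' mult.assoc)
  then show "elems X1 = {f \<in> A01. N1 f < top}" "qnorm X1 = N1"
    by (simp_all add: L_space_def finite_part_def)
qed

text \<open>If P is infinite nothing is claimed. Otherwise the norms of f0 and f1 are finite, which
  is what puts them into X0 and X1 and makes them an admissible decomposition there. The two bounds
  fit together because \<rho>(t) \<chi>1(t)/t = \<chi>0(t).\<close>

lemma holmstedt_upper: "\<exists>C>0. \<forall>t>0. \<forall>f\<in>A01. K_fun X0 X1 (\<rho> t) f \<le> ennreal C * P t f"
proof -
  obtain C0 where C0: "0 < C0" "\<And>t f f0 f1. 0 < t \<Longrightarrow> f \<in> A01 \<Longrightarrow> f0 \<in> elems A0 \<Longrightarrow> f1 \<in> elems A1 \<Longrightarrow>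
    f = f0 + f1 \<Longrightarrow> qnorm A0 f0 + ennreal t * qnorm A1 f1 \<le> 2 * K t f \<Longrightarrow>
    N0 f0 \<le> ennreal C0 * (I t f + ennreal (\<chi>0 t) * K t f)" using N0_upper by metis
  obtain C1 where C1: "0 < C1" "\<And>t f f0 f1. 0 < t \<Longrightarrow> f \<in> A01 \<Longrightarrow> f0 \<in> elems A0 \<Longrightarrow> f1 \<in> elems A1 \<Longrightarrow>
    f = f0 + f1 \<Longrightarrow> qnorm A0 f0 + ennreal t * qnorm A1 f1 \<le> 2 * K t f \<Longrightarrow>
    N1 f1 \<le> ennreal C1 * (ennreal (\<chi>1 t / t) * K t f + J t f)" using N1_upper by metis
  have "K_fun X0 X1 (\<rho> t) f \<le> ennreal (C0 + C1) * P t f" if t: "0 < t" and f: "f \<in> A01" for t f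
  proof (cases "P t f < top")
    case False
    then have "P t f = top" by (metis top.not_eq_extremum)
    then show ?thesis using C0(1) C1(1) by (simp add: ennreal_mult_top)
  next
    case True
    obtain f0 f1 where d: "f0 \<in> elems A0" "f1 \<in> elems A1" "f = f0 + f1"
      "qnorm A0 f0 + ennreal t * qnorm A1 f1 \<le> 2 * K t f" using K_decomp[OF t f] by blast
    have fin: "I t f < top" "K t f < top" "J t f < top"
      using True K_finite[OF f, of t] \<rho>_pos[OF t] by (auto simp: P_def ennreal_mult_less_top)
    note n0 = C0(2)[OF t f d] and n1 = C1(2)[OF t f d]
    have "N0 f0 < top" "N1 f1 < top"
      using le_less_trans[OF n0] le_less_trans[OF n1] fin by (auto simp: ennreal_mult_less_top)
    then have "f0 \<in> elems X0" "f1 \<in> elems X1"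
      unfolding X0_simps(1) X1_simps(1) using in_sum d by auto
    then have "K_fun X0 X1 (\<rho> t) f \<le> N0 f0 + ennreal (\<rho> t) * N1 f1"
      using K_fun_le[of f0 X0 f1 X1 "\<rho> t"] d(3) by (simp add: X0_simps(2) X1_simps(2))
    also have "\<dots> \<le> ennreal (C0 + C1) * P t f"
    proof (rule add_le_cmult)
      show "N0 f0 \<le> ennreal C0 * P t f"
        using n0 by (rule order_trans) (auto simp: P_def intro!: mult_left_mono)
      have "ennreal (\<rho> t) * N1 f1 \<le> ennreal (\<rho> t) * (ennreal C1 * (ennreal (\<chi>1 t / t) * K t f + J t f))"
        using n1 by (rule mult_left_mono) simp
      also have "\<dots> = ennreal C1 * ((ennreal (\<rho> t) * ennreal (\<chi>1 t / t)) * K t f + ennreal (\<rho> t) * J t f)"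
        by (simp only: distrib_left mult_ac)
      also have "ennreal (\<rho> t) * ennreal (\<chi>1 t / t) = ennreal (\<chi>0 t)"
        using t \<chi>_pos[OF t] \<rho>_pos[OF t] by (subst ennreal_mult[symmetric]) (auto simp: \<rho>)
      also have "ennreal C1 * (ennreal (\<chi>0 t) * K t f + ennreal (\<rho> t) * J t f) \<le> ennreal C1 * P t f"
        by (auto simp: P_def add.assoc intro!: mult_left_mono)
      finally show "ennreal (\<rho> t) * N1 f1 \<le> ennreal C1 * P t f" .
    qed (use C0 C1 in auto)
    finally show ?thesis .
  qed
  then show ?thesis using C0(1) C1(1) by (intro exI[of _ "C0 + C1"]) auto
qed

text \<open>P is quasi-subadditive, and on each summand of an arbitrary decomposition it is
  controlled by that summand's own norm; then take the infimum.\<close>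

lemma holmstedt_lower: "\<exists>C>0. \<forall>t>0. \<forall>f. P t f \<le> ennreal C * K_fun X0 X1 (\<rho> t) f"
proof -
  obtain C where C: "0 < C" "\<And>t f g. 0 < t \<Longrightarrow> P t (f + g) \<le> ennreal C * (P t f + P t g)" using P_add by auto
  obtain C0 where C0: "0 < C0" "\<And>t f. 0 < t \<Longrightarrow> f \<in> A01 \<Longrightarrow> N0 f < top \<Longrightarrow> P t f \<le> ennreal C0 * N0 f" using P_le_N0 by auto
  obtain C1 where C1: "0 < C1" "\<And>t f. 0 < t \<Longrightarrow> f \<in> A01 \<Longrightarrow> N1 f < top \<Longrightarrow> P t f \<le> ennreal C1 * (ennreal (\<rho> t) * N1 f)" using P_le_N1 by auto
  let ?M = "max C0 C1"
  have "P t f \<le> ennreal (C * ?M) * K_fun X0 X1 (\<rho> t) f" if t: "0 < t" for t f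
  proof (rule K_fun_greatest_cmult)
    fix f0 f1 assume f: "f0 \<in> elems X0" "f1 \<in> elems X1" "f = f0 + f1"
    show "P t f \<le> ennreal (C * ?M) * (qnorm X0 f0 + ennreal (\<rho> t) * qnorm X1 f1)"
    proof (rule le_cmult_trans)
      show "P t f \<le> ennreal C * (P t f0 + P t f1)" using C(2)[OF t] f(3) by simp
      have "P t f0 + P t f1 \<le> ennreal C0 * N0 f0 + ennreal C1 * (ennreal (\<rho> t) * N1 f1)"
        using f by (intro add_mono C0(2) C1(2) t) (auto simp: X0_simps X1_simps)
      also have "\<dots> \<le> ennreal ?M * N0 f0 + ennreal ?M * (ennreal (\<rho> t) * N1 f1)"
        by (intro add_mono mult_right_mono ennreal_leI) auto
      finally show "P t f0 + P t f1 \<le> ennreal ?M * (qnorm X0 f0 + ennreal (\<rho> t) * qnorm X1 f1)"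
        by (simp add: X0_simps X1_simps distrib_left)
    qed (use C in auto)
  qed (use C(1) C0(1) in auto)
  then show ?thesis using C(1) C0(1) by (intro exI[of _ "C * ?M"]) auto
qed

end

section \<open>Reiteration\<close>

lemma inter_finite_part:
  "inter_space (finite_part A0 A1 S) (finite_part A0 A1 T) = finite_part A0 A1 (\<lambda>f. max (S f) (T f))"
  by (auto simp: inter_space_def finite_part_def)

text \<open>\<open>w\<close> is the weight \<open>v powr (- \<theta>) * a v\<close> after the substitution \<open>v = \<rho> t\<close>.\<close>

locale reiteration = holmstedt +
  fixes r :: ennreal and a :: "real \<Rightarrow> real" and \<theta> :: real
  assumes r: "0 < r" and sv_a: "sv a" and \<theta>: "0 \<le> \<theta>" "\<theta> \<le> 1"
begin

definition "\<sigma> t = \<chi>0 t / \<chi>1 t"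
definition "w t = \<rho> t powr (- \<theta>) * a (\<rho> t)"
text \<open>The slowly varying part of w once t^(-\<theta>) is removed. The next weight is made so
  that u^\<theta> \<open>c\<^sub>w u\<close> is 1/(w(u) \<chi>0(u)): the size of K(u,f) for which w
  \<chi>0 K would be constant.\<close>

definition "slow t = (1 / \<sigma> t) powr \<theta> * a (\<rho> t)"
definition "c\<^sub>w t = 1 / (slow t * \<chi>0 t)"

lemma sv_\<sigma>: "sv \<sigma>"
  using sv_mult[OF sv_\<chi>0 sv_inverse[OF sv_\<chi>1]] by (simp add: \<sigma>_def[abs_def])

lemma \<sigma>_pos: "0 < t \<Longrightarrow> 0 < \<sigma> t"
  by (rule sv_pos[OF sv_\<sigma>])

lemma \<rho>_eq: "0 < t \<Longrightarrow> \<rho> t = t * \<sigma> t"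
  by (simp add: \<rho> \<sigma>_def)

lemma sv_slow: "sv slow"
  unfolding slow_def[abs_def]
  by (intro sv_mult sv_powr sv_inverse sv_\<sigma> \<theta> sv_comp[OF sv_a sv_\<sigma> \<rho>_eq])

lemma w_eq: "0 < t \<Longrightarrow> w t = t powr (- \<theta>) * slow t"
  using \<sigma>_pos[of t] by (simp add: w_def slow_def \<rho>_eq powr_mult powr_minus_divide powr_divide)

lemma w_pos: "0 < t \<Longrightarrow> 0 < w t"
  using sv_pos[OF sv_slow, of t] by (simp add: w_eq)

lemma sv_c\<^sub>w: "sv c\<^sub>w"
  unfolding c\<^sub>w_def[abs_def] by (intro sv_inverse sv_mult sv_slow sv_\<chi>0)

section \<open>Choice of the two grids\<close>

text \<open>Potter's inequality with exponent 1/2 lets \<sigma> fall by at most C \<Lambda>^(1/2)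
  over one step, while the factor t gains \<Lambda>. For large \<Lambda> the gain wins, so \<rho> at
  least doubles from one grid point to the next although it need not be monotone.\<close>

lemma geometric_grid:
  "\<exists>\<Lambda> M. 2 \<le> \<Lambda> \<and> \<Lambda> \<le> M \<and> partition (\<lambda>n. \<Lambda> powr real_of_int n) M \<and> partition (\<lambda>n. \<rho> (\<Lambda> powr real_of_int n)) M"
proof -
  obtain C' where C': "0 < C'" "\<And>s t. 0 < s \<Longrightarrow> 0 < t \<Longrightarrow> \<sigma> t \<le> C' * max (t / s) (s / t) powr (1/2) * \<sigma> s"
    using svE[OF sv_\<sigma>, of "1/2"] by auto
  define C where "C = max 1 C'"
  have C1: "1 \<le> C" by (simp add: C_def)
  have C: "\<sigma> t \<le> C * max (t / s) (s / t) powr (1/2) * \<sigma> s" if "0 < s" "0 < t" for s t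
  proof -
    have "C' * max (t / s) (s / t) powr (1/2) * \<sigma> s \<le> C * max (t / s) (s / t) powr (1/2) * \<sigma> s"
      using \<sigma>_pos[OF that(1)] by (intro mult_right_mono) (auto simp: C_def)
    then show ?thesis using C'(2)[OF that] by linarith
  qed
  \<comment> \<open>With \<Lambda>^(1/2) = 2C the loss of \<sigma> is at most 2C^2 and the gain is
    4C^2, leaving exactly the factor 2. The same loss upwards gives M.\<close>
  define \<Lambda> where "\<Lambda> = (2 * C)\<^sup>2"
  define M where "M = \<Lambda> * (C * (2 * C))"
  have "sqrt \<Lambda> = 2 * C" unfolding \<Lambda>_def using C1 by (intro real_sqrt_unique) auto
  then have root: "\<Lambda> powr (1/2) = 2 * C" using powr_half_sqrt[of \<Lambda>] by (simp add: \<Lambda>_def)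
  have "2 * 2 \<le> (2 * C) * (2 * C)" using C1 by (intro mult_mono) auto
  then have \<Lambda>: "4 \<le> \<Lambda>" by (simp add: \<Lambda>_def power2_eq_square)
  have "\<Lambda> * 1 \<le> M" unfolding M_def using C1 \<Lambda> mult_mono[of 1 C 1 "2 * C"] by (intro mult_left_mono) auto
  then have M: "\<Lambda> \<le> M" by simp
  have step: "\<Lambda> powr real_of_int (n + 1) = \<Lambda> * \<Lambda> powr real_of_int n" for n
    using \<Lambda> by (simp add: powr_add)
  have "partition (\<lambda>n. \<Lambda> powr real_of_int n) M"
    unfolding partition_def step using \<Lambda> M by (auto intro: mult_right_mono)
  moreover have "partition (\<lambda>n. \<rho> (\<Lambda> powr real_of_int n)) M"
    unfolding partition_def step
  proof (intro conjI allI)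
    fix n
    define t where "t = \<Lambda> powr real_of_int n"
    have t: "0 < t" using \<Lambda> by (simp add: t_def)
    have lt: "0 < \<Lambda> * t" using t \<Lambda> by simp
    have mx: "max (\<Lambda> * t / t) (t / (\<Lambda> * t)) = \<Lambda>" "max (t / (\<Lambda> * t)) (\<Lambda> * t / t) = \<Lambda>"
      using t \<Lambda> by (auto simp: max_def field_simps) (use \<Lambda> mult_mono[of 1 \<Lambda> 1 \<Lambda>] in auto)
    show "0 < \<rho> (\<Lambda> powr real_of_int n)" using \<rho>_pos[OF t] by (simp add: t_def)
    have "2 * \<rho> t = (2 * t) * \<sigma> t" using t by (simp add: \<rho>_eq)
    also have "\<dots> \<le> (2 * t) * (C * (2 * C) * \<sigma> (\<Lambda> * t))"
      using C[OF lt t] t unfolding mx root by (intro mult_left_mono) auto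
    also have "\<dots> = \<rho> (\<Lambda> * t)" using lt by (simp add: \<rho>_eq) (simp add: \<Lambda>_def power2_eq_square)
    finally show "2 * \<rho> (\<Lambda> powr real_of_int n) \<le> \<rho> (\<Lambda> * \<Lambda> powr real_of_int n)" by (simp add: t_def)
    have "\<rho> (\<Lambda> * t) = \<Lambda> * t * \<sigma> (\<Lambda> * t)" using lt by (simp add: \<rho>_eq)
    also have "\<dots> \<le> \<Lambda> * t * (C * (2 * C) * \<sigma> t)"
      using C[OF t lt] lt unfolding mx root by (intro mult_left_mono) auto
    also have "\<dots> = M * \<rho> t" using t by (simp add: \<rho>_eq M_def)
    finally show "\<rho> (\<Lambda> * \<Lambda> powr real_of_int n) \<le> M * \<rho> (\<Lambda> powr real_of_int n)" by (simp add: t_def)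
  qed
  ultimately show ?thesis using \<Lambda> M by (intro exI[of _ \<Lambda>] exI[of _ M]) auto
qed

text \<open>One pair is fixed by choice so that the grid can be named in definitions and both
  partitions become sublocales.\<close>

definition "\<Lambda>M = (SOME p. 2 \<le> fst p \<and> fst p \<le> snd p \<and> partition (\<lambda>n. fst p powr real_of_int n) (snd p) \<and>
  partition (\<lambda>n. \<rho> (fst p powr real_of_int n)) (snd p))"
definition "\<Lambda> = fst \<Lambda>M"
definition "M = snd \<Lambda>M"
definition "x n = \<Lambda> powr real_of_int n"

lemma grid: "2 \<le> \<Lambda>" "\<Lambda> \<le> M" "partition x M" "partition (\<lambda>n. \<rho> (x n)) M"
proof -
  have "\<exists>p. 2 \<le> fst p \<and> fst p \<le> snd p \<and> partition (\<lambda>n. fst p powr real_of_int n) (snd p) \<and>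
      partition (\<lambda>n. \<rho> (fst p powr real_of_int n)) (snd p)"
    using geometric_grid by auto
  from someI_ex[OF this, folded \<Lambda>M_def] 
  show "2 \<le> \<Lambda>" "\<Lambda> \<le> M" "partition x M" "partition (\<lambda>n. \<rho> (x n)) M"
    by (auto simp: \<Lambda>_def M_def x_def[abs_def])
qed

sublocale x: partition x M by (rule grid(3))
sublocale \<rho>x: partition "\<lambda>n. \<rho> (x n)" M by (rule grid(4))

lemma M: "1 \<le> M" "2 \<le> M" using grid(1,2) by auto

lemma x_step: "x (n + 1) = \<Lambda> * x n"
  using grid(1) by (simp add: x_def powr_add)

lemma powr_block:
  assumes "0 < s" "s \<le> t" "t \<le> M * s"
  shows "t powr (- \<theta>) \<le> s powr (- \<theta>)" "s powr (- \<theta>) \<le> M * t powr (- \<theta>)"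
proof -
  have t: "0 < t" using assms by simp
  show "t powr (- \<theta>) \<le> s powr (- \<theta>)" using assms \<theta> by (intro powr_mono2') auto
  have "(t / s) powr \<theta> \<le> (t / s) powr 1" using assms \<theta> by (intro powr_mono) auto
  also have "\<dots> \<le> M" using assms t by (simp add: pos_divide_le_eq)
  finally have "(t / s) powr \<theta> * t powr (- \<theta>) \<le> M * t powr (- \<theta>)" by (rule mult_right_mono) simp
  then show "s powr (- \<theta>) \<le> M * t powr (- \<theta>)"
    using assms t by (simp add: powr_divide powr_minus field_simps)
qed

lemma w_block: "\<exists>D\<ge>1. \<forall>s t. 0 < s \<longrightarrow> s \<le> t \<longrightarrow> t \<le> M * s \<longrightarrow> w t \<le> D * w s \<and> w s \<le> D * w t"
proof -
  obtain D where D: "1 \<le> D" "\<And>s t. 0 < s \<Longrightarrow> s \<le> t \<Longrightarrow> t \<le> M * s \<Longrightarrow> slow t \<le> D * slow s \<and> slow s \<le> D * slow t"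
    using sv_block[OF sv_slow M(1)] by blast
  have "w t \<le> (M * D) * w s \<and> w s \<le> (M * D) * w t" if st: "0 < s" "s \<le> t" "t \<le> M * s" for s t
  proof -
    have t: "0 < t" using st by simp
    note p = powr_block(1)[OF st] and p' = powr_block(2)[OF st]
    have "s powr (- \<theta>) \<le> M * s powr (- \<theta>)" using mult_right_mono[OF M(1), of "s powr (- \<theta>)"] by simp
    then have "w t \<le> (M * s powr (- \<theta>)) * (D * slow s)"
      unfolding w_eq[OF t] using p D(2)[OF st] sv_pos[OF sv_slow t] M by (intro mult_mono) auto
    moreover have "w s \<le> (M * t powr (- \<theta>)) * (D * slow t)"
      unfolding w_eq[OF st(1)] using p' D(2)[OF st] sv_pos[OF sv_slow st(1)] M by (intro mult_mono) auto
    ultimately show ?thesis by (simp add: w_eq[OF t] w_eq[OF st(1)] mult_ac)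
  qed
  moreover have "1 \<le> M * D" using M D(1) mult_mono[of 1 M 1 D] by auto
  ultimately show ?thesis by (intro exI[of _ "M * D"]) auto
qed

lemma \<rho>_block: "\<exists>D\<ge>1. \<forall>s t. 0 < s \<longrightarrow> s \<le> t \<longrightarrow> t \<le> M * s \<longrightarrow> \<rho> t \<le> D * \<rho> s"
proof -
  obtain D where D: "1 \<le> D" "\<And>s t. 0 < s \<Longrightarrow> s \<le> t \<Longrightarrow> t \<le> M * s \<Longrightarrow> \<sigma> t \<le> D * \<sigma> s \<and> \<sigma> s \<le> D * \<sigma> t"
    using sv_block[OF sv_\<sigma> M(1)] by blast
  have "\<rho> t \<le> (M * D) * \<rho> s" if st: "0 < s" "s \<le> t" "t \<le> M * s" for s t
  proof -
    have t: "0 < t" using st by simp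
    have "t * \<sigma> t \<le> (M * s) * (D * \<sigma> s)"
      using st D(2)[OF st] \<sigma>_pos[OF t] M by (intro mult_mono) auto
    then show ?thesis by (simp add: \<rho>_eq[OF t] \<rho>_eq[OF st(1)] mult_ac)
  qed
  moreover have "1 \<le> M * D" using M D(1) mult_mono[of 1 M 1 D] by auto
  ultimately show ?thesis by (intro exI[of _ "M * D"]) auto
qed

section \<open>Passing between integral norms and sequences\<close>

definition KX :: "real \<Rightarrow> 'a \<Rightarrow> ennreal" where "KX v f = K_fun X0 X1 v f"
definition LHS :: "'a \<Rightarrow> ennreal" where "LHS f = Nrm r {0<..} (\<lambda>v. ennreal (v powr (- \<theta>) * a v) * KX v f)"
definition Y :: "'a \<Rightarrow> int \<Rightarrow> ennreal" where "Y f n = ennreal (w (x n)) * KX (\<rho> (x n)) f"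
text \<open>Norms of the three terms of w P. \<open>TK\<close> is the norm of the reiterated space
  on the right; \<open>TI\<close> and \<open>TJ\<close> are the additional norms at \<theta> = 0 and
  \<theta> = 1.\<close>

definition TI :: "'a \<Rightarrow> ennreal" where "TI f = Nrm r {0<..} (\<lambda>t. ennreal (w t) * I t f)"
definition TK :: "'a \<Rightarrow> ennreal" where "TK f = Nrm r {0<..} (\<lambda>t. ennreal (w t * \<chi>0 t) * K t f)"
definition TJ :: "'a \<Rightarrow> ennreal" where "TJ f = Nrm r {0<..} (\<lambda>t. ennreal (w t * \<rho> t) * J t f)"

text \<open>Stands in for the substitution v = \<rho>(t): across a cell between consecutive values
  \<rho>(\<Lambda>^n) the argument varies by at most M, so the power, the weight a and K are
  constant up to bounded factors.\<close>

lemma LHS_equiv: "\<exists>C>0. \<forall>f. LHS f \<le> ennreal C * ell r (Y f) \<and> ell r (Y f) \<le> ennreal C * LHS f"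
proof -
  obtain D where D: "1 \<le> D" "\<And>s t. 0 < s \<Longrightarrow> s \<le> t \<Longrightarrow> t \<le> M * s \<Longrightarrow> a t \<le> D * a s \<and> a s \<le> D * a t"
    using sv_block[OF sv_a M(1)] by blast
  let ?F = "\<lambda>f v. ennreal (v powr (- \<theta>) * a v) * KX v f"
  have MD: "0 < M * D" using M D by simp
  have F1: "?F f v \<le> ennreal (M * D) * Y f n" and F2: "Y f n \<le> ennreal (M * D) * ?F f v"
    if v: "\<rho> (x n) \<le> v" "v < \<rho> (x (n + 1))" for f n v
  proof -
    let ?s = "\<rho> (x n)"
    have s: "0 < ?s" by (rule \<rho>x.pos)
    have v0: "0 < v" and vM: "v \<le> M * ?s" using s v \<rho>x.ratio[of n] by auto
    have w: "w (x n) = ?s powr (- \<theta>) * a ?s" by (simp add: w_def)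
    have pos: "0 < a v" "0 < a ?s" using sv_pos[OF sv_a] s v0 by auto
    note p = powr_block[OF s v(1) vM]
    have "v powr (- \<theta>) * a v \<le> ?s powr (- \<theta>) * (D * a ?s)"
      using p(1) D(2)[OF s v(1) vM] pos by (intro mult_mono) auto
    then have 1: "v powr (- \<theta>) * a v \<le> D * w (x n)" by (simp add: w mult_ac)
    have "KX v f \<le> ennreal (v / ?s) * KX ?s f" unfolding KX_def using v s by (intro K_fun_scale)
    also have "\<dots> \<le> ennreal M * KX ?s f" using vM s by (intro mult_right_mono ennreal_leI) (auto simp: pos_divide_le_eq)
    finally have "?F f v \<le> ennreal (D * w (x n)) * (ennreal M * KX ?s f)"
      by (intro mult_mono ennreal_leI[OF 1]) auto
    also have "\<dots> = ennreal (M * D) * Y f n"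
      using D(1) M by (simp add: Y_def ennreal_mult' mult_ac)
    finally show "?F f v \<le> ennreal (M * D) * Y f n" .
    have "w (x n) \<le> (M * v powr (- \<theta>)) * (D * a v)"
      unfolding w using p(2) D(2)[OF s v(1) vM] pos M by (intro mult_mono) auto
    then have 2: "w (x n) \<le> M * D * (v powr (- \<theta>) * a v)" by (simp add: mult_ac)
    have "Y f n \<le> ennreal (M * D * (v powr (- \<theta>) * a v)) * KX v f"
      unfolding Y_def KX_def using v by (intro mult_mono ennreal_leI[OF 2] K_fun_mono) auto
    also have "\<dots> = ennreal (M * D) * ?F f v"
      unfolding ennreal_mult'[OF less_imp_le[OF MD]] by (simp only: mult.assoc)
    finally show "Y f n \<le> ennreal (M * D) * ?F f v" .
  qed
  let ?c1 = "ln M powr recip r" and ?c2 = "(1 / ln 2) powr recip r"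
  have "LHS f \<le> ennreal (?c1 * (M * D)) * ell r (Y f)" for f
    unfolding LHS_def by (rule \<rho>x.Nrm_le_cmult_ell[OF r]) (rule F1)
  then have L1: "LHS f \<le> ennreal (max (?c1 * (M * D)) (?c2 * (M * D))) * ell r (Y f)" for f
    by (rule order_trans[OF _ mult_right_mono]) (auto intro: ennreal_leI)
  have "ell r (Y f) \<le> ennreal (?c2 * (M * D)) * LHS f" for f
    unfolding LHS_def by (rule \<rho>x.ell_le_cmult_Nrm[OF r]) (rule F2)
  then have L2: "ell r (Y f) \<le> ennreal (max (?c1 * (M * D)) (?c2 * (M * D))) * LHS f" for f
    by (rule order_trans[OF _ mult_right_mono]) (auto intro: ennreal_leI)
  have "0 < ?c2 * (M * D)" using MD by simp
  then have "0 < max (?c1 * (M * D)) (?c2 * (M * D))" by (rule less_le_trans[OF _ max.cobounded2])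
  then show ?thesis using L1 L2 by blast
qed

text \<open>The t-integrals are discretized along \<Lambda>^n and the v-integral along
  \<rho>(\<Lambda>^n); both meet in the sequence \<open>Y\<close>. Each target follows from w P
  because dropping the other terms is pointwise.\<close>

lemma targets_le_LHS: "\<exists>C>0. \<forall>f. TI f \<le> ennreal C * LHS f \<and> TK f \<le> ennreal C * LHS f \<and> TJ f \<le> ennreal C * LHS f"
proof -
  obtain C1 where C1: "0 < C1" "\<And>f. ell r (Y f) \<le> ennreal C1 * LHS f" using LHS_equiv by auto
  obtain C2 where C2: "0 < C2" "\<And>t f. 0 < t \<Longrightarrow> P t f \<le> ennreal C2 * KX (\<rho> t) f"
    using holmstedt_lower unfolding KX_def by auto
  obtain D where D: "1 \<le> D" "\<And>s t. 0 < s \<Longrightarrow> s \<le> t \<Longrightarrow> t \<le> M * s \<Longrightarrow> w t \<le> D * w s"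
    using w_block by blast
  obtain E where E: "1 \<le> E" "\<And>s t. 0 < s \<Longrightarrow> s \<le> t \<Longrightarrow> t \<le> M * s \<Longrightarrow> \<rho> t \<le> E * \<rho> s"
    using \<rho>_block by blast
  let ?c1 = "ln M powr recip r" and ?C = "C2 * (D * E)"
  have C: "0 < ?C" using C2(1) D(1) E(1) by simp
  have wP: "Nrm r {0<..} (\<lambda>t. ennreal (w t) * P t f) \<le> ennreal (?c1 * ?C * C1) * LHS f" for f
  proof (rule le_cmult_trans)
    show "Nrm r {0<..} (\<lambda>t. ennreal (w t) * P t f) \<le> ennreal (?c1 * ?C) * ell r (Y f)"
    proof (rule x.Nrm_le_cmult_ell[OF r])
      fix n t assume t: "x n \<le> t" "t < x (n + 1)"
      have xn: "0 < x n" "t \<le> M * x n" using x.pos[of n] x.ratio[of n] t by auto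
      have t0: "0 < t" using xn t by simp
      have "KX (\<rho> t) f \<le> KX (E * \<rho> (x n)) f"
        unfolding KX_def using E(2)[OF xn(1) t(1) xn(2)] by (rule K_fun_mono)
      also have "\<dots> \<le> ennreal (E * \<rho> (x n) / \<rho> (x n)) * KX (\<rho> (x n)) f"
        unfolding KX_def using \<rho>x.pos[of n] E(1) by (intro K_fun_scale) auto
      also have "E * \<rho> (x n) / \<rho> (x n) = E" using \<rho>x.pos[of n] by simp
      finally have "ennreal (w t) * P t f \<le> ennreal (D * w (x n)) * (ennreal C2 * (ennreal E * KX (\<rho> (x n)) f))"
        by (intro mult_mono ennreal_leI[OF D(2)[OF xn(1) t(1) xn(2)]] order_trans[OF C2(2)[OF t0]] mult_left_mono) auto
      also have "\<dots> = ennreal ?C * Y f n" using C2(1) D(1) E(1) by (simp add: Y_def ennreal_mult' mult_ac)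
      finally show "ennreal (w t) * P t f \<le> ennreal ?C * Y f n" .
    qed
  qed (use C1(2) C M(2) in auto)
  have "TI f \<le> Nrm r {0<..} (\<lambda>t. ennreal (w t) * P t f)" for f
    unfolding TI_def P_def by (intro Nrm_mono r mult_left_mono) auto
  moreover have "TK f \<le> Nrm r {0<..} (\<lambda>t. ennreal (w t) * P t f)" for f
    unfolding TK_def P_def using w_pos \<chi>_pos
    by (intro Nrm_mono r) (auto simp: ennreal_mult less_imp_le mult.assoc distrib_left add_increasing2 add_increasing)
  moreover have "TJ f \<le> Nrm r {0<..} (\<lambda>t. ennreal (w t) * P t f)" for f
    unfolding TJ_def P_def using w_pos \<rho>_pos
    by (intro Nrm_mono r) (auto simp: ennreal_mult less_imp_le mult.assoc distrib_left add_increasing2 add_increasing)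
  ultimately have "TI f \<le> ennreal (?c1 * ?C * C1) * LHS f \<and> TK f \<le> ennreal (?c1 * ?C * C1) * LHS f \<and> TJ f \<le> ennreal (?c1 * ?C * C1) * LHS f" for f
    using wP[of f] by (meson order_trans)
  moreover have "0 < ?c1 * ?C * C1" using C C1(1) M(2) by simp
  ultimately show ?thesis by blast
qed

definition EI :: "'a \<Rightarrow> int \<Rightarrow> ennreal" where "EI f n = ennreal (w (x n)) * I (x n) f"
definition EK :: "'a \<Rightarrow> int \<Rightarrow> ennreal" where "EK f n = ennreal (w (x n) * \<chi>0 (x n)) * K (x n) f"
definition EJ :: "'a \<Rightarrow> int \<Rightarrow> ennreal" where "EJ f n = ennreal (w (x n) * \<rho> (x n)) * J (x n) f"

text \<open>The decisive place for discretization: the sum P is split inside a sequence norm, so no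
  measurability of w is asked for.\<close>

lemma LHS_le: "\<exists>C>0. \<forall>f\<in>A01. LHS f \<le> ennreal C * (ell r (EI f) + ell r (EK f) + ell r (EJ f))"
proof -
  obtain C1 where C1: "0 < C1" "\<And>f. LHS f \<le> ennreal C1 * ell r (Y f)" using LHS_equiv by auto
  obtain C2 where C2: "0 < C2" "\<And>t f. 0 < t \<Longrightarrow> f \<in> A01 \<Longrightarrow> KX (\<rho> t) f \<le> ennreal C2 * P t f"
    using holmstedt_upper unfolding KX_def by auto
  let ?q = "quasi_const r"
  have q: "1 \<le> ?q" by (rule quasi_const_ge_1)
  have "LHS f \<le> ennreal (C1 * (C2 * (?q * ?q))) * (ell r (EI f) + ell r (EK f) + ell r (EJ f))" if f: "f \<in> A01" for f
  proof (rule le_cmult_trans[OF C1(2) le_cmult_trans])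
    have "Y f n \<le> ennreal C2 * (EI f n + EK f n + EJ f n)" for n
    proof -
      have "Y f n \<le> ennreal (w (x n)) * (ennreal C2 * P (x n) f)"
        unfolding Y_def using C2(2)[OF x.pos f] by (intro mult_left_mono) auto
      also have "\<dots> = ennreal C2 * (EI f n + EK f n + EJ f n)"
        using w_pos[OF x.pos, of n] \<chi>_pos(1)[OF x.pos, of n] \<rho>_pos[OF x.pos, of n]
        by (simp add: P_def EI_def EK_def EJ_def ennreal_mult less_imp_le distrib_left mult_ac)
      finally show ?thesis .
    qed
    then show "ell r (Y f) \<le> ennreal C2 * ell r (\<lambda>n. EI f n + EK f n + EJ f n)"
      by (intro ell_le_cmult r) auto
    have "ell r (\<lambda>n. EI f n + EK f n + EJ f n) \<le> ennreal ?q * (ell r (\<lambda>n. EI f n + EK f n) + ell r (EJ f))"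
      by (rule ell_add[OF r])
    also have "\<dots> \<le> ennreal ?q * (ennreal ?q * (ell r (EI f) + ell r (EK f)) + ennreal ?q * ell r (EJ f))"
    proof (intro mult_left_mono add_mono ell_add[OF r])
      have "1 * ell r (EJ f) \<le> ennreal ?q * ell r (EJ f)"
        using q by (intro mult_right_mono) (auto simp: ennreal_leI simp flip: ennreal_1)
      then show "ell r (EJ f) \<le> ennreal ?q * ell r (EJ f)" by simp
    qed auto
    also have "\<dots> = ennreal (?q * ?q) * (ell r (EI f) + ell r (EK f) + ell r (EJ f))"
      using q by (simp add: ennreal_mult distrib_left mult.assoc)
    finally show "ell r (\<lambda>n. EI f n + EK f n + EJ f n) \<le> \<dots>" .
  qed (use C1 C2 in auto)
  then show ?thesis using C1 C2 q by (intro exI[of _ "C1 * (C2 * (?q * ?q))"]) auto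
qed

lemma ell_EK: "\<exists>C>0. \<forall>f. ell r (EK f) \<le> ennreal C * TK f"
proof -
  obtain D where D: "1 \<le> D" "\<And>s t. 0 < s \<Longrightarrow> s \<le> t \<Longrightarrow> t \<le> M * s \<Longrightarrow> w s \<le> D * w t"
    using w_block by blast
  obtain E where E: "1 \<le> E" "\<And>s t. 0 < s \<Longrightarrow> s \<le> t \<Longrightarrow> t \<le> M * s \<Longrightarrow> \<chi>0 s \<le> E * \<chi>0 t"
    using sv_block[OF sv_\<chi>0 M(1)] by blast
  let ?c = "(1 / ln 2) powr recip r"
  have "ell r (EK f) \<le> ennreal (?c * (D * E)) * TK f" for f
    unfolding TK_def
  proof (rule x.ell_le_cmult_Nrm[OF r])
    fix n t assume t: "x n \<le> t" "t < x (n + 1)"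
    have xn: "0 < x n" "t \<le> M * x n" using x.pos[of n] x.ratio[of n] t by auto
    have "w (x n) * \<chi>0 (x n) \<le> (D * w t) * (E * \<chi>0 t)"
      using D(1) D(2)[OF xn(1) t(1) xn(2)] E(2)[OF xn(1) t(1) xn(2)] w_pos[of t] \<chi>_pos(1)[OF xn(1)] xn t
      by (intro mult_mono) auto
    then have le: "w (x n) * \<chi>0 (x n) \<le> (D * E) * (w t * \<chi>0 t)" by (simp add: mult_ac)
    have "EK f n \<le> ennreal ((D * E) * (w t * \<chi>0 t)) * K t f"
      unfolding EK_def using t by (intro mult_mono ennreal_leI[OF le] K_fun_mono) auto
    then show "EK f n \<le> ennreal (D * E) * (ennreal (w t * \<chi>0 t) * K t f)"
      using D(1) E(1) by (simp add: ennreal_mult' mult.assoc)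
  qed
  then show ?thesis using D(1) E(1) by (intro exI[of _ "?c * (D * E)"]) auto
qed

lemma I_mono: "s \<le> t \<Longrightarrow> I s f \<le> I t f"
  unfolding I_def by (intro Nrm_mono r0) auto

lemma J_antimono: "s \<le> t \<Longrightarrow> J t f \<le> J s f"
  unfolding J_def by (intro Nrm_mono r1 mult_left_mono Jin_mono) auto

lemma ell_EI: "\<exists>C>0. \<forall>f. ell r (EI f) \<le> ennreal C * TI f"
proof -
  obtain D where D: "1 \<le> D" "\<And>s t. 0 < s \<Longrightarrow> s \<le> t \<Longrightarrow> t \<le> M * s \<Longrightarrow> w s \<le> D * w t"
    using w_block by blast
  let ?c = "(1 / ln 2) powr recip r"
  have "ell r (EI f) \<le> ennreal (?c * D) * TI f" for f
    unfolding TI_def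
  proof (rule x.ell_le_cmult_Nrm[OF r])
    fix n t assume t: "x n \<le> t" "t < x (n + 1)"
    have xn: "0 < x n" "t \<le> M * x n" using x.pos[of n] x.ratio[of n] t by auto
    have "EI f n \<le> ennreal (D * w t) * I t f"
      unfolding EI_def using t by (intro mult_mono ennreal_leI[OF D(2)[OF xn(1) t(1) xn(2)]] I_mono) auto
    then show "EI f n \<le> ennreal D * (ennreal (w t) * I t f)"
      using D(1) by (simp add: ennreal_mult' mult.assoc)
  qed
  then show ?thesis using D(1) by (intro exI[of _ "?c * D"]) auto
qed

text \<open>I and K increase, so their values at the left end of a cell are below those inside it. J
  decreases, so the right end n + 1 is used here and the index is shifted back by
  \<open>ell_shift\<close>.\<close>

lemma ell_EJ: "\<exists>C>0. \<forall>f. ell r (EJ f) \<le> ennreal C * TJ f"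
proof -
  obtain D where D: "1 \<le> D" "\<And>s t. 0 < s \<Longrightarrow> s \<le> t \<Longrightarrow> t \<le> M * s \<Longrightarrow> w t \<le> D * w s"
    using w_block by blast
  obtain E where E: "1 \<le> E" "\<And>s t. 0 < s \<Longrightarrow> s \<le> t \<Longrightarrow> t \<le> M * s \<Longrightarrow> \<rho> t \<le> E * \<rho> s"
    using \<rho>_block by blast
  let ?c = "(1 / ln 2) powr recip r"
  have "ell r (\<lambda>n. EJ f (n + 1)) \<le> ennreal (?c * (D * E)) * TJ f" for f
    unfolding TJ_def
  proof (rule x.ell_le_cmult_Nrm[OF r])
    fix n t assume t: "x n \<le> t" "t < x (n + 1)"
    have t0: "0 < t" using x.pos[of n] t by auto
    have "M * x n \<le> M * t" using M t by (intro mult_left_mono) auto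
    then have le: "t \<le> x (n + 1)" "x (n + 1) \<le> M * t" using x.ratio[of n] t by auto
    have "w (x (n + 1)) * \<rho> (x (n + 1)) \<le> (D * w t) * (E * \<rho> t)"
      using D(1) D(2)[OF t0 le] E(2)[OF t0 le] w_pos[OF t0] \<rho>_pos[OF x.pos, of "n + 1"]
      by (intro mult_mono) auto
    then have le': "w (x (n + 1)) * \<rho> (x (n + 1)) \<le> (D * E) * (w t * \<rho> t)" by (simp add: mult_ac)
    have "EJ f (n + 1) \<le> ennreal ((D * E) * (w t * \<rho> t)) * J t f"
      unfolding EJ_def using le by (intro mult_mono ennreal_leI[OF le'] J_antimono) auto
    then show "EJ f (n + 1) \<le> ennreal (D * E) * (ennreal (w t * \<rho> t) * J t f)"
      using D(1) E(1) by (simp add: ennreal_mult' mult.assoc)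
  qed
  then show ?thesis unfolding ell_shift using D(1) E(1) by (intro exI[of _ "?c * (D * E)"]) auto
qed

section \<open>Hardy estimates for the I- and J-terms\<close>

text \<open>The least sequence above \<open>EK\<close> that changes by at most the factor
  \<Lambda>^\<delta> per step. It controls \<open>EK\<close> at all scales from its value at n
  alone, and \<open>ell_hardy\<close> bounds its norm.\<close>

definition HS :: "real \<Rightarrow> 'a \<Rightarrow> int \<Rightarrow> ennreal" where
  "HS \<delta> f n = (SUP k. ennreal ((\<Lambda> powr (- \<delta>)) ^ nat \<bar>n - k\<bar>) * EK f k)"

lemma ell_HS: "0 < \<delta> \<Longrightarrow> \<exists>C>0. \<forall>f. ell r (HS \<delta> f) \<le> ennreal C * ell r (EK f)"
proof -
  assume d: "0 < \<delta>"
  have "\<Lambda> powr (- \<delta>) < 1" "0 < \<Lambda> powr (- \<delta>)" using grid(1) d by (auto simp: powr_less_one)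
  then obtain C where "0 < C" "\<And>E. ell r (\<lambda>n. SUP k. ennreal ((\<Lambda> powr (- \<delta>)) ^ nat \<bar>n - k\<bar>) * E k) \<le> ennreal C * ell r E"
    using ell_hardy[OF r] by blast
  then show ?thesis unfolding HS_def[abs_def] by blast
qed

text \<open>K(u) is compared with its value at the left end x k of the cell of u, which is EK(k)/(w
  \<chi>0)(x k); moving from k to n costs \<Lambda>^(\<delta> |n - k|), comparable to the
  \<delta>-th power of the ratio of u and x n. The result is a pointwise bound of the kind that
  \<open>I_bound\<close> and \<open>J_bound\<close> accept.\<close>

lemma K_le_HS:
  assumes "0 < \<delta>" "\<delta> \<le> 1"
  shows "\<exists>C>0. \<forall>f n u. 0 < u \<longrightarrow>
    K u f \<le> ennreal (C * (max (u / x n) (x n / u) powr \<delta> * (u powr \<theta> * c\<^sub>w u))) * HS \<delta> f n"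
proof -
  obtain D where D: "1 \<le> D" "\<And>s t. 0 < s \<Longrightarrow> s \<le> t \<Longrightarrow> t \<le> M * s \<Longrightarrow> w t \<le> D * w s"
    using w_block by blast
  obtain E where E: "1 \<le> E" "\<And>s t. 0 < s \<Longrightarrow> s \<le> t \<Longrightarrow> t \<le> M * s \<Longrightarrow> \<chi>0 t \<le> E * \<chi>0 s"
    using sv_block[OF sv_\<chi>0 M(1)] by blast
  let ?C = "M * (D * E) * M"
  have "K u f \<le> ennreal (?C * (max (u / x n) (x n / u) powr \<delta> * (u powr \<theta> * c\<^sub>w u))) * HS \<delta> f n" if u: "0 < u" for f n u
  proof -
    obtain k where k: "x k \<le> u" "u < x (k + 1)" using x.ex_index[OF u] by blast
    have xk: "0 < x k" "0 < x n" "u \<le> M * x k" using x.pos x.ratio[of k] k by auto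
    let ?m = "max (u / x n) (x n / u)"
    have m1: "1 \<le> ?m" by (rule max_ratio_ge_1) (use u xk in auto)
    have 1: "K u f \<le> ennreal M * K (x k) f"
    proof -
      have "K u f \<le> ennreal (u / x k) * K (x k) f" using k xk by (intro K_fun_scale)
      also have "\<dots> \<le> ennreal M * K (x k) f" using xk by (intro mult_right_mono ennreal_leI) (auto simp: pos_divide_le_eq)
      finally show ?thesis .
    qed
    have wk: "0 < w (x k) * \<chi>0 (x k)" using w_pos[OF xk(1)] \<chi>_pos(1)[OF xk(1)] by simp
    have "w u * \<chi>0 u \<le> (D * w (x k)) * (E * \<chi>0 (x k))"
      using D(1) D(2)[OF xk(1) k(1) xk(3)] E(2)[OF xk(1) k(1) xk(3)] w_pos[OF xk(1)] \<chi>_pos(1)[OF u] by (intro mult_mono) auto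
    then have "w u * \<chi>0 u \<le> D * E * (w (x k) * \<chi>0 (x k))" by (simp add: mult_ac)
    moreover have "1 / V \<le> c * (1 / W)" if "0 < V" "0 < W" "W \<le> c * V" for V W c :: real
      using that by (simp add: field_simps)
    ultimately have "1 / (w (x k) * \<chi>0 (x k)) \<le> D * E * (1 / (w u * \<chi>0 u))"
      using wk w_pos[OF u] \<chi>_pos(1)[OF u] by simp
    also have "1 / (w u * \<chi>0 u) = u powr \<theta> * c\<^sub>w u"
      using u by (simp add: w_eq c\<^sub>w_def powr_minus_divide)
    finally have 2: "1 / (w (x k) * \<chi>0 (x k)) \<le> D * E * (u powr \<theta> * c\<^sub>w u)" .
    have cancel: "ennreal (1 / V) * (ennreal V * y) = y" if "0 < V" for V y
      using that by (simp add: mult.assoc[symmetric] flip: ennreal_mult')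
    have 3: "K (x k) f = ennreal (1 / (w (x k) * \<chi>0 (x k))) * EK f k"
      by (simp only: EK_def cancel[OF wk])
    let ?z = "(\<Lambda> powr (- \<delta>)) ^ nat \<bar>n - k\<bar>"
    have \<Lambda>0: "0 < \<Lambda>" "1 \<le> \<Lambda>" using grid(1) by auto
    have z: "0 < ?z" using \<Lambda>0 by simp
    have "ennreal ?z * EK f k \<le> HS \<delta> f n" unfolding HS_def by (rule SUP_upper) simp
    then have "ennreal (1 / ?z) * (ennreal ?z * EK f k) \<le> ennreal (1 / ?z) * HS \<delta> f n" by (rule mult_left_mono) simp
    then have 4: "EK f k \<le> ennreal (1 / ?z) * HS \<delta> f n" by (simp only: cancel[OF z])
    have "?z = (\<Lambda> powr (- \<delta>)) powr real (nat \<bar>n - k\<bar>)"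
      by (rule powr_realpow[symmetric]) (use \<Lambda>0 in simp)
    also have "real (nat \<bar>n - k\<bar>) = real_of_int \<bar>n - k\<bar>" by simp
    also have "(\<Lambda> powr (- \<delta>)) powr real_of_int \<bar>n - k\<bar> = \<Lambda> powr (- (real_of_int \<bar>n - k\<bar> * \<delta>))"
      by (simp only: powr_powr mult_minus_left mult.commute)
    finally have "1 / ?z = (\<Lambda> powr real_of_int \<bar>n - k\<bar>) powr \<delta>"
      using \<Lambda>0 by (simp only: powr_minus_divide powr_powr) simp
    also have "\<dots> \<le> (\<Lambda> * ?m) powr \<delta>"
    proof (rule powr_mono2)
      have "\<Lambda> powr real_of_int \<bar>n - k\<bar> = (if n \<le> k then x k / x n else x n / x k)"
        using \<Lambda>0 by (auto simp: x_def powr_diff)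
      also have "\<dots> \<le> \<Lambda> * ?m"
      proof (cases "n \<le> k")
        case True
        have "x k / x n \<le> 1 * (u / x n)" using k xk by (simp add: divide_right_mono)
        also have "\<dots> \<le> \<Lambda> * ?m" using \<Lambda>0 u xk by (intro mult_mono) auto
        finally show ?thesis using True by simp
      next
        case False
        \<comment> \<open>Only u < x (k + 1) bounds u from above, so one extra factor \<Lambda>
          appears in this direction.\<close>
        have "x n / x k = \<Lambda> * (x n / x (k + 1))" using \<Lambda>0 by (simp add: x_step)
        also have "\<dots> \<le> \<Lambda> * ?m"
          using \<Lambda>0 u xk k by (intro mult_left_mono) (auto simp: le_max_iff_disj intro!: disjI2 divide_left_mono)
        finally show ?thesis using False by simp
      qed
      finally show "\<Lambda> powr real_of_int \<bar>n - k\<bar> \<le> \<Lambda> * ?m" .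
    qed (use assms \<Lambda>0 in auto)
    also have "\<dots> = \<Lambda> powr \<delta> * ?m powr \<delta>" using m1 \<Lambda>0 by (simp add: powr_mult)
    also have "\<dots> \<le> M * ?m powr \<delta>"
    proof (rule mult_right_mono)
      have "\<Lambda> powr \<delta> \<le> \<Lambda> powr 1" using \<Lambda>0 assms by (intro powr_mono) auto
      then show "\<Lambda> powr \<delta> \<le> M" using \<Lambda>0 grid(2) by simp
    qed simp
    finally have 5: "1 / ?z \<le> M * ?m powr \<delta>" .
    have "K u f \<le> ennreal M * (ennreal (D * E * (u powr \<theta> * c\<^sub>w u)) * (ennreal (M * ?m powr \<delta>) * HS \<delta> f n))"
      using 1 unfolding 3
      by (rule order_trans) (intro mult_left_mono mult_mono ennreal_leI[OF 2] order_trans[OF 4] mult_right_mono ennreal_leI[OF 5], auto)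
    also have "\<dots> = ennreal (M * (D * E * (u powr \<theta> * c\<^sub>w u)) * (M * ?m powr \<delta>)) * HS \<delta> f n"
      using M D(1) E(1) sv_pos[OF sv_c\<^sub>w u] by (simp add: ennreal_mult mult.assoc)
    also have "M * (D * E * (u powr \<theta> * c\<^sub>w u)) * (M * ?m powr \<delta>) = ?C * (?m powr \<delta> * (u powr \<theta> * c\<^sub>w u))"
      by (simp add: mult_ac)
    finally show ?thesis .
  qed
  then show ?thesis using M D(1) E(1) by (intro exI[of _ ?C]) auto
qed

text \<open>The Hardy-type estimate for the I-term and the J-term at once: \<open>T\<close> is \<open>I\<close> with \<open>R t u = (u < t)\<close>,
  or \<open>\<rho> * J\<close> with \<open>R t u = (t < u)\<close>.\<close>

lemma hardy:
  assumes d: "0 < \<delta>" "\<delta> \<le> 1"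
    and T: "\<exists>B>0. \<forall>t>0. \<forall>f N. N \<noteq> top \<longrightarrow> (\<forall>u>0. R t u \<longrightarrow> K u f \<le> N * ennreal (u powr e * c\<^sub>w u)) \<longrightarrow>
      T t f \<le> N * ennreal (B * (t powr e * c\<^sub>w t * \<chi>0 t))"
    and R: "\<And>t u. 0 < t \<Longrightarrow> 0 < u \<Longrightarrow> R t u \<Longrightarrow>
      max (u / t) (t / u) powr \<delta> * u powr \<theta> = t powr (\<theta> - e) * u powr e"
  shows "\<exists>C>0. \<forall>f. ell r (\<lambda>n. ennreal (w (x n)) * T (x n) f) \<le> ennreal C * ell r (EK f)"
proof -
  obtain C where C: "0 < C" "\<And>f n u. 0 < u \<Longrightarrow>
    K u f \<le> ennreal (C * (max (u / x n) (x n / u) powr \<delta> * (u powr \<theta> * c\<^sub>w u))) * HS \<delta> f n"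
    using K_le_HS[OF d] by blast
  obtain B where B: "0 < B" "\<And>t f N. 0 < t \<Longrightarrow> N \<noteq> top \<Longrightarrow> (\<forall>u>0. R t u \<longrightarrow> K u f \<le> N * ennreal (u powr e * c\<^sub>w u)) \<Longrightarrow>
    T t f \<le> N * ennreal (B * (t powr e * c\<^sub>w t * \<chi>0 t))"
    using T by blast
  obtain H where H: "0 < H" "\<And>f. ell r (HS \<delta> f) \<le> ennreal H * ell r (EK f)" using ell_HS[OF d(1)] by blast
  have le: "ennreal (w (x n)) * T (x n) f \<le> ennreal (C * B) * HS \<delta> f n" for f n
  \<comment> \<open>The bounds on T require a finite constant N.\<close>
  proof (cases "HS \<delta> f n = top")
    case True
    then show ?thesis using B(1) C(1) by (simp add: ennreal_mult_top)
  next
    case False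
    let ?t = "x n"
    have t: "0 < ?t" by (rule x.pos)
    \<comment> \<open>By R the bound on K splits into a power of t, constant in u, and the power of
      u for which T is controlled; the former joins N.\<close>
    let ?N = "HS \<delta> f n * ennreal (C * ?t powr (\<theta> - e))"
    have "T ?t f \<le> ?N * ennreal (B * (?t powr e * c\<^sub>w ?t * \<chi>0 ?t))"
    proof (rule B(2)[OF t])
      show "?N \<noteq> top" using False by (simp add: ennreal_mult_eq_top_iff)
      show "\<forall>u>0. R ?t u \<longrightarrow> K u f \<le> ?N * ennreal (u powr e * c\<^sub>w u)"
      proof (intro allI impI)
        fix u assume u: "0 < u" "R ?t u"
        have eq: "C * (max (u / ?t) (?t / u) powr \<delta> * (u powr \<theta> * c\<^sub>w u)) = (C * ?t powr (\<theta> - e)) * (u powr e * c\<^sub>w u)"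
          using R[OF t u] by (simp only: mult.assoc[symmetric])
        show "K u f \<le> ?N * ennreal (u powr e * c\<^sub>w u)"
          using C(2)[OF u(1), of f n] C(1) sv_pos[OF sv_c\<^sub>w u(1)] unfolding eq
          by (simp add: ennreal_mult mult_ac)
      qed
    qed
    then have "ennreal (w ?t) * T ?t f \<le> ennreal (w ?t) * (?N * ennreal (B * (?t powr e * c\<^sub>w ?t * \<chi>0 ?t)))"
      by (rule mult_left_mono) simp
    also have "\<dots> = ennreal (w ?t * ((C * ?t powr (\<theta> - e)) * (B * (?t powr e * c\<^sub>w ?t * \<chi>0 ?t)))) * HS \<delta> f n"
      using C(1) B(1) w_pos[OF t] sv_pos[OF sv_c\<^sub>w t] \<chi>_pos(1)[OF t] by (simp add: ennreal_mult mult_ac)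
    also have "w ?t * ((C * ?t powr (\<theta> - e)) * (B * (?t powr e * c\<^sub>w ?t * \<chi>0 ?t)))
        = C * B * (?t powr (- \<theta>) * (?t powr (\<theta> - e) * ?t powr e)) * (slow ?t * c\<^sub>w ?t * \<chi>0 ?t)"
      by (simp add: w_eq[OF t])
    \<comment> \<open>All powers of t cancel here, and \<open>c\<^sub>w\<close> was defined so that
      the slowly varying factors cancel next.\<close>
    also have "?t powr (- \<theta>) * (?t powr (\<theta> - e) * ?t powr e) = 1" using t by (simp flip: powr_add)
    also have "slow ?t * c\<^sub>w ?t * \<chi>0 ?t = 1"
      using sv_pos[OF sv_slow t] \<chi>_pos(1)[OF t] by (simp add: c\<^sub>w_def)
    finally show ?thesis by simp
  qed
  have "ell r (\<lambda>n. ennreal (w (x n)) * T (x n) f) \<le> ennreal (C * B * H) * ell r (EK f)" for f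
  proof (rule le_cmult_trans[OF _ H(2)])
    show "ell r (\<lambda>n. ennreal (w (x n)) * T (x n) f) \<le> ennreal (C * B) * ell r (HS \<delta> f)"
      by (rule ell_le_cmult[OF r]) (auto intro: le)
  qed (use B(1) C(1) in auto)
  then show ?thesis using B(1) C(1) H(1) by (intro exI[of _ "C * B * H"]) auto
qed

text \<open>For u < t the loss (t/u)^\<delta> with \<delta> = \<theta>/2 takes half of u^\<theta>.
  The remaining u^(\<theta>/2) is the positive power demanded by \<open>I_bound\<close>.\<close>

lemma hardy_EI:
  assumes "0 < \<theta>" shows "\<exists>C>0. \<forall>f. ell r (EI f) \<le> ennreal C * ell r (EK f)"
  unfolding EI_def
proof (rule hardy[where R = "\<lambda>t u. u < t" and e = "\<theta> / 2" and \<delta> = "\<theta> / 2"])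
  show "\<exists>B>0. \<forall>t>0. \<forall>f N. N \<noteq> top \<longrightarrow> (\<forall>u>0. u < t \<longrightarrow> K u f \<le> N * ennreal (u powr (\<theta> / 2) * c\<^sub>w u)) \<longrightarrow>
      I t f \<le> N * ennreal (B * (t powr (\<theta> / 2) * c\<^sub>w t * \<chi>0 t))"
    using I_bound[OF _ sv_c\<^sub>w, of "\<theta> / 2"] assms by simp
  fix t u :: real assume tu: "0 < t" "0 < u" "u < t"
  then have "max (u / t) (t / u) = t / u"
    using mult_mono[of u t u t] by (intro max_absorb2) (simp add: field_simps)
  moreover have "u powr \<theta> = u powr (\<theta> / 2) * u powr (\<theta> / 2)" by (simp flip: powr_add)
  ultimately show "max (u / t) (t / u) powr (\<theta> / 2) * u powr \<theta> = t powr (\<theta> - \<theta> / 2) * u powr (\<theta> / 2)"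
    using tu by (simp add: powr_divide)
qed (use assms \<theta> in auto)

text \<open>For u > t the loss (u/t)^\<delta> raises the exponent from \<theta> to \<theta> +
  \<delta>. With \<delta> = (1 - \<theta>)/2 this equals 1 - \<delta>, the form demanded by
  \<open>J_bound\<close>.\<close>

lemma hardy_EJ:
  assumes "\<theta> < 1" shows "\<exists>C>0. \<forall>f. ell r (EJ f) \<le> ennreal C * ell r (EK f)"
proof -
  let ?\<delta> = "(1 - \<theta>) / 2"
  have EJ: "EJ f = (\<lambda>n. ennreal (w (x n)) * (ennreal (\<rho> (x n)) * J (x n) f))" for f
    using w_pos[OF x.pos] \<rho>_pos[OF x.pos] by (auto simp: EJ_def ennreal_mult less_imp_le mult.assoc)
  obtain B where B: "0 < B" "\<And>t f N. 0 < t \<Longrightarrow> N \<noteq> top \<Longrightarrow> (\<forall>v>t. K v f \<le> N * ennreal (v powr (1 - ?\<delta>) * c\<^sub>w v)) \<Longrightarrow>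
    J t f \<le> N * ennreal (B * (t powr (- ?\<delta>) * c\<^sub>w t * \<chi>1 t))"
    using J_bound[OF _ sv_c\<^sub>w, of ?\<delta>] assms by auto
  have T: "ennreal (\<rho> t) * J t f \<le> N * ennreal (B * (t powr (1 - ?\<delta>) * c\<^sub>w t * \<chi>0 t))"
    if t: "0 < t" and N: "N \<noteq> top" and le: "\<forall>u>0. t < u \<longrightarrow> K u f \<le> N * ennreal (u powr (1 - ?\<delta>) * c\<^sub>w u)" for t f N
  proof -
    let ?b = "B * (t powr (- ?\<delta>) * c\<^sub>w t * \<chi>1 t)"
    have "ennreal (\<rho> t) * J t f \<le> ennreal (\<rho> t) * (N * ennreal ?b)"
      using le t by (intro mult_left_mono B(2)[OF t N]) auto
    also have "\<dots> = N * ennreal (\<rho> t * ?b)" 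
      unfolding ennreal_mult'[OF less_imp_le[OF \<rho>_pos[OF t]]] by (simp only: mult.left_commute)
    also have "\<rho> t * ?b = B * ((t * t powr (- ?\<delta>)) * c\<^sub>w t * \<chi>0 t)" using t \<chi>_pos[OF t] by (simp add: \<rho>)
    also have "t * t powr (- ?\<delta>) = t powr (1 - ?\<delta>)" using t powr_add[of t 1 "- ?\<delta>"] by simp
    finally show ?thesis .
  qed
  show ?thesis
    unfolding EJ
  proof (rule hardy[where R = "\<lambda>t u. t < u" and e = "1 - ?\<delta>" and \<delta> = ?\<delta>])
    fix t u :: real assume tu: "0 < t" "0 < u" "t < u"
    then have "max (u / t) (t / u) = u / t"
      using mult_mono[of t u t u] by (intro max_absorb1) (simp add: field_simps)
    moreover have "u powr (1 - ?\<delta>) = u powr ?\<delta> * u powr \<theta>" by (simp add: field_simps flip: powr_add)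
    moreover have "\<theta> - (1 - ?\<delta>) = - ?\<delta>" by (simp add: field_simps)
    then have "t powr (\<theta> - (1 - ?\<delta>)) = 1 / t powr ?\<delta>" by (simp only: powr_minus_divide)
    ultimately show "max (u / t) (t / u) powr ?\<delta> * u powr \<theta> = t powr (\<theta> - (1 - ?\<delta>)) * u powr (1 - ?\<delta>)"
      using tu by (simp add: powr_divide)
  qed (use assms \<theta> B(1) T in \<open>auto intro!: exI[of _ B]\<close>)
qed

section \<open>From norm estimates to equality of spaces\<close>

lemma EK_le_target:
  assumes T: "\<And>f. TK f \<le> T f" and E: "\<exists>C>0. \<forall>f. ell r (E f) \<le> ennreal C * ell r (EK f)"
  shows "\<exists>C>0. \<forall>f. ell r (E f) \<le> ennreal C * T f"
proof -
  obtain C where C: "0 < C" "\<And>f. ell r (E f) \<le> ennreal C * ell r (EK f)" using E by blast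
  obtain D where D: "0 < D" "\<And>f. ell r (EK f) \<le> ennreal D * TK f" using ell_EK by blast
  have "ell r (E f) \<le> ennreal (C * D) * T f" for f
    using order_trans[OF le_cmult_trans[OF C(2) D(2) less_imp_le[OF C(1)]] mult_left_mono[OF T]] by simp
  then show ?thesis using C D by (intro exI[of _ "C * D"]) auto
qed

lemma LHS_le_target:
  assumes T: "\<And>f. TK f \<le> T f"
    and EI: "\<exists>C>0. \<forall>f. ell r (EI f) \<le> ennreal C * T f" and EJ: "\<exists>C>0. \<forall>f. ell r (EJ f) \<le> ennreal C * T f"
  shows "\<exists>C>0. \<forall>f\<in>A01. LHS f \<le> ennreal C * T f"
proof -
  obtain C where C: "0 < C" "\<And>f. f \<in> A01 \<Longrightarrow> LHS f \<le> ennreal C * (ell r (EI f) + ell r (EK f) + ell r (EJ f))"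
    using LHS_le by blast
  obtain CI where CI: "0 < CI" "\<And>f. ell r (EI f) \<le> ennreal CI * T f" using EI by blast
  obtain CJ where CJ: "0 < CJ" "\<And>f. ell r (EJ f) \<le> ennreal CJ * T f" using EJ by blast
  obtain CK where CK: "0 < CK" "\<And>f. ell r (EK f) \<le> ennreal CK * TK f" using ell_EK by blast
  have "ell r (EK f) \<le> ennreal CK * T f" for f
    using order_trans[OF CK(2) mult_left_mono[OF T]] by simp
  then have "LHS f \<le> ennreal (C * (CI + CK + CJ)) * T f" if "f \<in> A01" for f
    using CI CJ CK(1) C(1) that by (intro le_cmult_trans[OF C(2)] add_le_cmult) auto
  then show ?thesis using C(1) CI(1) CJ(1) CK(1) by (intro exI[of _ "C * (CI + CK + CJ)"]) auto
qed

lemma LHS_space: "interp_space X0 X1 \<theta> r a = finite_part X0 X1 LHS"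
  unfolding interp_space_def[of X0 X1 \<theta> r a] Lnorm_eq_Nrm LHS_def[abs_def] KX_def ..

text \<open>Membership in X0 + X1 need not be shown separately: a finite norm has a finite value of
  K at some u, and that already provides a decomposition.\<close>

lemma LHS_finite_imp: "LHS f < top \<Longrightarrow> f \<in> elems X0 + elems X1"
proof -
  assume "LHS f < top"
  then have "\<exists>u\<in>{1<..<2 * 1}. ennreal (u powr (- \<theta>) * a u) * KX u f < top"
    unfolding LHS_def by (intro Nrm_finite_imp_ex[OF r, where S = "{0<..}"]) auto
  then obtain u where u: "1 < u" "ennreal (u powr (- \<theta>) * a u) * KX u f < top" by auto
  then have "KX u f < top" using sv_pos[OF sv_a, of u] by (auto simp: ennreal_mult_less_top)
  then show ?thesis unfolding KX_def by (rule K_fun_finite_imp)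
qed

lemma X_sum_subset: "elems X0 + elems X1 \<subseteq> A01"
proof
  fix h assume "h \<in> elems X0 + elems X1"
  then obtain f g where "f \<in> elems X0" "g \<in> elems X1" "h = f + g" by (rule set_plus_elim)
  then show "h \<in> A01" by (simp add: X0_simps X1_simps sum_add)
qed

text \<open>T is \<open>TK\<close> alone or its maximum with \<open>TI\<close> or \<open>TJ\<close>.
  A term absent from T has to be recovered from the K-term by the Hardy estimate.\<close>

lemma same_space_target:
  assumes T: "\<And>f. TK f \<le> T f"
    and EI: "\<exists>C>0. \<forall>f. ell r (EI f) \<le> ennreal C * T f" and EJ: "\<exists>C>0. \<forall>f. ell r (EJ f) \<le> ennreal C * T f"
    and le: "\<And>f. T f \<le> max (TK f) (max (TI f) (TJ f))"
    and Z: "Z = finite_part A0 A1 T"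
  shows "same_space (interp_space X0 X1 \<theta> r a) Z"
proof -
  obtain C where C: "0 < C" "\<And>f. f \<in> A01 \<Longrightarrow> LHS f \<le> ennreal C * T f"
    using LHS_le_target[OF T EI EJ] by blast
  obtain D where D: "\<And>f. TI f \<le> ennreal D * LHS f" "\<And>f. TK f \<le> ennreal D * LHS f" "\<And>f. TJ f \<le> ennreal D * LHS f"
    using targets_le_LHS by blast
  have T_le: "T f \<le> ennreal D * LHS f" for f using le[of f] D[of f] by (auto intro: order_trans)
  have "embedded (finite_part X0 X1 LHS) (finite_part A0 A1 T)"
    unfolding embedded_def finite_part_def using X_sum_subset T_le
    by (auto intro!: exI[of _ D] intro: le_less_trans[OF T_le] simp: ennreal_mult_less_top)
  moreover have "embedded (finite_part A0 A1 T) (finite_part X0 X1 LHS)"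
    unfolding embedded_def finite_part_def using C(2)
    by (auto intro!: exI[of _ C] LHS_finite_imp intro: le_less_trans[OF C(2)] simp: ennreal_mult_less_top)
  ultimately show ?thesis unfolding LHS_space Z same_space_def by blast
qed

text \<open>The weights agree exactly, not only up to equivalence: \<rho>^(-\<theta>) contributes
  u^(-\<theta>) (\<chi>1/\<chi>0)^\<theta>, and the remaining \<chi>0 turns this into
  \<chi>0^(1-\<theta>) \<chi>1^\<theta>.\<close>

lemma TK_space:
  assumes "\<And>t. 0 < t \<Longrightarrow> as t = \<chi>0 t powr (1 - \<theta>) * \<chi>1 t powr \<theta> * a (\<rho> t)"
  shows "interp_space A0 A1 \<theta> r as = finite_part A0 A1 TK"
proof -
  have eq: "u powr (- \<theta>) * as u = w u * \<chi>0 u" if u: "0 < u" for u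
  proof -
    have pos: "0 < \<chi>0 u" "0 < \<chi>1 u" using \<chi>_pos[OF u] by auto
    have "\<chi>0 u = \<chi>0 u powr (1 - \<theta>) * \<chi>0 u powr \<theta>" using pos by (simp flip: powr_add)
    then have "w u * \<chi>0 u = (u * (\<chi>0 u / \<chi>1 u)) powr (- \<theta>) * a (\<rho> u) * (\<chi>0 u powr (1 - \<theta>) * \<chi>0 u powr \<theta>)"
      by (simp add: w_def \<rho>[OF u])
    also have "(u * (\<chi>0 u / \<chi>1 u)) powr (- \<theta>) = u powr (- \<theta>) * (\<chi>1 u powr \<theta> / \<chi>0 u powr \<theta>)"
      using pos u by (simp add: powr_mult powr_divide powr_minus_divide)
    finally show ?thesis using pos by (simp add: assms[OF u])
  qed
  have "Nrm r {0<..} (\<lambda>u. ennreal (u powr (- \<theta>) * as u) * K u f) = TK f" for f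
    unfolding TK_def by (intro Nrm_cong r) (auto simp: eq)
  then show ?thesis unfolding interp_space_def Lnorm_eq_Nrm by simp
qed

lemma interior_case:
  assumes "0 < \<theta>" "\<theta> < 1" "\<And>t. 0 < t \<Longrightarrow> as t = \<chi>0 t powr (1 - \<theta>) * \<chi>1 t powr \<theta> * a (\<rho> t)"
  shows "same_space (interp_space X0 X1 \<theta> r a) (interp_space A0 A1 \<theta> r as)"
  by (rule same_space_target[where T = TK])
    (auto intro!: EK_le_target hardy_EI hardy_EJ assms TK_space)

text \<open>At \<theta> = 0 there is no power of u to absorb the I-term, so its norm stays as the
  L-space; the J-term is still covered by \<open>hardy_EJ\<close>.\<close>

lemma left_endpoint_case:
  assumes "\<theta> = 0" "\<And>t. 0 < t \<Longrightarrow> as t = \<chi>0 t powr (1 - \<theta>) * \<chi>1 t powr \<theta> * a (\<rho> t)"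
  shows "same_space (interp_space X0 X1 0 r a)
    (inter_space (interp_space A0 A1 0 r as) (L_space A0 A1 0 r (a \<circ> \<rho>) r0 b0))"
proof -
  have "Lnorm r {0<..} (\<lambda>t. ennreal (t powr (- recip r) * (a \<circ> \<rho>) t) *
      Lnorm r0 {0<..<t} (\<lambda>u. ennreal (u powr (- 0 - recip r0) * b0 u) * K u f)) = TI f" for f
  proof -
    have I: "Lnorm r0 {0<..<t} (\<lambda>u. ennreal (u powr (- 0 - recip r0) * b0 u) * K u f) = I t f" for t
      unfolding Lnorm_eq_Nrm I_def by (intro Nrm_cong r0) auto
    have "TI f = Nrm r {0<..} (\<lambda>t. ennreal (a (\<rho> t)) * I t f)"
      unfolding TI_def w_def unfolding assms(1) by (intro Nrm_cong r) (auto dest: \<rho>_pos)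
    then show ?thesis unfolding I by (simp add: Nrm_def ennreal_mult' mult.assoc)
  qed
  then have "L_space A0 A1 0 r (a \<circ> \<rho>) r0 b0 = finite_part A0 A1 TI" by (simp add: L_space_def)
  then have Y: "inter_space (interp_space A0 A1 0 r as) (L_space A0 A1 0 r (a \<circ> \<rho>) r0 b0)
      = finite_part A0 A1 (\<lambda>f. max (TK f) (TI f))"
    using TK_space[OF assms(2)] by (simp add: inter_finite_part assms(1))
  obtain C where C: "0 < C" "\<And>f. ell r (EI f) \<le> ennreal C * TI f" using ell_EI by blast
  have "ell r (EI f) \<le> ennreal C * max (TK f) (TI f)" for f
    by (rule order_trans[OF C(2) mult_left_mono]) auto
  then have EI: "\<exists>C>0. \<forall>f. ell r (EI f) \<le> ennreal C * max (TK f) (TI f)" using C(1) by blast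
  have "same_space (interp_space X0 X1 \<theta> r a) (finite_part A0 A1 (\<lambda>f. max (TK f) (TI f)))"
    by (rule same_space_target[OF _ EI _ _ refl], simp, rule EK_le_target[OF _ hardy_EJ])
      (auto simp: assms(1) max_def)
  then show ?thesis unfolding Y unfolding assms(1) .
qed

text \<open>At \<theta> = 1 the J-term stays as the LR-space, its weight w \<rho> being just
  a(\<rho>(t)); the I-term is covered by \<open>hardy_EI\<close>.\<close>

lemma right_endpoint_case:
  assumes "\<theta> = 1" "\<And>t. 0 < t \<Longrightarrow> as t = \<chi>0 t powr (1 - \<theta>) * \<chi>1 t powr \<theta> * a (\<rho> t)"
  shows "same_space (interp_space X0 X1 1 r a)
    (inter_space (interp_space A0 A1 1 r as) (LR_space A0 A1 1 r (a \<circ> \<rho>) r1 b1 q1 a1))"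
proof -
  have "Lnorm r {0<..} (\<lambda>t. ennreal (t powr (- recip r) * (a \<circ> \<rho>) t) *
      Lnorm r1 {t<..} (\<lambda>u. ennreal (u powr (- recip r1) * b1 u) *
        Lnorm q1 {t<..<u} (\<lambda>v. ennreal (v powr (- 1 - recip q1) * a1 v) * K v f))) = TJ f" for f
  proof -
    have J: "Lnorm r1 {t<..} (\<lambda>u. ennreal (u powr (- recip r1) * b1 u) *
        Lnorm q1 {t<..<u} (\<lambda>v. ennreal (v powr (- 1 - recip q1) * a1 v) * K v f)) = J t f" if "0 < t" for t
      unfolding J_def Nrm_def Jin_eq[OF less_imp_le[OF that]] by (simp add: ennreal_mult' mult.assoc)
    have "TJ f = Nrm r {0<..} (\<lambda>t. ennreal (a (\<rho> t)) * J t f)"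
      unfolding TJ_def w_def unfolding assms(1) by (intro Nrm_cong r) (auto dest: \<rho>_pos simp: powr_minus_divide)
    also have "\<dots> = Nrm r {0<..} (\<lambda>t. ennreal (a (\<rho> t)) *
      Lnorm r1 {t<..} (\<lambda>u. ennreal (u powr (- recip r1) * b1 u) *
        Lnorm q1 {t<..<u} (\<lambda>v. ennreal (v powr (- 1 - recip q1) * a1 v) * K v f)))"
      by (intro Nrm_cong r) (simp_all add: J)
    finally show ?thesis by (simp add: Nrm_def ennreal_mult' mult.assoc)
  qed
  then have "LR_space A0 A1 1 r (a \<circ> \<rho>) r1 b1 q1 a1 = finite_part A0 A1 TJ" by (simp add: LR_space_def)
  then have Y: "inter_space (interp_space A0 A1 1 r as) (LR_space A0 A1 1 r (a \<circ> \<rho>) r1 b1 q1 a1)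
      = finite_part A0 A1 (\<lambda>f. max (TK f) (TJ f))"
    using TK_space[OF assms(2)] by (simp add: inter_finite_part assms(1))
  obtain C where C: "0 < C" "\<And>f. ell r (EJ f) \<le> ennreal C * TJ f" using ell_EJ by blast
  have "ell r (EJ f) \<le> ennreal C * max (TK f) (TJ f)" for f
    by (rule order_trans[OF C(2) mult_left_mono]) auto
  then have EJ: "\<exists>C>0. \<forall>f. ell r (EJ f) \<le> ennreal C * max (TK f) (TJ f)" using C(1) by blast
  have "same_space (interp_space X0 X1 \<theta> r a) (finite_part A0 A1 (\<lambda>f. max (TK f) (TJ f)))"
    by (rule same_space_target[OF _ _ EJ _ refl], simp, rule EK_le_target[OF _ hardy_EI])
      (auto simp: assms(1) max_def)
  then show ?thesis unfolding Y unfolding assms(1) .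
qed

end

theorem theorem27:
  fixes A0 A1 :: "'v::real_vector qspace"
    and q1 r1 r r0 :: ennreal
    and a1 b1 a b0 :: "real \<Rightarrow> real"
    and \<chi>0 \<chi>1 \<rho> :: "real \<Rightarrow> real"
    and asharp :: "real \<Rightarrow> real \<Rightarrow> real"
    and X0 X1 :: "'v qspace"
  assumes "quasi_banach A0" and "quasi_banach A1" and "compatible_couple A0 A1"
    and "elems A0 \<inter> elems A1 \<noteq> {0}"
    and "0 < q1" and "0 < r1" and "a1 \<in> SV" and "b1 \<in> SV"
    and "wnorm r1 b1 {1<..} < top"
    and "wnorm2 r1 b1 q1 a1 1 < top"
    and \<chi>1: "\<And>t. t > 0 \<Longrightarrow>
      \<chi>1 t = enn2real (wnorm2 r1 b1 q1 a1 t + wnorm r1 b1 {t<..} * wnorm q1 a1 {0<..<t})"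
    and "0 < r" and "0 < r0" and "a \<in> SV" and "b0 \<in> SV"
    and "wnorm r0 b0 {1<..} < top"
    and \<chi>0: "\<And>t. t > 0 \<Longrightarrow> \<chi>0 t = enn2real (wnorm r0 b0 {t<..})"
    and \<rho>: "\<And>t. t > 0 \<Longrightarrow> \<rho> t = t * (\<chi>0 t / \<chi>1 t)"
    and asharp: "\<And>\<theta> t. 0 \<le> \<theta> \<Longrightarrow> \<theta> \<le> 1 \<Longrightarrow> t > 0 \<Longrightarrow>
      asharp \<theta> t = \<chi>0 t powr (1 - \<theta>) * \<chi>1 t powr \<theta> * a (\<rho> t)"
    and X0: "X0 = interp_space A0 A1 0 r0 b0"
    and X1: "X1 = L_space A0 A1 1 r1 b1 q1 a1"
  shows
    "(\<forall>\<theta>. 0 < \<theta> \<and> \<theta> < 1 \<longrightarrow>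
        same_space (interp_space X0 X1 \<theta> r a) (interp_space A0 A1 \<theta> r (asharp \<theta>))) \<and>
     (wnorm r a {1<..} < top \<longrightarrow>
        same_space (interp_space X0 X1 0 r a)
          (inter_space (interp_space A0 A1 0 r (asharp 0))
                       (L_space A0 A1 0 r (a \<circ> \<rho>) r0 b0))) \<and>
     (wnorm r a {0<..<1} < top \<longrightarrow>
        same_space (interp_space X0 X1 1 r a)
          (inter_space (interp_space A0 A1 1 r (asharp 1))
                       (LR_space A0 A1 1 r (a \<circ> \<rho>) r1 b1 q1 a1)))"
proof -
  have holm: "holmstedt A0 A1 q1 r1 r0 a1 b1 b0 \<chi>0 \<chi>1 \<rho>"
    using assms by (auto simp: quasi_banach_def intro!: holmstedt.intro couple.intro holmstedt_axioms.intro)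
  have reit: "reiteration A0 A1 q1 r1 r0 a1 b1 b0 \<chi>0 \<chi>1 \<rho> r a \<theta>" if "0 \<le> \<theta>" "\<theta> \<le> 1" for \<theta>
    using holm assms(12) SV_imp_sv[OF assms(14)] that by (intro reiteration.intro reiteration_axioms.intro)
  show ?thesis
  proof (intro conjI allI impI)
    fix \<theta> :: real assume "0 < \<theta> \<and> \<theta> < 1"
    then show "same_space (interp_space X0 X1 \<theta> r a) (interp_space A0 A1 \<theta> r (asharp \<theta>))"
      unfolding X0 X1 by (intro reiteration.interior_case[OF reit] asharp) auto
  next
    show "same_space (interp_space X0 X1 0 r a)
        (inter_space (interp_space A0 A1 0 r (asharp 0)) (L_space A0 A1 0 r (a \<circ> \<rho>) r0 b0))"
      unfolding X0 X1 by (intro reiteration.left_endpoint_case[OF reit[of 0]] asharp) auto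
  next
    show "same_space (interp_space X0 X1 1 r a)
        (inter_space (interp_space A0 A1 1 r (asharp 1)) (LR_space A0 A1 1 r (a \<circ> \<rho>) r1 b1 q1 a1))"
      unfolding X0 X1 by (intro reiteration.right_endpoint_case[OF reit[of 1]] asharp) auto
  qed
qed

end
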